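(* Let $G$ be a graded nilpotent Lie group and let $\sigma\in\mathcal A_0$. If $\sigma$ is non-negative (that is, $\sigma(x,\pi)\ge0$ for almost all $(x,\pi)\in G\times\widehat G$), then there exists a constant $C>0$ such that $$\forall f\in L^2(G),\ \forall\varepsilon\in(0,1],\qquad \Re\big(\mathrm{Op}_\varepsilon(\sigma)f,f\big)_{L^2(G)}\ \ge\ -C\,\varepsilon\,\|f\|_{L^2(G)}^2 .$$
   Context: Graded group: a connected simply connected nilpotent Lie group $G$ whose Lie algebra is $\mathfrak g=\oplus_{j\ge1}\mathfrak g_j$ (finitely many non-zero terms) with $[\mathfrak g_i,\mathfrak g_j]\subseteq\mathfrak g_{i+j}$. Points of $G$ are identified with $\mathbb R^n$ via the exponential map and a basis $X_1,\dots,X_n$ of $\mathfrak g$ adapted to the gradation, with weights $\upsilon_1\le\dots\le\upsilon_n$ ($X_j\in\mathfrak g_{\upsilon_j}$). Dilations: $\delta_r(x)=(r^{\upsilon_1}x_1,\dots,r^{\upsilon_n}x_n)$, $r>0$; homogeneous dimension $Q=\sum_j\upsilon_j$. $dx$ is the Haar measure, $\mathcal S(G)$ the Schwartz space, $(f_1*f_2)(x)=\int_Gf_1(y)f_2(y^{-1}x)dy$. $\widehat G$ is the set of classes of irreducible unitary representations $\pi$ of $G$ on $\mathcal H_\pi$, equipped with the Plancherel measure $\mu$, and $\mathcal F f(\pi)=\int_Gf(y)\pi(y)^*dy$. Dilations act on $\widehat G$ by $(\delta_r\pi)(x)=\pi(\delta_rx)$. $\mathcal A_0$ is the space of symbols $\sigma=\{\sigma(x,\pi):(x,\pi)\in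 G\times\widehat G\}$ of the form $\sigma(x,\pi)=\mathcal F\kappa_x(\pi)=\int_G\kappa_x(y)\pi(y)^*dy$ with $x\mapsto\kappa_x$ in $C_c^\infty(G,\mathcal S(G))$ (smooth and compactly supported in $x$, Schwartz-valued). For $\varepsilon\in(0,1]$, $\mathrm{Op}_\varepsilon(\sigma)=\mathrm{Op}^{\mathrm{KN}}(\sigma(\cdot,\delta_\varepsilon\,\cdot))$, i.e. $\mathrm{Op}_\varepsilon(\sigma)f(x)=f*\kappa_x^{(\varepsilon)}(x)$ with $\kappa_x^{(\varepsilon)}(y)=\varepsilon^{-Q}\kappa_x(\delta_{\varepsilon}^{-1}y)$; these operators are bounded on $L^2(G)$. *)

theory Defs
  imports "HOL-Analysis.Analysis"
begin

text \<open>Smooth functions and Schwartz functions on a Euclidean space.\<close>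

definition partial :: "'a::euclidean_space \<Rightarrow> ('a \<Rightarrow> 'b::real_normed_vector) \<Rightarrow> 'a \<Rightarrow> 'b" where
  "partial b f x = vector_derivative (\<lambda>t. f (x + t *\<^sub>R b)) (at 0)"

primrec partials :: "'a::euclidean_space list \<Rightarrow> ('a \<Rightarrow> 'b::real_normed_vector) \<Rightarrow> 'a \<Rightarrow> 'b" where
  "partials [] f = f"
| "partials (b # bs) f = partial b (partials bs f)"

definition smooth :: "('a::euclidean_space \<Rightarrow> 'b::real_normed_vector) \<Rightarrow> bool" where
  "smooth f \<longleftrightarrow> (\<forall>bs\<in>lists Basis. \<forall>x. partials bs f differentiable (at x))"

definition schwartz :: "('a::euclidean_space \<Rightarrow> complex) set" where
  "schwartz = {f. smooth f \<and>
     (\<forall>N. \<forall>bs\<in>lists Basis. bounded (range (\<lambda>x. (1 + norm x) ^ N *\<^sub>R partials bs f x)))}"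

definition schwartz_seminorm :: "nat \<Rightarrow> 'a::euclidean_space list \<Rightarrow> ('a \<Rightarrow> complex) \<Rightarrow> real" where
  "schwartz_seminorm N bs f = (SUP x. (1 + norm x) ^ N * norm (partials bs f x))"

definition schwartz_tendsto ::
    "('c \<Rightarrow> 'a::euclidean_space \<Rightarrow> complex) \<Rightarrow> ('a \<Rightarrow> complex) \<Rightarrow> 'c filter \<Rightarrow> bool" where
  "schwartz_tendsto g l F \<longleftrightarrow>
     (\<forall>N. \<forall>bs\<in>lists Basis. ((\<lambda>t. schwartz_seminorm N bs (\<lambda>y. g t y - l y)) \<longlongrightarrow> 0) F)"

text \<open>Smooth compactly supported maps into the Frechet space of Schwartz functions:
  \<open>D bs\<close> is the iterated partial derivative of \<open>\<kappa>\<close> in the directions \<open>bs\<close>, the limits of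
  difference quotients and the continuity being taken in the Schwartz topology.\<close>

definition Cc_schwartz :: "('a::euclidean_space \<Rightarrow> 'a \<Rightarrow> complex) set" where
  "Cc_schwartz = {\<kappa>.
     (\<exists>K. compact K \<and> (\<forall>x. x \<notin> K \<longrightarrow> \<kappa> x = (\<lambda>y. 0))) \<and>
     (\<exists>D. D [] = \<kappa> \<and>
        (\<forall>bs\<in>lists Basis. \<forall>x.
           D bs x \<in> schwartz \<and>
           schwartz_tendsto (D bs) (D bs x) (at x) \<and>
           (\<forall>b\<in>Basis. schwartz_tendsto
              (\<lambda>t y. (D bs (x + t *\<^sub>R b) y - D bs x y) / complex_of_real t) (D (b # bs) x) (at 0))))}"

text \<open>Graded groups in exponential coordinates.  The group is \<open>\<real>\<^sup>n\<close> with a smooth group law \<open>m\<close>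
  for which every line \<open>t \<mapsto> t x\<close> is a one-parameter subgroup, i.e. the exponential map
  is the identity.  The Lie bracket of the tangent space at 0 is
  \<open>[x, y] = d/ds d/dt (sx)(ty)(sx)\<inverse>\<close> at \<open>s = t = 0\<close>.  Nilpotency is a consequence
  of the gradation, all weights being positive.\<close>

definition lie_bracket :: "('a::euclidean_space \<Rightarrow> 'a \<Rightarrow> 'a) \<Rightarrow> 'a \<Rightarrow> 'a \<Rightarrow> 'a" where
  "lie_bracket m x y =
     vector_derivative (\<lambda>s. vector_derivative
       (\<lambda>t. m (m (s *\<^sub>R x) (t *\<^sub>R y)) (- (s *\<^sub>R x))) (at 0)) (at (0::real))"

definition layer :: "('n::finite \<Rightarrow> nat) \<Rightarrow> nat \<Rightarrow> (real^'n) set" where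
  "layer \<upsilon> k = span {axis j 1 | j. \<upsilon> j = k}"

definition graded_group ::
    "('n::{finite,linorder} \<Rightarrow> nat) \<Rightarrow>
      ((real, 'n) vec \<Rightarrow> (real, 'n) vec \<Rightarrow> (real, 'n) vec) \<Rightarrow> bool" where
  "graded_group \<upsilon> m \<longleftrightarrow>
     (\<forall>j. 1 \<le> \<upsilon> j) \<and> mono \<upsilon> \<and>
     smooth (\<lambda>p. m (fst p) (snd p)) \<and>
     (\<forall>x y z. m (m x y) z = m x (m y z)) \<and>
     (\<forall>x. m 0 x = x \<and> m x 0 = x) \<and>
     (\<forall>x. m (- x) x = 0 \<and> m x (- x) = 0) \<and>
     (\<forall>s t x. m (s *\<^sub>R x) (t *\<^sub>R x) = (s + t) *\<^sub>R x) \<and>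
     (\<forall>i j. \<forall>x\<in>layer \<upsilon> i. \<forall>y\<in>layer \<upsilon> j. lie_bracket m x y \<in> layer \<upsilon> (i + j))"

definition dil :: "('n::finite \<Rightarrow> nat) \<Rightarrow> real \<Rightarrow> real^'n \<Rightarrow> real^'n" where
  "dil \<upsilon> r x = (\<chi> j. r ^ \<upsilon> j * x $ j)"

text \<open>In exponential coordinates Haar measure is Lebesgue measure, and \<open>y\<inverse> = - y\<close>.\<close>

definition conv :: "('a::euclidean_space \<Rightarrow> 'a \<Rightarrow> 'a) \<Rightarrow> ('a \<Rightarrow> complex) \<Rightarrow> ('a \<Rightarrow> complex) \<Rightarrow> 'a \<Rightarrow> complex" where
  "conv m f g x = (LINT y|lborel. f y * g (m (- y) x))"

definition L1 :: "('a::euclidean_space \<Rightarrow> complex) set" where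
  "L1 = {f. f \<in> borel_measurable lborel \<and> integrable lborel f}"

definition L2 :: "('a::euclidean_space \<Rightarrow> complex) set" where
  "L2 = {f. f \<in> borel_measurable lborel \<and> integrable lborel (\<lambda>x. (cmod (f x))\<^sup>2)}"

definition L2_inner :: "('a::euclidean_space \<Rightarrow> complex) \<Rightarrow> ('a \<Rightarrow> complex) \<Rightarrow> complex" where
  "L2_inner f g = (LINT x|lborel. f x * cnj (g x))"

definition L2_norm :: "('a::euclidean_space \<Rightarrow> complex) \<Rightarrow> real" where
  "L2_norm f = sqrt (LINT x|lborel. (cmod (f x))\<^sup>2)"

text \<open>Every separable complex Hilbert space is isometric to \<open>ell2 {..<d}\<close> or \<open>ell2 UNIV\<close>,
  and irreducible unitary representations of a second countable group act on separable spaces.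
  The Hilbert spaces below are therefore taken to be these models.\<close>

type_synonym hvec = "nat \<Rightarrow> complex"

definition ell2 :: "nat set \<Rightarrow> hvec set" where
  "ell2 I = {v. (\<forall>n. n \<notin> I \<longrightarrow> v n = 0) \<and> summable (\<lambda>n. (cmod (v n))\<^sup>2)}"

definition ell2_inner :: "hvec \<Rightarrow> hvec \<Rightarrow> complex" where
  "ell2_inner v w = (\<Sum>n. v n * cnj (w n))"

definition ell2_norm :: "hvec \<Rightarrow> real" where
  "ell2_norm v = sqrt (\<Sum>n. (cmod (v n))\<^sup>2)"

definition unit_vec :: "nat \<Rightarrow> hvec" where
  "unit_vec j = (\<lambda>n. if n = j then 1 else 0)"

definition linear_on_ell2 :: "nat set \<Rightarrow> (hvec \<Rightarrow> hvec) \<Rightarrow> bool" where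
  "linear_on_ell2 I T \<longleftrightarrow> (\<forall>v\<in>ell2 I. \<forall>w\<in>ell2 I. \<forall>a b.
     T (\<lambda>n. a * v n + b * w n) = (\<lambda>n. a * T v n + b * T w n))"

definition closed_subspace :: "nat set \<Rightarrow> hvec set \<Rightarrow> bool" where
  "closed_subspace I W \<longleftrightarrow> W \<subseteq> ell2 I \<and> (\<lambda>n. 0) \<in> W \<and>
     (\<forall>v\<in>W. \<forall>w\<in>W. \<forall>a b. (\<lambda>n. a * v n + b * w n) \<in> W) \<and>
     (\<forall>v\<in>ell2 I. (\<forall>e>0. \<exists>w\<in>W. ell2_norm (\<lambda>n. v n - w n) < e) \<longrightarrow> v \<in> W)"

text \<open>The adjoint of a bounded operator, written through its coefficients
  \<open>\<langle>T* v, e\<^sub>n\<rangle> = \<langle>v, T e\<^sub>n\<rangle>\<close>.\<close>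

definition adj :: "nat set \<Rightarrow> (hvec \<Rightarrow> hvec) \<Rightarrow> hvec \<Rightarrow> hvec" where
  "adj I T v = (\<lambda>n. if n \<in> I then ell2_inner v (T (unit_vec n)) else 0)"

definition nonneg_op :: "nat set \<Rightarrow> (hvec \<Rightarrow> hvec) \<Rightarrow> bool" where
  "nonneg_op I T \<longleftrightarrow> (\<forall>v\<in>ell2 I. ell2_inner (T v) v \<in> \<real>\<^sub>\<ge>\<^sub>0)"

definition hs_norm_sq :: "nat set \<Rightarrow> (hvec \<Rightarrow> hvec) \<Rightarrow> ennreal" where
  "hs_norm_sq I T = (\<integral>\<^sup>+ j. ennreal ((ell2_norm (T (unit_vec j)))\<^sup>2) \<partial>count_space I)"

text \<open>A representation \<open>(I, U)\<close> acts on \<open>ell2 I\<close>; its operators are extended by 0 outside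
  \<open>ell2 I\<close>, so that each representation has exactly one encoding.\<close>

type_synonym 'a rep = "nat set \<times> ('a \<Rightarrow> hvec \<Rightarrow> hvec)"

definition unitary_rep :: "('a::euclidean_space \<Rightarrow> 'a \<Rightarrow> 'a) \<Rightarrow> 'a rep \<Rightarrow> bool" where
  "unitary_rep m \<pi> \<longleftrightarrow> (case \<pi> of (I, U) \<Rightarrow>
     (I = UNIV \<or> (\<exists>d. I = {..<d})) \<and>
     (\<forall>x. linear_on_ell2 I (U x)) \<and>
     (\<forall>x. \<forall>v\<in>ell2 I. U x v \<in> ell2 I) \<and>
     (\<forall>x. \<forall>v\<in>ell2 I. \<forall>w\<in>ell2 I. ell2_inner (U x v) (U x w) = ell2_inner v w) \<and>
     (\<forall>v\<in>ell2 I. U 0 v = v) \<and>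
     (\<forall>x y. \<forall>v\<in>ell2 I. U (m x y) v = U x (U y v)) \<and>
     (\<forall>v\<in>ell2 I. \<forall>x. ((\<lambda>y. ell2_norm (\<lambda>n. U y v n - U x v n)) \<longlongrightarrow> 0) (at x)) \<and>
     (\<forall>x v. v \<notin> ell2 I \<longrightarrow> U x v = (\<lambda>n. 0)))"

definition irreps :: "('a::euclidean_space \<Rightarrow> 'a \<Rightarrow> 'a) \<Rightarrow> 'a rep set" where
  "irreps m = {(I, U). unitary_rep m (I, U) \<and> I \<noteq> {} \<and>
     (\<forall>W. closed_subspace I W \<and> (\<forall>x. \<forall>v\<in>W. U x v \<in> W) \<longrightarrow> W = {\<lambda>n. 0} \<or> W = ell2 I)}"

definition rep_equiv :: "'a rep \<Rightarrow> 'a rep \<Rightarrow> bool" where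
  "rep_equiv \<pi> \<rho> \<longleftrightarrow> (\<exists>T. bij_betw T (ell2 (fst \<pi>)) (ell2 (fst \<rho>)) \<and>
     linear_on_ell2 (fst \<pi>) T \<and>
     (\<forall>v\<in>ell2 (fst \<pi>). \<forall>w\<in>ell2 (fst \<pi>). ell2_inner (T v) (T w) = ell2_inner v w) \<and>
     (\<forall>x. \<forall>v\<in>ell2 (fst \<pi>). T (snd \<pi> x v) = snd \<rho> x (T v)))"

definition unitary_dual :: "('a::euclidean_space \<Rightarrow> 'a \<Rightarrow> 'a) \<Rightarrow> 'a rep set set" where
  "unitary_dual m = irreps m // {(\<pi>, \<rho>). \<pi> \<in> irreps m \<and> \<rho> \<in> irreps m \<and> rep_equiv \<pi> \<rho>}"

definition rep_of :: "'a rep set \<Rightarrow> 'a rep" where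
  "rep_of c = (SOME \<pi>. \<pi> \<in> c)"

definition dil_rep :: "('n::finite \<Rightarrow> nat) \<Rightarrow> real \<Rightarrow> (real^'n) rep \<Rightarrow> (real^'n) rep" where
  "dil_rep \<upsilon> r \<pi> = (fst \<pi>, \<lambda>x. snd \<pi> (dil \<upsilon> r x))"

text \<open>The group Fourier transform \<open>\<integral> f(y) \<pi>(y)* dy\<close>, as a weak operator integral (coordinatewise).\<close>

definition fourier :: "('a::euclidean_space \<Rightarrow> complex) \<Rightarrow> 'a rep \<Rightarrow> hvec \<Rightarrow> hvec" where
  "fourier f \<pi> v = (\<lambda>n. if v \<in> ell2 (fst \<pi>)
      then LINT y|lborel. f y * adj (fst \<pi>) (snd \<pi> y) v n else 0)"

text \<open>The Mackey Borel structure: representations on each model space carry the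
  \<open>\<sigma>\<close>-algebra generated by their matrix coefficients, and the dual its quotient.\<close>

definition irreps_borel :: "('a::euclidean_space \<Rightarrow> 'a \<Rightarrow> 'a) \<Rightarrow> 'a rep set set" where
  "irreps_borel m = sigma_sets (irreps m)
     {{\<pi> \<in> irreps m. fst \<pi> = I \<and> ell2_inner (snd \<pi> x v) w \<in> B} | I x v w B.
        v \<in> ell2 I \<and> w \<in> ell2 I \<and> B \<in> sets borel}"

definition dual_borel :: "('a::euclidean_space \<Rightarrow> 'a \<Rightarrow> 'a) \<Rightarrow> 'a rep set set set" where
  "dual_borel m = {E. E \<subseteq> unitary_dual m \<and> \<Union>E \<in> irreps_borel m}"

text \<open>The Plancherel measure is the unique measure on the dual satisfying the Plancherel
  formula (the Hilbert-Schmidt norm depends only on the class of a representation).\<close>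

definition plancherel_measure ::
    "('a::euclidean_space \<Rightarrow> 'a \<Rightarrow> 'a) \<Rightarrow> 'a rep set measure \<Rightarrow> bool" where
  "plancherel_measure m \<mu> \<longleftrightarrow>
     space \<mu> = unitary_dual m \<and> sets \<mu> = dual_borel m \<and> sigma_finite_measure \<mu> \<and>
     (\<forall>f \<in> L1 \<inter> L2.
        (\<integral>\<^sup>+ x. ennreal ((cmod (f x))\<^sup>2) \<partial>lborel) =
        (\<integral>\<^sup>+ c. hs_norm_sq (fst (rep_of c)) (fourier f (rep_of c)) \<partial>\<mu>))"

type_synonym 'a symbol = "'a \<Rightarrow> 'a rep \<Rightarrow> hvec \<Rightarrow> hvec"

definition has_kernel ::
    "('a::euclidean_space \<Rightarrow> 'a \<Rightarrow> 'a) \<Rightarrow> 'a symbol \<Rightarrow> ('a \<Rightarrow> 'a \<Rightarrow> complex) \<Rightarrow> bool" where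
  "has_kernel m \<sigma> \<kappa> \<longleftrightarrow> \<kappa> \<in> Cc_schwartz \<and>
     (\<forall>x. \<forall>\<pi>\<in>irreps m. \<forall>v\<in>ell2 (fst \<pi>). \<sigma> x \<pi> v = fourier (\<kappa> x) \<pi> v)"

definition A0 :: "('a::euclidean_space \<Rightarrow> 'a \<Rightarrow> 'a) \<Rightarrow> 'a symbol set" where
  "A0 m = {\<sigma>. \<exists>\<kappa>. has_kernel m \<sigma> \<kappa>}"

text \<open>The kernel of a symbol is unique, by injectivity of the Fourier transform.\<close>

definition Op_KN :: "('a::euclidean_space \<Rightarrow> 'a \<Rightarrow> 'a) \<Rightarrow> 'a symbol \<Rightarrow> ('a \<Rightarrow> complex) \<Rightarrow> 'a \<Rightarrow> complex" where
  "Op_KN m \<sigma> f x = conv m f ((SOME \<kappa>. has_kernel m \<sigma> \<kappa>) x) x"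

text \<open>If \<open>\<sigma>\<close> has kernel \<open>\<kappa>\<close>, the dilated symbol \<open>\<sigma>(x, \<delta>\<^sub>\<epsilon> \<pi>)\<close> has kernel
  \<open>\<epsilon>\<close> to the power \<open>-Q\<close> times \<open>\<kappa>\<^sub>x(\<delta>\<^sub>\<epsilon>\<inverse> y)\<close>, where \<open>Q\<close> is the sum of the weights.\<close>

definition Op_eps ::
    "('n::finite \<Rightarrow> nat) \<Rightarrow> (real^'n \<Rightarrow> real^'n \<Rightarrow> real^'n) \<Rightarrow> real \<Rightarrow> (real^'n) symbol
      \<Rightarrow> (real^'n \<Rightarrow> complex) \<Rightarrow> real^'n \<Rightarrow> complex" where
  "Op_eps \<upsilon> m \<epsilon> \<sigma> = Op_KN m (\<lambda>x \<pi>. \<sigma> x (dil_rep \<upsilon> \<epsilon> \<pi>))"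

definition nonneg_symbol ::
    "'a::euclidean_space rep set measure \<Rightarrow> 'a symbol \<Rightarrow> bool" where
  "nonneg_symbol \<mu> \<sigma> \<longleftrightarrow>
     (AE (x, c) in lborel \<Otimes>\<^sub>M \<mu>. \<forall>\<pi>\<in>c. nonneg_op (fst \<pi>) (\<sigma> x \<pi>))"

end

theory Submission
  imports Defs
begin

text \<open>
  The quadratic form of the operator is compared with an average of non-negative forms.

  Let \<open>\<kappa>\<close> be the kernel of \<open>\<sigma>\<close>, put \<open>s = \<surd>\<epsilon>\<close> and let \<open>g\<close> be an even bump function with
  \<open>\<integral> g\<^sup>2 = 1\<close>.  After replacing \<open>f\<close> by \<open>f \<circ> \<delta>\<^sub>\<epsilon>\<close> the form is
  \<open>\<integral>\<integral> f(y) \<kappa>\<^sub>X(y\<inverse>x) cnj f(x) dy dx\<close> with \<open>X = \<delta>\<^sub>\<epsilon> x\<close> (\<open>Op_eps_rescaled\<close>).  For fixed \<open>z\<close>,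
  convolution by the frozen kernel \<open>\<kappa>\<^sub>z\<close> has a non-negative form for almost every \<open>z\<close>: this
  follows from \<open>\<sigma>(z, \<pi>) \<ge> 0\<close> by the Plancherel formula (\<open>conv_nonneg\<close>).  Evaluating the form of
  \<open>\<kappa>\<close> frozen at \<open>\<delta>\<^sub>s z\<close> on the wave packet \<open>g(z\<inverse> \<delta>\<^sub>s x) f(x)\<close> and integrating over \<open>z\<close> gives a
  non-negative form, whose kernel is an average \<open>packet_kernel\<close> of \<open>\<kappa>\<close> near \<open>X\<close>.

  The point is that this average differs from \<open>\<kappa>\<^sub>X(w)\<close> by \<open>O(s\<^sup>2)\<close> only, with rapid decay in \<open>w\<close>
  (\<open>packet_kernel_estimate\<close>).  With \<open>h = \<delta>\<^sub>s w\<close>, of norm at most \<open>s |w|\<close>, the errors of order \<open>s\<close>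
  vanish for two reasons: \<open>\<integral> g(u) g(uh\<inverse>) du = 1 - (1/2) \<integral> (g(uh\<inverse>) - g(u))\<^sup>2 du\<close>, and the first
  order variation of \<open>x \<mapsto> \<kappa>\<^sub>x\<close> is integrated against the even function \<open>g\<^sup>2\<close>.  A Schur test turns
  the pointwise bound into an error of size \<open>C s\<^sup>2 \<parallel>f\<parallel>\<^sup>2 = C \<epsilon> \<parallel>f\<parallel>\<^sup>2\<close> (\<open>wave_packet_lower_bound\<close>).

  Three facts on the group have to be derived from its definition.  Dilations are automorphisms,
  as they preserve the bracket and a linear map that preserves the bracket is a homomorphism in
  exponential coordinates (\<open>lie_hom_imp_hom\<close>).  Lebesgue measure is invariant under translations,
  as the Jacobian of a left translation is invariant under dilations and these contract the group
  to its unit (\<open>jacobian_left_field\<close>).  The kernel of a symbol is unique (\<open>kernel_unique\<close>), so that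
  the operator can be computed from the dilated kernel.
\<close>


section \<open>Differential calculus\<close>

lemma has_derivative_imp_partial:
  assumes "(f has_derivative f') (at x)"
  shows "partial b f x = f' b"
proof -
  have "((\<lambda>t. x + t *\<^sub>R b) has_derivative (\<lambda>t. t *\<^sub>R b)) (at 0)"
    by (auto intro!: derivative_eq_intros)
  moreover have "(f has_derivative f') (at (x + 0 *\<^sub>R b))" using assms by simp
  ultimately have "((\<lambda>t. f (x + t *\<^sub>R b)) has_derivative (\<lambda>t. f' (t *\<^sub>R b))) (at 0)"
    using has_derivative_compose[of "\<lambda>t. x + t *\<^sub>R b" "\<lambda>t. t *\<^sub>R b" 0 UNIV f f'] by simp
  moreover have "f' (t *\<^sub>R b) = t *\<^sub>R f' b" for t
    using assms by (simp add: has_derivative_linear linear_cmul)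
  ultimately have "((\<lambda>t. f (x + t *\<^sub>R b)) has_vector_derivative f' b) (at 0)"
    by (simp add: has_vector_derivative_def)
  then show ?thesis by (simp add: partial_def vector_derivative_at)
qed

lemma smooth_has_derivative:
  "smooth f \<Longrightarrow> (f has_derivative frechet_derivative f (at x)) (at x)"
  unfolding smooth_def by (auto dest!: bspec[of _ _ "[]"] simp flip: frechet_derivative_works)

lemma partials_append: "partials (bs @ cs) f = partials bs (partials cs f)"
  by (induction bs) auto

lemma smooth_partials:
  assumes "smooth f" "bs \<in> lists Basis" shows "smooth (partials bs f)"
  using assms unfolding smooth_def by (metis append_in_lists_conv partials_append)

lemma smooth_frechet_eq:
  assumes "smooth f"
  shows "frechet_derivative f (at x) v = (\<Sum>b\<in>Basis. (v \<bullet> b) *\<^sub>R partial b f x)"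
proof -
  note d = smooth_has_derivative[OF assms, of x]
  have "frechet_derivative f (at x) v = frechet_derivative f (at x) (\<Sum>b\<in>Basis. (v \<bullet> b) *\<^sub>R b)"
    by (simp add: euclidean_representation)
  also have "\<dots> = (\<Sum>b\<in>Basis. (v \<bullet> b) *\<^sub>R partial b f x)"
    using has_derivative_linear[OF d]
    by (simp add: linear_sum linear_cmul has_derivative_imp_partial[OF d])
  finally show ?thesis .
qed

lemma smooth_isCont: "smooth f \<Longrightarrow> isCont f x"
  using smooth_has_derivative has_derivative_continuous by blast

lemma smooth_frechet_isCont:
  assumes "smooth f" shows "isCont (\<lambda>x. frechet_derivative f (at x) v) x"
proof -
  have "isCont (partial b f) x" if "b \<in> Basis" for b
    using smooth_isCont[OF smooth_partials[OF assms, of "[b]"]] that by simp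
  then show ?thesis
    unfolding smooth_frechet_eq[OF assms] by (intro continuous_intros) auto
qed

lemma has_vector_derivative_shift:
  "((\<lambda>h. g (s + h)) has_vector_derivative d) (at 0) \<Longrightarrow> (g has_vector_derivative d) (at (s::real))"
proof -
  assume a: "((\<lambda>h. g (s + h)) has_vector_derivative d) (at 0)"
  have "((\<lambda>t. t - s) has_vector_derivative 1) (at s)"
    by (auto intro!: derivative_eq_intros)
  from vector_diff_chain_at[OF this, of "\<lambda>h. g (s + h)" d] a
  show ?thesis by (simp add: o_def)
qed

lemma has_vector_derivative_at_0_iff:
  "(g has_vector_derivative d) (at 0) \<longleftrightarrow> ((\<lambda>t. (g t - g 0) /\<^sub>R t) \<longlongrightarrow> d) (at (0::real))"
proof -
  have "(g has_vector_derivative d) (at 0) \<longleftrightarrow>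
      ((\<lambda>t. norm ((g t - g 0) - t *\<^sub>R d) / norm t) \<longlongrightarrow> 0) (at 0)"
    by (simp add: has_vector_derivative_def has_derivative_iff_norm bounded_linear_scaleR_left)
  also have "\<dots> \<longleftrightarrow> ((\<lambda>t. norm ((g t - g 0) /\<^sub>R t - d)) \<longlongrightarrow> 0) (at 0)"
  proof (rule tendsto_cong)
    have "norm ((g t - g 0) - t *\<^sub>R d) / norm t = norm ((g t - g 0) /\<^sub>R t - d)" if "t \<noteq> 0" for t
    proof -
      have "(g t - g 0) /\<^sub>R t - d = (1/t) *\<^sub>R ((g t - g 0) - t *\<^sub>R d)"
        using that by (simp add: scaleR_diff_right divide_inverse)
      then show ?thesis by (simp add: divide_inverse)
    qed
    then show "\<forall>\<^sub>F t in at 0. norm (g t - g 0 - t *\<^sub>R d) / norm t = norm ((g t - g 0) /\<^sub>R t - d)"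
      by (simp add: eventually_at_filter)
  qed
  also have "\<dots> \<longleftrightarrow> ((\<lambda>t. (g t - g 0) /\<^sub>R t) \<longlongrightarrow> d) (at 0)"
    unfolding tendsto_norm_zero_iff by (rule Lim_null[symmetric])
  finally show ?thesis .
qed

lemma vector_derivative_zero_imp_const:
  assumes "\<And>s::real. (g has_vector_derivative 0) (at s)"
  shows "g s = g t"
proof -
  have "\<exists>c. \<forall>x\<in>UNIV. g x = c"
    using has_derivative_zero_constant[of UNIV g] assms
    by (auto simp: has_vector_derivative_def)
  then show ?thesis by auto
qed

lemma linear_vector_derivative:
  fixes L :: "'a::euclidean_space \<Rightarrow> 'b::real_normed_vector"
  assumes "linear L" "(f has_vector_derivative f') F"
  shows "((\<lambda>t. L (f t)) has_vector_derivative L f') F"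
  using assms(1)
  by (simp add: linear_conv_bounded_linear bounded_linear.has_vector_derivative assms(2))

section \<open>Groups in exponential coordinates\<close>

text \<open>The exponential map is the identity, so the inverse of \<open>x\<close> is \<open>- x\<close> and squaring is doubling.
  The second property makes much of the Lie theory below elementary.\<close>

locale exp_group =
  fixes m :: "'a::euclidean_space \<Rightarrow> 'a \<Rightarrow> 'a"
  assumes smooth_mult: "smooth (\<lambda>p. m (fst p) (snd p))"
    and assoc: "m (m x y) z = m x (m y z)"
    and unit_l [simp]: "m 0 x = x" and unit_r [simp]: "m x 0 = x"
    and inv_l [simp]: "m (- x) x = 0" and inv_r [simp]: "m x (- x) = 0"
    and line: "m (s *\<^sub>R x) (t *\<^sub>R x) = (s + t) *\<^sub>R x"
begin

lemma cancel_l [simp]: "m (- x) (m x y) = y" "m x (m (- x) y) = y"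
  by (simp_all flip: assoc)

lemma cancel_r [simp]: "m (m y (- x)) x = y" "m (m y x) (- x) = y"
  by (simp_all add: assoc)

lemma inv_unique: "m x y = 0 \<Longrightarrow> y = - x"
  by (metis cancel_l(1) unit_r)

lemma minus_mult: "- m x y = m (- y) (- x)"
  by (rule inv_unique[symmetric]) (simp flip: assoc)

lemma mult_eq_0_iff: "m x (- y) = 0 \<longleftrightarrow> x = y"
  by (metis cancel_r(1) inv_r unit_l)

definition dm :: "'a \<times> 'a \<Rightarrow> 'a \<times> 'a \<Rightarrow> 'a" where
  "dm p = frechet_derivative (\<lambda>p. m (fst p) (snd p)) (at p)"

lemma linear_dm: "linear (dm p)"
  unfolding dm_def using smooth_has_derivative[OF smooth_mult] has_derivative_linear by blast

lemma mult_has_derivative: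
  assumes "(f has_derivative f') (at x)" "(g has_derivative g') (at x)"
  shows "((\<lambda>x. m (f x) (g x)) has_derivative (\<lambda>h. dm (f x, g x) (f' h, g' h))) (at x)"
proof -
  have "((\<lambda>p. m (fst p) (snd p)) has_derivative dm (f x, g x)) (at (f x, g x))"
    unfolding dm_def by (rule smooth_has_derivative[OF smooth_mult])
  from has_derivative_compose[OF has_derivative_Pair[OF assms] this]
  show ?thesis by simp
qed

lemma mult_has_vector_derivative:
  assumes "(f has_vector_derivative f') (at x)" "(g has_vector_derivative g') (at x)"
  shows "((\<lambda>x. m (f x) (g x)) has_vector_derivative dm (f x, g x) (f', g')) (at x)"
proof -
  have "(h *\<^sub>R f', h *\<^sub>R g') = h *\<^sub>R (f', g')" for h by simp
  then show ?thesis
    using mult_has_derivative[OF assms[unfolded has_vector_derivative_def]]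
    unfolding has_vector_derivative_def by (simp only: linear_cmul[OF linear_dm])
qed

lemma dm_split: "dm p (a, b) = dm p (a, 0) + dm p (0, b)"
  by (simp flip: linear_add[OF linear_dm])

lemma dm_unit_r [simp]: "dm (p, 0) (a, 0) = a"
proof -
  have "((\<lambda>t. p + t *\<^sub>R a) has_vector_derivative a) (at 0)"
    by (auto intro!: derivative_eq_intros)
  from mult_has_vector_derivative[OF this, of "\<lambda>t. 0" 0] this
  show ?thesis by (simp add: vector_derivative_unique_at)
qed

lemma dm_unit_l [simp]: "dm (0, p) (0, a) = a"
proof -
  have "((\<lambda>t. p + t *\<^sub>R a) has_vector_derivative a) (at 0)"
    by (auto intro!: derivative_eq_intros)
  from mult_has_vector_derivative[OF has_vector_derivative_const[of 0] this] this
  show ?thesis by (simp add: vector_derivative_unique_at)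
qed

lemma isCont_mult:
  assumes "isCont f x" "isCont g x" shows "isCont (\<lambda>x. m (f x) (g x)) x"
proof -
  have "isCont (\<lambda>p. m (fst p) (snd p)) (f x, g x)" by (rule smooth_isCont[OF smooth_mult])
  from isCont_o2[OF isCont_Pair[OF assms] this] show ?thesis by simp
qed

text \<open>A homomorphism commutes with squaring, hence \<open>\<phi> x = 2\<^sup>n \<phi> (x / 2\<^sup>n)\<close>, which tends to the
  derivative of \<open>\<phi>\<close> at 0 in direction \<open>x\<close>.\<close>

lemma hom_linear:
  assumes hom: "\<And>x y. \<phi> (m x y) = m (\<phi> x) (\<phi> y)" and d: "\<phi> differentiable (at 0)"
  shows "linear \<phi>"
proof -
  obtain D where D: "(\<phi> has_derivative D) (at 0)" using d by (auto simp: differentiable_def)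
  have m2: "m x x = 2 *\<^sub>R x" for x
    using line[of 1 x 1] by simp
  have "\<phi> 0 = 0"
  proof -
    have "m (\<phi> 0) (\<phi> 0) = \<phi> 0" using hom[of 0 0] by simp
    then show ?thesis by (metis cancel_l(1) inv_l)
  qed
  have half: "\<phi> x = 2 *\<^sub>R \<phi> ((1/2) *\<^sub>R x)" for x
    using hom[of "(1/2) *\<^sub>R x" "(1/2) *\<^sub>R x"] by (simp add: m2)
  have pow: "\<phi> x = 2^n *\<^sub>R \<phi> ((1/2)^n *\<^sub>R x)" for x n
  proof (induction n)
    case (Suc n)
    then show ?case using half[of "(1/2)^n *\<^sub>R x"] by (simp add: mult.commute)
  qed simp
  have "\<phi> x = D x" for x
  proof -
    have "((\<lambda>t. t *\<^sub>R x) has_derivative (\<lambda>t. t *\<^sub>R x)) (at 0)"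
      by (auto intro!: derivative_eq_intros)
    from has_derivative_compose[OF this, of \<phi> D] D
    have "((\<lambda>t. \<phi> (t *\<^sub>R x)) has_derivative (\<lambda>t. D (t *\<^sub>R x))) (at 0)" by simp
    then have "((\<lambda>t. \<phi> (t *\<^sub>R x)) has_vector_derivative D x) (at 0)"
      using has_derivative_linear[OF D] by (simp add: has_vector_derivative_def linear_cmul)
    then have lim: "((\<lambda>t. \<phi> (t *\<^sub>R x) /\<^sub>R t) \<longlongrightarrow> D x) (at 0)"
      using \<open>\<phi> 0 = 0\<close> by (simp add: has_vector_derivative_at_0_iff)
    have "filterlim (\<lambda>n. (1/2)^n :: real) (at 0) sequentially"
      by (auto simp: filterlim_at intro!: LIMSEQ_realpow_zero)
    from filterlim_compose[OF lim this]
    have "(\<lambda>n. 2^n *\<^sub>R \<phi> ((1/2)^n *\<^sub>R x)) \<longlonglongrightarrow> D x"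
      by (simp add: power_one_over)
    then show ?thesis by (simp flip: pow add: LIMSEQ_const_iff)
  qed
  then show ?thesis using has_derivative_linear[OF D] by (metis ext)
qed


text \<open>Conjugation is a homomorphism, hence linear: in exponential coordinates it coincides with the
  adjoint representation.\<close>

definition Ad :: "'a \<Rightarrow> 'a \<Rightarrow> 'a" where
  "Ad x y = m (m x y) (- x)"

definition ad :: "'a \<Rightarrow> 'a \<Rightarrow> 'a" where
  "ad x y = frechet_derivative (\<lambda>p. Ad (fst p) (snd p)) (at (0, y)) (x, 0)"

lemma Ad_0 [simp]: "Ad 0 y = y" by (simp add: Ad_def)

lemma Ad_mult: "Ad (m x y) z = Ad x (Ad y z)"
  by (simp add: Ad_def minus_mult assoc)

lemma Ad_minus [simp]: "Ad x (Ad (- x) y) = y" "Ad (- x) (Ad x y) = y"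
  by (simp_all flip: Ad_mult)

lemma Ad_add_line: "Ad ((s + t) *\<^sub>R x) y = Ad (s *\<^sub>R x) (Ad (t *\<^sub>R x) y)"
  by (simp flip: Ad_mult add: line)

lemma Ad_hom: "Ad x (m y z) = m (Ad x y) (Ad x z)"
  by (simp add: Ad_def assoc)

lemma Ad_differentiable: "(\<lambda>p. Ad (fst p) (snd p)) differentiable (at p)"
proof -
  have "(fst has_derivative fst) (at p)" "(snd has_derivative snd) (at p)"
    "((\<lambda>p. - fst p) has_derivative (\<lambda>p. - fst p)) (at p)"
    by (auto intro!: derivative_eq_intros)
  then show ?thesis
    unfolding Ad_def differentiable_def
    by (intro exI) (rule mult_has_derivative[OF mult_has_derivative])
qed

lemma linear_Ad: "linear (Ad x)"
proof (rule hom_linear)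
  have "(\<lambda>y. (x, y)) differentiable (at 0)"
    by (auto simp: differentiable_def intro!: exI derivative_eq_intros)
  from differentiable_chain_at[OF this Ad_differentiable]
  show "Ad x differentiable (at 0)" by (simp add: o_def)
qed (rule Ad_hom)

lemma Ad_has_vector_derivative:
  assumes f: "(f has_vector_derivative f') (at 0)"
  shows "((\<lambda>s. Ad (s *\<^sub>R x) (f s)) has_vector_derivative ad x (f 0) + f') (at 0)"
proof -
  define D where "D = frechet_derivative (\<lambda>p. Ad (fst p) (snd p)) (at (0, f 0))"
  have D: "((\<lambda>p. Ad (fst p) (snd p)) has_derivative D) (at (0, f 0))"
    unfolding D_def using Ad_differentiable by (simp flip: frechet_derivative_works)
  have 1: "((\<lambda>s. Ad (g s) (h s)) has_vector_derivative D (g', h')) (at 0)"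
    if g: "(g has_vector_derivative g') (at 0)" "(h has_vector_derivative h') (at 0)"
       "g 0 = 0" "h 0 = f 0" for g h g' h'
  proof -
    have *: "((\<lambda>s. (g s, h s)) has_derivative (\<lambda>t. (t *\<^sub>R g', t *\<^sub>R h'))) (at 0)"
      using g by (auto simp: has_vector_derivative_def intro!: has_derivative_Pair)
    have "(t *\<^sub>R g', t *\<^sub>R h') = t *\<^sub>R (g', h')" for t by simp
    then show ?thesis
      using has_derivative_compose[OF *, of "\<lambda>p. Ad (fst p) (snd p)" D] D g(3,4)
      unfolding has_vector_derivative_def
      by (simp only: fst_conv snd_conv linear_cmul[OF has_derivative_linear[OF D]])
  qed
  have "((\<lambda>s. f 0 + s *\<^sub>R f') has_vector_derivative f') (at 0)"
    by (auto intro!: derivative_eq_intros)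
  from 1[OF has_vector_derivative_const this] this have "D (0, f') = f'"
    by (simp add: vector_derivative_unique_at)
  moreover have "D (x, f') = D (x, 0) + D (0, f')"
    by (simp flip: linear_add[OF has_derivative_linear[OF D]])
  ultimately have "D (x, f') = ad x (f 0) + f'" by (simp add: ad_def D_def)
  moreover have "((\<lambda>s. s *\<^sub>R x) has_vector_derivative x) (at 0)"
    by (auto intro!: derivative_eq_intros)
  ultimately show ?thesis using 1[OF _ f] by force
qed

lemma Ad_line_has_vector_derivative:
  "((\<lambda>s. Ad (s *\<^sub>R x) y) has_vector_derivative ad x y) (at 0)"
  using Ad_has_vector_derivative[OF has_vector_derivative_const[of y]] by simp

text \<open>By linearity of conjugation the inner derivative in the definition of the bracket is
  \<open>Ad (s x) y\<close> itself.\<close>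

lemma lie_bracket_eq_ad: "lie_bracket m x y = ad x y"
proof -
  have "vector_derivative (\<lambda>t. m (m (s *\<^sub>R x) (t *\<^sub>R y)) (- (s *\<^sub>R x))) (at 0) = Ad (s *\<^sub>R x) y" for s
  proof -
    have "((\<lambda>t. t *\<^sub>R Ad (s *\<^sub>R x) y) has_vector_derivative Ad (s *\<^sub>R x) y) (at 0)"
      by (auto intro!: derivative_eq_intros)
    then have "((\<lambda>t. Ad (s *\<^sub>R x) (t *\<^sub>R y)) has_vector_derivative Ad (s *\<^sub>R x) y) (at 0)"
      by (simp add: linear_cmul[OF linear_Ad])
    then show ?thesis by (simp add: vector_derivative_at Ad_def)
  qed
  then show ?thesis
    unfolding lie_bracket_def using Ad_line_has_vector_derivative by (simp add: vector_derivative_at)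
qed

lemma linear_ad_left: "linear (\<lambda>x. ad x y)"
proof -
  have "linear (frechet_derivative (\<lambda>p. Ad (fst p) (snd p)) (at (0, y)))"
    by (rule linear_frechet_derivative[OF Ad_differentiable])
  then show ?thesis unfolding ad_def
    by (intro linearI) (simp_all flip: linear_add linear_cmul)
qed

lemma linear_ad_right: "linear (ad x)"
proof (intro linearI)
  fix y z c
  have "((\<lambda>s. Ad (s *\<^sub>R x) y + Ad (s *\<^sub>R x) z) has_vector_derivative ad x y + ad x z) (at 0)"
    by (intro derivative_intros Ad_line_has_vector_derivative)
  moreover have "((\<lambda>s. Ad (s *\<^sub>R x) y + Ad (s *\<^sub>R x) z) has_vector_derivative ad x (y + z)) (at 0)"
    using Ad_line_has_vector_derivative[of x "y + z"] by (simp add: linear_add[OF linear_Ad])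
  ultimately show "ad x (y + z) = ad x y + ad x z" by (metis vector_derivative_unique_at)
  have "((\<lambda>s. c *\<^sub>R Ad (s *\<^sub>R x) y) has_vector_derivative c *\<^sub>R ad x y) (at 0)"
    by (rule linear_vector_derivative[OF linear_scaleR Ad_line_has_vector_derivative])
  moreover have "((\<lambda>s. c *\<^sub>R Ad (s *\<^sub>R x) y) has_vector_derivative ad x (c *\<^sub>R y)) (at 0)"
    using Ad_line_has_vector_derivative[of x "c *\<^sub>R y"] by (simp add: linear_cmul[OF linear_Ad])
  ultimately show "ad x (c *\<^sub>R y) = c *\<^sub>R ad x y" by (metis vector_derivative_unique_at)
qed

text \<open>The left-invariant vector fields, and the derivative of left translation from \<open>x\<close> back to
  the unit (the Maurer--Cartan form), which inverts them.\<close>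

definition left_field :: "'a \<Rightarrow> 'a \<Rightarrow> 'a" where
  "left_field x v = dm (x, 0) (0, v)"

definition maurer_cartan :: "'a \<Rightarrow> 'a \<Rightarrow> 'a" where
  "maurer_cartan x w = dm (- x, x) (0, w)"

lemma line_deriv: "((\<lambda>t. p + t *\<^sub>R v) has_vector_derivative v) (at 0)"
  by (auto intro!: derivative_eq_intros)

lemma left_field_deriv: "((\<lambda>t. m x (t *\<^sub>R v)) has_vector_derivative left_field x v) (at 0)"
  using mult_has_vector_derivative[OF has_vector_derivative_const[of x] line_deriv[of 0 v]]
  by (simp add: left_field_def)

lemma maurer_cartan_deriv:
  "((\<lambda>t. m (- x) (x + t *\<^sub>R w)) has_vector_derivative maurer_cartan x w) (at 0)"
  using mult_has_vector_derivative[OF has_vector_derivative_const[of "- x"] line_deriv[of x w]]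
  by (simp add: maurer_cartan_def)

lemma left_field_maurer_cartan: "left_field x (maurer_cartan x w) = w"
proof -
  have "((\<lambda>t. m x (m (- x) (x + t *\<^sub>R w))) has_vector_derivative dm (x, 0) (0, maurer_cartan x w)) (at 0)"
    using mult_has_vector_derivative[OF has_vector_derivative_const[of x] maurer_cartan_deriv[of x w]]
    by simp
  then show ?thesis
    using line_deriv[of x w] by (simp add: left_field_def vector_derivative_unique_at)
qed

lemma maurer_cartan_left_field: "maurer_cartan x (left_field x v) = v"
proof -
  have "((\<lambda>t. m (- x) (m x (t *\<^sub>R v))) has_vector_derivative dm (- x, x) (0, left_field x v)) (at 0)"
    using mult_has_vector_derivative[OF has_vector_derivative_const[of "- x"] left_field_deriv[of x v]]
    by simp
  then show ?thesis
    using line_deriv[of 0 v] by (simp add: maurer_cartan_def vector_derivative_unique_at)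
qed

lemma linear_maurer_cartan: "linear (maurer_cartan x)" and linear_left_field: "linear (left_field x)"
  unfolding maurer_cartan_def left_field_def
  using linear_dm by (auto intro!: linearI simp flip: linear_add linear_cmul)

lemma maurer_cartan_0 [simp]: "maurer_cartan 0 w = w"
  by (simp add: maurer_cartan_def)

lemma isCont_dm:
  assumes "isCont f x" shows "isCont (\<lambda>x. dm (f x) v) x"
  using isCont_o2[OF assms smooth_frechet_isCont[OF smooth_mult]] by (simp add: dm_def)

text \<open>The identity \<open>(-(s+h)x)((s+h)y) = Ad(-hx)((-sx)(sy)) (-hx)(hy)\<close> is differentiated along
  \<open>y = x + tw\<close> at \<open>t = 0\<close>, where both factors are the unit and the derivative of the product is the
  sum.  It determines the Maurer--Cartan form from \<open>Ad\<close>.\<close>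

lemma maurer_cartan_cocycle:
  "maurer_cartan ((s + h) *\<^sub>R x) ((s + h) *\<^sub>R w) =
    Ad (- (h *\<^sub>R x)) (maurer_cartan (s *\<^sub>R x) (s *\<^sub>R w)) + maurer_cartan (h *\<^sub>R x) (h *\<^sub>R w)"
proof -
  define f where "f = (\<lambda>s t. m (- (s *\<^sub>R x)) (s *\<^sub>R x + t *\<^sub>R s *\<^sub>R w))"
  have f: "(f s has_vector_derivative maurer_cartan (s *\<^sub>R x) (s *\<^sub>R w)) (at 0)" for s
    unfolding f_def by (rule maurer_cartan_deriv)
  have eq: "f (s + h) t = m (Ad (- (h *\<^sub>R x)) (f s t)) (f h t)" for t
  proof -
    have *: "s *\<^sub>R x + t *\<^sub>R s *\<^sub>R w = s *\<^sub>R (x + t *\<^sub>R w)" for s by (simp add: algebra_simps)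
    have f_eq: "f s t = m (- (s *\<^sub>R x)) (s *\<^sub>R (x + t *\<^sub>R w))" for s
      unfolding f_def by (simp only: *)
    have "- ((s + h) *\<^sub>R x) = m (- (h *\<^sub>R x)) (- (s *\<^sub>R x))"
      using line[of "-h" x "-s"] by (simp add: algebra_simps)
    then have "f (s + h) t = m (- (h *\<^sub>R x)) (m (f s t) (h *\<^sub>R (x + t *\<^sub>R w)))"
      unfolding f_eq by (simp only: assoc line)
    then show ?thesis unfolding f_eq[of h] Ad_def by (simp add: assoc)
  qed
  have f0: "f s 0 = 0" for s by (simp add: f_def)
  have "((\<lambda>t. m (Ad (- (h *\<^sub>R x)) (f s t)) (f h t)) has_vector_derivative
      dm (0, 0) (Ad (- (h *\<^sub>R x)) (maurer_cartan (s *\<^sub>R x) (s *\<^sub>R w)), maurer_cartan (h *\<^sub>R x) (h *\<^sub>R w))) (at 0)"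
    using mult_has_vector_derivative[OF linear_vector_derivative[OF linear_Ad f] f]
    by (simp add: f0 linear_0[OF linear_Ad])
  then have "(f (s + h) has_vector_derivative Ad (- (h *\<^sub>R x)) (maurer_cartan (s *\<^sub>R x) (s *\<^sub>R w)) + maurer_cartan (h *\<^sub>R x) (h *\<^sub>R w)) (at 0)"
    by (subst (asm) dm_split) (simp flip: eq)
  then show ?thesis using f vector_derivative_unique_at by blast
qed

text \<open>A linear map that preserves brackets commutes with \<open>Ad\<close>, hence by the cocycle identity with the
  Maurer--Cartan form, hence with the left-invariant fields and with their integral curves
  \<open>t \<mapsto> x (t y)\<close>.  In each step a curve with vanishing derivative replaces a uniqueness theorem for
  differential equations.\<close>

context
  fixes \<phi> :: "'a \<Rightarrow> 'a"
  assumes linear_phi: "linear \<phi>" and phi_ad: "\<And>x y. \<phi> (ad x y) = ad (\<phi> x) (\<phi> y)"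
begin

lemma lie_hom_Ad: "\<phi> (Ad x y) = Ad (\<phi> x) (\<phi> y)"
proof -
  define g where "g = (\<lambda>s. Ad (s *\<^sub>R (- \<phi> x)) (\<phi> (Ad (s *\<^sub>R x) y)))"
  have "(g has_vector_derivative 0) (at s)" for s
  proof (rule has_vector_derivative_shift)
    define v where "v = Ad (s *\<^sub>R x) y"
    have eq: "g (s + h) = Ad (s *\<^sub>R (- \<phi> x)) (Ad (h *\<^sub>R (- \<phi> x)) (\<phi> (Ad (h *\<^sub>R x) v)))" for h
      unfolding g_def v_def by (metis Ad_add_line add.commute)
    have "((\<lambda>h. Ad (h *\<^sub>R (- \<phi> x)) (\<phi> (Ad (h *\<^sub>R x) v))) has_vector_derivative
        ad (- \<phi> x) (\<phi> v) + \<phi> (ad x v)) (at 0)"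
      using Ad_has_vector_derivative[OF linear_vector_derivative[OF linear_phi Ad_line_has_vector_derivative[of x v]],
          of "- \<phi> x"]
      by simp
    moreover have "ad (- \<phi> x) (\<phi> v) + \<phi> (ad x v) = 0"
      by (simp add: phi_ad linear_neg[OF linear_ad_left])
    ultimately show "((\<lambda>h. g (s + h)) has_vector_derivative 0) (at 0)"
      unfolding eq using linear_vector_derivative[OF linear_Ad] linear_0[OF linear_Ad] by metis
  qed
  then have "g 1 = g 0" by (rule vector_derivative_zero_imp_const)
  then have "Ad (- \<phi> x) (\<phi> (Ad x y)) = \<phi> y" by (simp add: g_def)
  then show ?thesis by (metis Ad_minus(1))
qed

text \<open>The defect \<open>E\<close> satisfies the cocycle identity and \<open>E(h) = o(h)\<close>, so \<open>Ad (s \<phi>(x)) (E s)\<close> is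
  constant.\<close>

lemma lie_hom_maurer_cartan: "\<phi> (maurer_cartan x w) = maurer_cartan (\<phi> x) (\<phi> w)"
proof -
  define E where "E = (\<lambda>s. \<phi> (maurer_cartan (s *\<^sub>R x) (s *\<^sub>R w)) - maurer_cartan (s *\<^sub>R \<phi> x) (s *\<^sub>R \<phi> w))"
  have E_add: "E (s + h) = Ad (- (h *\<^sub>R \<phi> x)) (E s) + E h" for s h
    unfolding E_def maurer_cartan_cocycle
    by (simp add: linear_add[OF linear_phi] lie_hom_Ad linear_diff[OF linear_Ad] linear_neg[OF linear_phi]
        linear_cmul[OF linear_phi])
  have cont: "((\<lambda>s. maurer_cartan (s *\<^sub>R x) w) \<longlongrightarrow> w) (at 0)" for x w :: 'a
  proof -
    have "isCont (\<lambda>s. maurer_cartan (s *\<^sub>R x) w) 0"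
      unfolding maurer_cartan_def by (intro isCont_dm) (intro continuous_intros)
    then show ?thesis by (simp add: isCont_def)
  qed
  have E0: "E 0 = 0" by (simp add: E_def linear_0[OF linear_phi])
  have E_deriv: "(E has_vector_derivative 0) (at 0)"
  proof -
    have "((\<lambda>s. \<phi> (maurer_cartan (s *\<^sub>R x) w) - maurer_cartan (s *\<^sub>R \<phi> x) (\<phi> w)) \<longlongrightarrow> \<phi> w - \<phi> w) (at 0)"
      using linear_phi by (intro tendsto_diff cont bounded_linear.tendsto[of \<phi>])
        (simp_all add: linear_conv_bounded_linear)
    moreover have "\<phi> (maurer_cartan (s *\<^sub>R x) w) - maurer_cartan (s *\<^sub>R \<phi> x) (\<phi> w) = E s /\<^sub>R s" if "s \<noteq> 0" for s
      using that by (simp add: E_def linear_cmul[OF linear_maurer_cartan] linear_cmul[OF linear_phi]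
          flip: scaleR_diff_right)
    ultimately have "((\<lambda>s. E s /\<^sub>R s) \<longlongrightarrow> 0) (at 0)"
      by (auto simp: eventually_at_filter intro: Lim_transform_eventually)
    then show ?thesis by (simp add: has_vector_derivative_at_0_iff E0)
  qed
  define H where "H = (\<lambda>s. Ad (s *\<^sub>R \<phi> x) (E s))"
  have "(H has_vector_derivative 0) (at s)" for s
  proof (rule has_vector_derivative_shift)
    have "H (s + h) = H s + Ad (s *\<^sub>R \<phi> x) (Ad (h *\<^sub>R \<phi> x) (E h))" for h
      by (simp add: H_def E_add linear_add[OF linear_Ad] Ad_add_line)
    moreover have "((\<lambda>h. Ad (h *\<^sub>R \<phi> x) (E h)) has_vector_derivative 0) (at 0)"
      using Ad_has_vector_derivative[OF E_deriv] by (simp add: E0 linear_0[OF linear_ad_right])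
    then have "((\<lambda>h. H s + Ad (s *\<^sub>R \<phi> x) (Ad (h *\<^sub>R \<phi> x) (E h))) has_vector_derivative 0 + Ad (s *\<^sub>R \<phi> x) 0) (at 0)"
      by (intro derivative_intros linear_vector_derivative[OF linear_Ad])
    ultimately show "((\<lambda>h. H (s + h)) has_vector_derivative 0) (at 0)"
      by (simp add: linear_0[OF linear_Ad])
  qed
  then have "H 1 = H 0" by (rule vector_derivative_zero_imp_const)
  then have "Ad (\<phi> x) (E 1) = 0" by (simp add: H_def E0)
  then have "E 1 = 0" by (metis Ad_minus(2) linear_0 linear_Ad)
  then show ?thesis by (simp add: E_def)
qed

lemma lie_hom_left_field: "\<phi> (left_field x v) = left_field (\<phi> x) (\<phi> v)"
  by (metis left_field_maurer_cartan maurer_cartan_left_field lie_hom_maurer_cartan)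

text \<open>Both \<open>\<phi>(x (ty))\<close> and \<open>\<phi>(x) (t \<phi>(y))\<close> are integral curves of the field of \<open>\<phi>(y)\<close>; their quotient
  \<open>e\<close> is constant.\<close>

theorem lie_hom_imp_hom: "\<phi> (m x y) = m (\<phi> x) (\<phi> y)"
proof -
  define e where "e = (\<lambda>t. m (\<phi> (m x (t *\<^sub>R y))) (m (t *\<^sub>R (- \<phi> y)) (- \<phi> x)))"
  have "(e has_vector_derivative 0) (at t)" for t
  proof (rule has_vector_derivative_shift)
    define p where "p = m x (t *\<^sub>R y)"
    define q where "q = m (t *\<^sub>R (- \<phi> y)) (- \<phi> x)"
    have p: "m x ((t + h) *\<^sub>R y) = m p (h *\<^sub>R y)" for h
      by (simp add: p_def assoc line)
    have q: "m ((t + h) *\<^sub>R (- \<phi> y)) (- \<phi> x) = m (h *\<^sub>R (- \<phi> y)) q" for h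
      unfolding q_def by (simp only: assoc[symmetric] line add.commute)
    obtain r where r: "((\<lambda>h. m (h *\<^sub>R (- \<phi> y)) q) has_vector_derivative r) (at 0)"
      using mult_has_vector_derivative[OF line_deriv[of 0 "- \<phi> y"] has_vector_derivative_const[of q]]
      by auto
    have 1: "((\<lambda>h. e (t + h)) has_vector_derivative dm (\<phi> p, q) (\<phi> (left_field p y), r)) (at 0)"
      unfolding e_def p q
      using mult_has_vector_derivative[OF linear_vector_derivative[OF linear_phi left_field_deriv[of p y]] r]
      by simp
    have "((\<lambda>h. m (m (\<phi> p) (h *\<^sub>R \<phi> y)) (m (h *\<^sub>R (- \<phi> y)) q)) has_vector_derivative
        dm (\<phi> p, q) (left_field (\<phi> p) (\<phi> y), r)) (at 0)"
      using mult_has_vector_derivative[OF left_field_deriv[of "\<phi> p" "\<phi> y"] r] by simp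
    moreover have "m (m (\<phi> p) (h *\<^sub>R \<phi> y)) (m (h *\<^sub>R (- \<phi> y)) q) = m (\<phi> p) q" for h
      using cancel_l(2)[of "h *\<^sub>R \<phi> y" q] by (simp add: assoc)
    ultimately have "((\<lambda>h. m (\<phi> p) q) has_vector_derivative
        dm (\<phi> p, q) (left_field (\<phi> p) (\<phi> y), r)) (at (0::real))" by simp
    then have "dm (\<phi> p, q) (\<phi> (left_field p y), r) = 0"
      unfolding lie_hom_left_field by (metis has_vector_derivative_const vector_derivative_unique_at)
    with 1 show "((\<lambda>h. e (t + h)) has_vector_derivative 0) (at 0)" by simp
  qed
  then have "e 1 = e 0" by (rule vector_derivative_zero_imp_const)
  then have "m (\<phi> (m x y)) (- m (\<phi> x) (\<phi> y)) = 0" by (simp add: e_def minus_mult)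
  then show ?thesis by (simp add: mult_eq_0_iff)
qed

end

end


section \<open>Dilations are automorphisms\<close>

lemma dil_nth [simp]: "dil \<upsilon> r x $ j = r ^ \<upsilon> j * x $ j"
  by (simp add: dil_def)

lemma linear_dil: "linear (dil \<upsilon> r)"
  by (intro linearI) (simp_all add: vec_eq_iff algebra_simps)

lemma dil_dil: "dil \<upsilon> r (dil \<upsilon> s x) = dil \<upsilon> (r * s) x"
  by (simp add: vec_eq_iff power_mult_distrib)

lemma dil_1 [simp]: "dil \<upsilon> 1 x = x"
  by (simp add: vec_eq_iff)

lemma dil_zero [simp]: "dil \<upsilon> r 0 = 0"
  by (simp add: vec_eq_iff)

lemma dil_minus: "dil \<upsilon> r (- x) = - dil \<upsilon> r x"
  by (simp add: vec_eq_iff)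

lemma dil_inverse [simp]: "r \<noteq> 0 \<Longrightarrow> dil \<upsilon> (1 / r) (dil \<upsilon> r x) = x" "r \<noteq> 0 \<Longrightarrow> dil \<upsilon> r (dil \<upsilon> (1 / r) x) = x"
  by (simp_all add: dil_dil)

lemma dil_layer: "x \<in> layer \<upsilon> k \<Longrightarrow> dil \<upsilon> r x = r ^ k *\<^sub>R x"
proof -
  have "layer \<upsilon> k \<subseteq> {x. dil \<upsilon> r x = r ^ k *\<^sub>R x}"
    unfolding layer_def
  proof (rule span_minimal)
    show "subspace {x. dil \<upsilon> r x = r ^ k *\<^sub>R x}"
      by (auto simp: subspace_def linear_add[OF linear_dil] linear_cmul[OF linear_dil] algebra_simps)
  qed (auto simp: vec_eq_iff axis_def)
  then show "x \<in> layer \<upsilon> k \<Longrightarrow> dil \<upsilon> r x = r ^ k *\<^sub>R x" by blast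
qed

lemma continuous_dil: "continuous_on UNIV (dil \<upsilon> r)"
  by (rule linear_continuous_on[OF linear_dil[unfolded linear_conv_bounded_linear]])

locale graded =
  fixes \<upsilon> :: "'n::{finite,linorder} \<Rightarrow> nat"
    and m :: "(real, 'n) vec \<Rightarrow> (real, 'n) vec \<Rightarrow> (real, 'n) vec"
  assumes graded_group: "graded_group \<upsilon> m"
begin

lemma weight_ge_1: "1 \<le> \<upsilon> j"
  using graded_group by (simp add: graded_group_def)

sublocale exp_group m
  using graded_group unfolding graded_group_def by unfold_locales auto

lemma dil_0 [simp]: "dil \<upsilon> 0 x = 0"
proof -
  have "\<upsilon> j \<noteq> 0" for j using weight_ge_1[of j] by linarith
  note ne = this
  show ?thesis by (simp add: vec_eq_iff power_0_left ne)
qed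

lemma norm_dil_le:
  assumes "0 \<le> r" "r \<le> 1" shows "norm (dil \<upsilon> r x) \<le> r * norm x"
proof -
  have "norm (dil \<upsilon> r x) \<le> norm (r *\<^sub>R x)"
  proof (rule norm_le_componentwise_cart)
    fix i
    have "r ^ \<upsilon> i \<le> r" using assms weight_ge_1[of i] power_decreasing[of 1 "\<upsilon> i" r] by simp
    then show "norm (dil \<upsilon> r x $ i) \<le> norm ((r *\<^sub>R x) $ i)"
      using assms by (simp add: abs_mult mult_right_mono)
  qed
  then show ?thesis using assms by simp
qed

lemma dil_ad: "dil \<upsilon> r (ad x y) = ad (dil \<upsilon> r x) (dil \<upsilon> r y)"
proof -
  have ax: "axis i 1 \<in> layer \<upsilon> (\<upsilon> i)" for i
    unfolding layer_def by (rule span_base) auto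
  have basis: "dil \<upsilon> r (ad (axis i 1) (axis j 1)) = ad (dil \<upsilon> r (axis i 1)) (dil \<upsilon> r (axis j 1))" for i j
  proof -
    have "lie_bracket m (axis i 1) (axis j 1) \<in> layer \<upsilon> (\<upsilon> i + \<upsilon> j)"
      using graded_group ax unfolding graded_group_def by blast
    then have "dil \<upsilon> r (ad (axis i 1) (axis j 1)) = r ^ (\<upsilon> i + \<upsilon> j) *\<^sub>R ad (axis i 1) (axis j 1)"
      using dil_layer by (simp add: lie_bracket_eq_ad)
    then show ?thesis
      by (simp add: dil_layer[OF ax] linear_cmul[OF linear_ad_left] linear_cmul[OF linear_ad_right] power_add)
  qed
  have expand: "z = (\<Sum>i\<in>UNIV. (z $ i) *\<^sub>R axis i 1)" for z :: "(real, 'n) vec"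
    using basis_expansion[of z] by (simp add: scalar_mult_eq_scaleR)
  have 1: "dil \<upsilon> r (ad (axis i 1) y) = ad (dil \<upsilon> r (axis i 1)) (dil \<upsilon> r y)" for i y
    by (subst (1 2) expand[of y])
      (simp add: linear_sum[OF linear_dil] linear_sum[OF linear_ad_right] linear_cmul[OF linear_dil]
        linear_cmul[OF linear_ad_right] basis)
  show ?thesis
    by (subst (1 2) expand[of x])
      (simp add: linear_sum[OF linear_dil] linear_sum[OF linear_ad_left] linear_cmul[OF linear_dil]
        linear_cmul[OF linear_ad_left] 1)
qed

lemma dil_mult: "dil \<upsilon> r (m x y) = m (dil \<upsilon> r x) (dil \<upsilon> r y)"
  by (rule lie_hom_imp_hom[OF linear_dil dil_ad])

lemma dil_left_field: "dil \<upsilon> r (left_field x v) = left_field (dil \<upsilon> r x) (dil \<upsilon> r v)"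
  by (rule lie_hom_left_field[OF linear_dil dil_ad])

end

section \<open>Lebesgue measure is a Haar measure\<close>

text \<open>Change of variables is a statement about vectors indexed by a well-order.  A finite linear order
  is one, but only as a copy of the type can it be made an instance of that class.\<close>

typedef 'a wo_copy = "UNIV :: 'a set" by simp

instantiation wo_copy :: (linorder) linorder
begin
definition "x \<le> y \<longleftrightarrow> Rep_wo_copy x \<le> Rep_wo_copy y"
definition "x < y \<longleftrightarrow> Rep_wo_copy x < Rep_wo_copy y"
instance by standard (auto simp: less_eq_wo_copy_def less_wo_copy_def simp flip: Rep_wo_copy_inject)
end

instance wo_copy :: (finite) finite
proof
  have "finite (Rep_wo_copy ` (UNIV :: 'a wo_copy set))" by simp
  then show "finite (UNIV :: 'a wo_copy set)"
    by (rule finite_imageD) (simp add: inj_def Rep_wo_copy_inject)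
qed

instance wo_copy :: ("{finite,linorder}") wellorder
proof
  fix P and a :: "'a wo_copy"
  assume step: "\<And>x :: 'a wo_copy. (\<And>y. y < x \<Longrightarrow> P y) \<Longrightarrow> P x"
  show "P a"
  proof (induction "card {..<a}" arbitrary: a rule: less_induct)
    case less
    have "card {..<y} < card {..<a}" if "y < a" for y
      using that by (intro psubset_card_mono) auto
    then show ?case using step less by blast
  qed
qed

lemma prod_Basis_cart:
  fixes f :: "real^'n::finite \<Rightarrow> 'b::comm_monoid_mult"
  shows "(\<Prod>b\<in>Basis. f b) = (\<Prod>i\<in>UNIV. f (axis i 1))"
proof -
  have "Basis = range (\<lambda>i. axis i (1::real) :: real^'n::finite)"
    by (auto simp: Basis_vec_def)
  moreover have "inj (\<lambda>i. axis i (1::real) :: real^'n::finite)" by (auto simp: inj_def axis_eq_axis)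
  ultimately have "prod f Basis = prod f (range (\<lambda>i. axis i 1))" "inj (\<lambda>i. axis i 1 :: real^'n)"
    by simp_all
  then show ?thesis by (simp only: prod.reindex) (simp add: o_def)
qed

lemma distr_lborel_det_1:
  fixes f g :: "real^'n::{finite,wellorder} \<Rightarrow> real^'n::{finite,wellorder}"
  assumes f: "continuous_on UNIV f" and fg: "\<And>x. f (g x) = x" "\<And>x. g (f x) = x"
    and g: "\<And>x. (g has_derivative g' x) (at x)" and det: "\<And>x. \<bar>det (matrix (g' x))\<bar> = 1"
  shows "distr lborel borel f = lborel"
proof (rule lborel_eqI[symmetric])
  have fm [measurable]: "f \<in> borel_measurable borel"
    by (rule borel_measurable_continuous_onI[OF f])
  fix l u :: "real^'n::{finite,wellorder}"
  have "emeasure (distr lborel borel f) (box l u) = emeasure lborel (f -` box l u)"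
    by (simp add: emeasure_distr)
  also have eq: "f -` box l u = g ` box l u"
    using fg by (auto intro!: image_eqI[where x = "f _"])
  also have "emeasure lborel (g ` box l u) = emeasure lborel (box l u)"
  proof -
    have "inj_on g (box l u)" using fg by (metis inj_onI)
    moreover have "((\<lambda>x. \<bar>det (matrix (g' x))\<bar>) has_integral measure lborel (box l u)) (box l u)"
      by (simp only: det) (rule has_integral_measure_lborel, simp_all add: emeasure_lborel_box_finite flip: infinity_ennreal_def)
    ultimately have "g ` box l u \<in> lmeasurable \<and> measure lebesgue (g ` box l u) = measure lborel (box l u)"
      using has_measure_differentiable_image[of "box l u" g g'] g
      by (auto intro: has_derivative_at_withinI)
    then have "emeasure lebesgue (g ` box l u) = ennreal (measure lborel (box l u))"
      by (metis emeasure_eq_measure2)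
    moreover have "g ` box l u \<in> sets borel"
      using measurable_sets[OF fm, of "box l u"] by (simp flip: eq)
    moreover have "emeasure lborel (box l u) = ennreal (measure lborel (box l u))"
      by (rule emeasure_eq_ennreal_measure) (metis emeasure_lborel_box_finite infinity_ennreal_def less_irrefl)
    ultimately show ?thesis by simp
  qed
  finally show "emeasure (distr lborel borel f) (box l u) = (\<Prod>b\<in>Basis. (u - l) \<bullet> b)"
    if "\<And>b. b \<in> Basis \<Longrightarrow> l \<bullet> b \<le> u \<bullet> b" using that by (simp add: emeasure_lborel_box)
qed simp

definition to_copy :: "real^'n::finite \<Rightarrow> real^('n wo_copy)" where
  "to_copy x = (\<chi> i. x $ Rep_wo_copy i)"

definition of_copy :: "real^('n wo_copy) \<Rightarrow> real^'n::finite" where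
  "of_copy x = (\<chi> i. x $ Abs_wo_copy i)"

lemma copy_inverse [simp]: "to_copy (of_copy x) = x" "of_copy (to_copy y) = y"
  by (simp_all add: to_copy_def of_copy_def vec_eq_iff Rep_wo_copy_inverse Abs_wo_copy_inverse)

lemma linear_copy: "linear to_copy" "linear of_copy"
  by (auto intro!: linearI simp: to_copy_def of_copy_def vec_eq_iff)

lemma continuous_copy: "continuous_on UNIV (to_copy :: real^'n::finite \<Rightarrow> _)" "continuous_on UNIV (of_copy :: _ \<Rightarrow> real^'n::finite)"
  by (rule linear_continuous_on[OF linear_copy(1)[unfolded linear_conv_bounded_linear]],
      rule linear_continuous_on[OF linear_copy(2)[unfolded linear_conv_bounded_linear]])

lemma distr_of_copy: "distr lborel borel (of_copy :: _ \<Rightarrow> real^'n::finite) = lborel"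
proof (rule lborel_eqI[symmetric])
  fix l u :: "real^'n::finite" assume le: "\<And>b. b \<in> Basis \<Longrightarrow> l \<bullet> b \<le> u \<bullet> b"
  have [measurable]: "(of_copy :: _ \<Rightarrow> real^'n) \<in> borel_measurable borel"
    by (rule borel_measurable_continuous_onI[OF continuous_copy(2)])
  have le': "l $ i \<le> u $ i" for i
    using le[of "axis i 1"] by (auto simp: Basis_vec_def inner_axis)
  have ball: "(\<forall>i. P (Abs_wo_copy i)) \<longleftrightarrow> (\<forall>i. P i)" for P :: "'n wo_copy \<Rightarrow> bool"
    by (metis Rep_wo_copy_inverse)
  have pre: "of_copy -` box l u = box (to_copy l) (to_copy u)"
  proof -
    have "of_copy x \<in> box l u \<longleftrightarrow> x \<in> box (to_copy l) (to_copy u)" for x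
      using ball[of "\<lambda>i. l $ Rep_wo_copy i < x $ i \<and> x $ i < u $ Rep_wo_copy i"]
      by (simp add: mem_box_cart of_copy_def to_copy_def Abs_wo_copy_inverse)
    then show ?thesis by auto
  qed
  have "emeasure (distr lborel borel of_copy) (box l u) = emeasure lborel (box (to_copy l) (to_copy u))"
    by (simp add: emeasure_distr pre)
  also have "\<dots> = (\<Prod>b\<in>Basis. (to_copy u - to_copy l) \<bullet> b)"
    using le' by (subst emeasure_lborel_box) (auto simp: Basis_vec_def inner_axis to_copy_def)
  also have "\<dots> = (\<Prod>i\<in>UNIV. u $ Rep_wo_copy i - l $ Rep_wo_copy i)"
    unfolding prod_Basis_cart by (simp add: inner_axis to_copy_def)
  also have "(\<Prod>i\<in>UNIV. u $ Rep_wo_copy i - l $ Rep_wo_copy i) = (\<Prod>i\<in>UNIV. u $ i - l $ i)"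
  proof (rule prod.reindex_bij_betw)
    show "bij Rep_wo_copy"
      by (rule bijI', rule Rep_wo_copy_inject) (metis Abs_wo_copy_inverse UNIV_I)
  qed
  also have "\<dots> = (\<Prod>b\<in>Basis. (u - l) \<bullet> b)"
    unfolding prod_Basis_cart by (simp add: inner_axis)
  finally show "emeasure (distr lborel borel of_copy) (box l u) = (\<Prod>b\<in>Basis. (u - l) \<bullet> b)" .
qed simp

context graded
begin

text \<open>The determinant is computed in the copied coordinates.\<close>

definition jacobian :: "((real, 'n) vec \<Rightarrow> (real, 'n) vec) \<Rightarrow> real" where
  "jacobian f = det (matrix (to_copy \<circ> f \<circ> of_copy))"

lemma jacobian_comp:
  assumes "linear f" "linear g" shows "jacobian (f \<circ> g) = jacobian f * jacobian g"
proof -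
  have "to_copy \<circ> (f \<circ> g) \<circ> of_copy = (to_copy \<circ> f \<circ> of_copy) \<circ> (to_copy \<circ> g \<circ> of_copy)"
    by (simp add: fun_eq_iff)
  moreover have "linear (to_copy \<circ> f \<circ> of_copy)" "linear (to_copy \<circ> g \<circ> of_copy)"
    using assms linear_copy by (auto intro!: linear_compose)
  ultimately show ?thesis unfolding jacobian_def by (simp only: matrix_compose det_mul)
qed

lemma jacobian_ident: "jacobian (\<lambda>x. x) = 1"
proof -
  have "to_copy \<circ> (\<lambda>x. x) \<circ> of_copy = (id :: _ \<Rightarrow> real^('n wo_copy))" by (simp add: fun_eq_iff)
  then show ?thesis by (simp add: jacobian_def)
qed

text \<open>The Jacobian at the unit of the left translation by \<open>x\<close> is invariant under dilations, and
  these contract \<open>x\<close> to the unit.\<close>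

lemma jacobian_left_field: "jacobian (left_field x) = 1"
proof -
  have inv: "jacobian (left_field (dil \<upsilon> r x)) = jacobian (left_field x)" if "r \<noteq> 0" for r
  proof -
    have "dil \<upsilon> r \<circ> dil \<upsilon> (1/r) = (\<lambda>x. x)" using that by (simp add: fun_eq_iff)
    then have "jacobian (dil \<upsilon> r) * jacobian (dil \<upsilon> (1/r)) = 1"
      by (metis jacobian_comp jacobian_ident linear_dil)
    then have "jacobian (dil \<upsilon> r) \<noteq> 0" by auto
    moreover have "left_field (dil \<upsilon> r x) \<circ> dil \<upsilon> r = dil \<upsilon> r \<circ> left_field x"
      by (simp add: fun_eq_iff dil_left_field)
    then have "jacobian (left_field (dil \<upsilon> r x)) * jacobian (dil \<upsilon> r) = jacobian (dil \<upsilon> r) * jacobian (left_field x)"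
      by (metis jacobian_comp linear_dil linear_left_field)
    ultimately show ?thesis by simp
  qed
  have "isCont (\<lambda>r. left_field (dil \<upsilon> r x) v) 0" for v
  proof -
    have "continuous_on UNIV (\<lambda>r. dil \<upsilon> r x)"
      unfolding dil_def by (intro continuous_on_vec_lambda continuous_intros)
    then have "isCont (\<lambda>r. dil \<upsilon> r x) 0" by (simp add: continuous_on_eq_continuous_at)
    then show ?thesis unfolding left_field_def by (intro isCont_dm continuous_intros)
  qed
  then have "isCont (\<lambda>r. jacobian (left_field (dil \<upsilon> r x))) 0"
    unfolding jacobian_def det_def matrix_def to_copy_def by (auto intro!: continuous_intros)
  then have "((\<lambda>r. jacobian (left_field (dil \<upsilon> r x))) \<longlongrightarrow> jacobian (left_field 0)) (at 0)"
    by (simp add: isCont_def)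
  then have "((\<lambda>r::real. jacobian (left_field x)) \<longlongrightarrow> jacobian (left_field 0)) (at 0)"
    by (rule Lim_transform_eventually) (auto simp: eventually_at_filter inv)
  then have "jacobian (left_field x) = jacobian (left_field 0)"
    by (metis tendsto_const_iff trivial_limit_at)
  moreover have "left_field 0 = (\<lambda>x. x)" by (simp add: left_field_def fun_eq_iff)
  ultimately show ?thesis by (simp add: jacobian_ident)
qed

lemma continuous_mult_left: "continuous_on UNIV (\<lambda>y. m x y)"
  and continuous_mult_right: "continuous_on UNIV (\<lambda>y. m y x)"
  by (auto simp: continuous_on_eq_continuous_at intro!: isCont_mult)

text \<open>The derivative of the translation by \<open>x\<close> at \<open>y\<close> maps the left-invariant fields at \<open>y\<close> to those at
  \<open>x y\<close>, so its Jacobian is a quotient of two Jacobians at the unit.\<close>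

lemma left_invariant: "distr lborel borel (m x) = lborel"
proof -
  define D where "D = (\<lambda>y v. dm (- x, y) (0, v))"
  have D: "(m (- x) has_derivative D y) (at y)" for y
    using mult_has_derivative[OF has_derivative_const[of "- x"] has_derivative_ident[of "at y"]]
    by (simp add: D_def)
  have "D y \<circ> left_field y = left_field (m (- x) y)" for y
  proof
    fix v
    have "((\<lambda>t. m (- x) (m y (t *\<^sub>R v))) has_vector_derivative dm (- x, y) (0, left_field y v)) (at 0)"
      using mult_has_vector_derivative[OF has_vector_derivative_const[of "- x"] left_field_deriv[of y v]]
      by simp
    then show "(D y \<circ> left_field y) v = left_field (m (- x) y) v"
      using left_field_deriv[of "m (- x) y" v] by (simp add: assoc D_def vector_derivative_unique_at)
  qed
  then have J: "jacobian (D y) = 1" for y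
    using jacobian_comp[OF has_derivative_linear[OF D] linear_left_field, of y y] by (simp add: jacobian_left_field)
  define f where "f = to_copy \<circ> m x \<circ> of_copy"
  define g where "g = to_copy \<circ> m (- x) \<circ> of_copy"
  have df: "distr lborel borel f = lborel"
  proof (rule distr_lborel_det_1)
    show "continuous_on UNIV f" unfolding f_def
      by (intro continuous_on_compose continuous_on_subset[OF continuous_copy(1)] continuous_copy
          continuous_on_subset[OF continuous_mult_left]) auto
    show "(g has_derivative to_copy \<circ> D (of_copy y) \<circ> of_copy) (at y)" for y
      unfolding g_def
      by (intro diff_chain_at linear_imp_has_derivative linear_copy) (simp_all add: D)
  qed (auto simp: f_def g_def J jacobian_def[symmetric])
  have [measurable]: "of_copy \<in> borel \<rightarrow>\<^sub>M (borel :: (real, 'n) vec measure)"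
    "m x \<in> borel \<rightarrow>\<^sub>M borel" "to_copy \<in> (borel :: (real, 'n) vec measure) \<rightarrow>\<^sub>M borel"
    by (intro borel_measurable_continuous_onI continuous_copy continuous_mult_left)+
  have "distr lborel borel (m x) = distr (distr lborel borel of_copy) borel (m x)"
    by (simp add: distr_of_copy)
  also have "\<dots> = distr (distr lborel borel f) borel of_copy"
    by (subst (1 2) distr_distr) (auto simp: f_def o_def)
  finally show ?thesis by (simp add: df distr_of_copy)
qed

lemma inversion_invariant: "distr lborel borel uminus = (lborel :: (real, 'n) vec measure)"
  using lborel_affine[of "-1" "0 :: (real, 'n) vec"] by (simp add: density_1)

lemma right_invariant: "distr lborel borel (\<lambda>y. m y x) = lborel"
proof -
  have [measurable]: "m (- x) \<in> borel \<rightarrow>\<^sub>M borel"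
    by (intro borel_measurable_continuous_onI continuous_mult_left)
  have "distr lborel borel (\<lambda>y. m y x) = distr (distr (distr lborel borel uminus) borel (m (- x))) borel uminus"
  proof -
    have eq: "(\<lambda>y. m y x) = uminus \<circ> (m (- x) \<circ> uminus)" by (simp add: fun_eq_iff minus_mult)
    show ?thesis unfolding eq by (subst (1 2) distr_distr) (auto simp: comp_assoc intro!: measurable_comp[of _ _ borel])
  qed
  then show ?thesis by (simp add: inversion_invariant left_invariant)
qed

end


section \<open>Square-summable and square-integrable functions\<close>

lemma mult_le_half_squares: "a * b \<le> (a\<^sup>2 + b\<^sup>2) / (2 :: real)"
  using sum_squares_bound[of a b] by simp

lemma norm_add_squares:
  fixes a b :: "'a::real_normed_vector"
  shows "(norm (a + b))\<^sup>2 \<le> 2 * (norm a)\<^sup>2 + 2 * (norm b)\<^sup>2"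
proof -
  have "(norm (a + b))\<^sup>2 \<le> (norm a + norm b)\<^sup>2"
    by (intro power_mono norm_triangle_ineq) simp
  then show ?thesis using mult_le_half_squares[of "norm a" "norm b"] by (simp add: power2_sum)
qed

lemma integrable_dominated:
  fixes f :: "'a \<Rightarrow> 'b::{banach, second_countable_topology}" and g :: "'a \<Rightarrow> real"
  assumes "integrable M g" "f \<in> borel_measurable M" "\<And>x. norm (f x) \<le> g x"
  shows "integrable M f"
  by (rule Bochner_Integration.integrable_bound[OF assms(1,2)])
    (intro AE_I2 order_trans[OF assms(3)], simp)

lemma cnj_measurable [measurable (raw)]:
  "f \<in> borel_measurable M \<Longrightarrow> (\<lambda>x. cnj (f x)) \<in> borel_measurable M"
  by (rule measurable_compose[OF _ borel_measurable_continuous_onI[of cnj]]) (auto intro: continuous_intros)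

lemma L1_D: "f \<in> L1 \<Longrightarrow> integrable lborel f" by (simp add: L1_def)

lemma L1_bounded_imp_L2:
  assumes f: "f \<in> L1" and B: "\<And>x. cmod (f x) \<le> B" shows "f \<in> L2"
proof -
  have [measurable]: "f \<in> borel_measurable borel" using f by (simp add: L1_def)
  have "integrable lborel (\<lambda>x. B * cmod (f x))" using L1_D[OF f] by simp
  then have "integrable lborel (\<lambda>x. (cmod (f x))\<^sup>2)"
    by (rule integrable_dominated) (auto simp: power2_eq_square B intro!: mult_right_mono)
  then show ?thesis by (simp add: L2_def)
qed

lemma L2_add:
  assumes "f \<in> L2" "g \<in> L2" shows "(\<lambda>x. f x + t * g x) \<in> L2"
proof -
  have [measurable]: "f \<in> borel_measurable borel" "g \<in> borel_measurable borel"
    using assms by (auto simp: L2_def)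
  have "integrable lborel (\<lambda>x. 2 * (cmod (f x))\<^sup>2 + 2 * ((cmod t)\<^sup>2 * (cmod (g x))\<^sup>2))"
    using assms by (simp add: L2_def)
  then have "integrable lborel (\<lambda>x. (cmod (f x + t * g x))\<^sup>2)"
  proof (rule integrable_dominated)
    show "norm ((cmod (f x + t * g x))\<^sup>2) \<le> 2 * (cmod (f x))\<^sup>2 + 2 * ((cmod t)\<^sup>2 * (cmod (g x))\<^sup>2)" for x
      using norm_add_squares[of "f x" "t * g x"] by (simp add: norm_mult power_mult_distrib)
  qed measurable
  then show ?thesis by (simp add: L2_def)
qed

lemma L2_L1_lincomb:
  assumes "f \<in> L1 \<inter> L2" "g \<in> L1 \<inter> L2" shows "(\<lambda>x. f x + t * g x) \<in> L1 \<inter> L2"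
  using assms L2_add by (auto simp: L1_def)

lemma L2_mult_integrable:
  assumes "f \<in> L2" "g \<in> L2" shows "integrable lborel (\<lambda>x. f x * cnj (g x))"
proof -
  have [measurable]: "f \<in> borel_measurable borel" "g \<in> borel_measurable borel"
    using assms by (auto simp: L2_def)
  have "integrable lborel (\<lambda>x. ((cmod (f x))\<^sup>2 + (cmod (g x))\<^sup>2) / 2)" using assms by (simp add: L2_def)
  then show ?thesis
    by (rule integrable_dominated) (measurable, simp only: norm_mult complex_mod_cnj mult_le_half_squares)
qed

lemma integrable_mult_bounded:
  fixes G :: "'b \<Rightarrow> complex"
  assumes "integrable M f" "G \<in> borel_measurable M" "\<And>x. cmod (G x) \<le> B"
  shows "integrable M (\<lambda>x. f x * G x)"
proof (rule integrable_dominated)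
  show "integrable M (\<lambda>x. cmod (f x) * B)" using assms by simp
qed (use assms in \<open>auto simp: norm_mult intro!: mult_left_mono\<close>)

section \<open>The model Hilbert spaces\<close>

lemma ell2_summable: "v \<in> ell2 I \<Longrightarrow> summable (\<lambda>n. (cmod (v n))\<^sup>2)"
  by (simp add: ell2_def)

lemma ell2_lincomb:
  assumes "v \<in> ell2 I" "w \<in> ell2 I" shows "(\<lambda>n. a * v n + b * w n) \<in> ell2 I"
proof -
  have summable: "summable (\<lambda>n. 2 * ((cmod a)\<^sup>2 * (cmod (v n))\<^sup>2) + 2 * ((cmod b)\<^sup>2 * (cmod (w n))\<^sup>2))"
    using assms by (intro summable_add summable_mult ell2_summable)
  have "(cmod (a * v n + b * w n))\<^sup>2 \<le> 2 * ((cmod a)\<^sup>2 * (cmod (v n))\<^sup>2) + 2 * ((cmod b)\<^sup>2 * (cmod (w n))\<^sup>2)" for n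
    using norm_add_squares[of "a * v n" "b * w n"] by (simp add: norm_mult power_mult_distrib)
  then have "summable (\<lambda>n. (cmod (a * v n + b * w n))\<^sup>2)"
    by (intro summable_comparison_test'[OF summable, of 0]) simp
  then show ?thesis using assms by (simp add: ell2_def)
qed

lemma ell2_zero [simp]: "(\<lambda>n. 0) \<in> ell2 I"
  by (simp add: ell2_def)

lemma ell2_diff: "v \<in> ell2 I \<Longrightarrow> w \<in> ell2 I \<Longrightarrow> (\<lambda>n. v n - w n) \<in> ell2 I"
  using ell2_lincomb[of v I w 1 "-1"] by simp

lemma ell2_norm_nonneg: "v \<in> ell2 I \<Longrightarrow> 0 \<le> ell2_norm v"
  by (simp add: ell2_norm_def ell2_summable suminf_nonneg)

lemma L2_set_le_ell2_norm:
  assumes "v \<in> ell2 I" shows "L2_set (\<lambda>n. cmod (v n)) {..<N} \<le> ell2_norm v"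
  unfolding L2_set_def ell2_norm_def using ell2_summable[OF assms]
  by (intro real_sqrt_le_mono sum_le_suminf) auto

lemma ell2_abs_mult_summable:
  assumes "v \<in> ell2 I" "w \<in> ell2 J" shows "summable (\<lambda>n. cmod (v n * cnj (w n)))"
proof (rule summable_comparison_test'[where N = 0])
  show "summable (\<lambda>n. ((cmod (v n))\<^sup>2 + (cmod (w n))\<^sup>2) / 2)"
    using assms by (intro summable_divide summable_add ell2_summable)
qed (simp only: norm_mult real_norm_def abs_mult abs_norm_cancel complex_mod_cnj mult_le_half_squares)

lemma ell2_mult_summable:
  "v \<in> ell2 I \<Longrightarrow> w \<in> ell2 J \<Longrightarrow> summable (\<lambda>n. v n * cnj (w n))"
  using summable_norm_cancel[OF ell2_abs_mult_summable] .

lemma ell2_inner_sums: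
  "v \<in> ell2 I \<Longrightarrow> w \<in> ell2 J \<Longrightarrow> (\<lambda>N. \<Sum>n<N. v n * cnj (w n)) \<longlonglongrightarrow> ell2_inner v w"
  unfolding ell2_inner_def using summable_LIMSEQ[OF ell2_mult_summable] .

lemma ell2_cauchy_schwarz:
  assumes "v \<in> ell2 I" "w \<in> ell2 J" shows "cmod (ell2_inner v w) \<le> ell2_norm v * ell2_norm w"
proof (rule LIMSEQ_le_const2[OF tendsto_norm[OF ell2_inner_sums[OF assms]]])
  have "cmod (\<Sum>n<N. v n * cnj (w n)) \<le> ell2_norm v * ell2_norm w" for N
  proof -
    have "cmod (\<Sum>n<N. v n * cnj (w n)) \<le> (\<Sum>n<N. \<bar>cmod (v n)\<bar> * \<bar>cmod (w n)\<bar>)"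
      by (rule order_trans[OF norm_sum]) (simp add: norm_mult)
    also have "\<dots> \<le> L2_set (\<lambda>n. cmod (v n)) {..<N} * L2_set (\<lambda>n. cmod (w n)) {..<N}"
      by (rule L2_set_mult_ineq)
    also have "\<dots> \<le> ell2_norm v * ell2_norm w"
      by (intro mult_mono L2_set_le_ell2_norm[OF assms(1)] L2_set_le_ell2_norm[OF assms(2)] ell2_norm_nonneg[OF assms(1)]) auto
    finally show ?thesis .
  qed
  then show "\<exists>N0. \<forall>N\<ge>N0. cmod (\<Sum>n<N. v n * cnj (w n)) \<le> ell2_norm v * ell2_norm w" by blast
qed

lemma ell2_inner_self: "v \<in> ell2 I \<Longrightarrow> ell2_inner v v = of_real ((ell2_norm v)\<^sup>2)"
  using suminf_of_real[OF ell2_summable, of v I, where 'a = complex]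
  by (simp add: ell2_inner_def ell2_norm_def suminf_nonneg ell2_summable flip: complex_norm_square)

lemma ell2_inner_lincomb_right:
  assumes "v \<in> ell2 I" "w \<in> ell2 I" "u \<in> ell2 I"
  shows "ell2_inner u (\<lambda>n. a * v n + b * w n) = cnj a * ell2_inner u v + cnj b * ell2_inner u w"
proof -
  have "(\<lambda>n. cnj a * (u n * cnj (v n)) + cnj b * (u n * cnj (w n))) sums
      (cnj a * ell2_inner u v + cnj b * ell2_inner u w)"
    unfolding ell2_inner_def
    using assms by (intro sums_add sums_mult summable_sums ell2_mult_summable)
  then show ?thesis
    unfolding ell2_inner_def[of u "\<lambda>n. a * v n + b * w n"] by (auto simp: sums_iff algebra_simps)
qed

definition truncate :: "nat \<Rightarrow> hvec \<Rightarrow> hvec" where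
  "truncate N u = (\<lambda>n. if n < N then u n else 0)"

lemma truncate_ell2: "(\<And>n. n \<notin> I \<Longrightarrow> u n = 0) \<Longrightarrow> truncate N u \<in> ell2 I"
  unfolding ell2_def truncate_def
  by (auto intro!: summable_finite[of "{..<N}"] split: if_splits)

lemma unit_vec_ell2: "n \<in> I \<Longrightarrow> unit_vec n \<in> ell2 I"
  unfolding ell2_def unit_vec_def by (auto intro!: summable_finite[of "{n}"] split: if_splits)

lemma truncate_norm_sq:
  "(ell2_norm (truncate N u))\<^sup>2 = (\<Sum>n<N. (cmod (u n))\<^sup>2)"
proof -
  have "(\<Sum>n. (cmod (truncate N u n))\<^sup>2) = (\<Sum>n<N. (cmod (truncate N u n))\<^sup>2)"
    by (rule suminf_finite) (auto simp: truncate_def)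
  then show ?thesis by (simp add: ell2_norm_def sum_nonneg truncate_def)
qed

lemma truncate_tendsto:
  assumes "u \<in> ell2 I" shows "(\<lambda>N. ell2_norm (\<lambda>n. truncate N u n - u n)) \<longlonglongrightarrow> 0"
proof -
  have s: "summable (\<lambda>n. (cmod (u n))\<^sup>2)" by (rule ell2_summable[OF assms])
  have "(\<Sum>n. (cmod (truncate N u n - u n))\<^sup>2) = (\<Sum>n. (cmod (u n))\<^sup>2) - (\<Sum>n<N. (cmod (u n))\<^sup>2)" for N
  proof -
    have "(\<Sum>n. (cmod (truncate N u n))\<^sup>2) = (\<Sum>n<N. (cmod (u n))\<^sup>2)"
      using suminf_finite[of "{..<N}" "\<lambda>n. (cmod (truncate N u n))\<^sup>2"] by (auto simp: truncate_def)
    moreover have "summable (\<lambda>n. (cmod (truncate N u n))\<^sup>2)"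
      by (rule summable_finite[of "{..<N}"]) (auto simp: truncate_def)
    moreover have "(cmod (truncate N u n - u n))\<^sup>2 = (cmod (u n))\<^sup>2 - (cmod (truncate N u n))\<^sup>2" for n
      by (simp add: truncate_def)
    ultimately show ?thesis using suminf_diff[OF s, of "\<lambda>n. (cmod (truncate N u n))\<^sup>2"] by simp
  qed
  moreover have "(\<lambda>N. sqrt ((\<Sum>n. (cmod (u n))\<^sup>2) - (\<Sum>n<N. (cmod (u n))\<^sup>2))) \<longlonglongrightarrow> sqrt ((\<Sum>n. (cmod (u n))\<^sup>2) - (\<Sum>n. (cmod (u n))\<^sup>2))"
    by (intro tendsto_intros summable_LIMSEQ s)
  ultimately show ?thesis by (simp add: ell2_norm_def)
qed

section \<open>The group Fourier transform\<close>

locale urep =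
  fixes m :: "'a::euclidean_space \<Rightarrow> 'a \<Rightarrow> 'a" and I U
  assumes rep: "unitary_rep m (I, U)"
begin

lemma U_ell2: "U x v \<in> ell2 I"
  using rep by (cases "v \<in> ell2 I") (auto simp: unitary_rep_def)

lemma U_outside: "v \<notin> ell2 I \<Longrightarrow> U x v = (\<lambda>n. 0)"
  using rep by (simp add: unitary_rep_def)

lemma U_lincomb: "v \<in> ell2 I \<Longrightarrow> w \<in> ell2 I \<Longrightarrow>
    U x (\<lambda>n. a * v n + b * w n) = (\<lambda>n. a * U x v n + b * U x w n)"
  using rep by (simp add: unitary_rep_def linear_on_ell2_def)

lemma U_mult: "v \<in> ell2 I \<Longrightarrow> U (m x y) v = U x (U y v)"
  using rep by (simp add: unitary_rep_def)

lemma U_norm: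
  assumes "v \<in> ell2 I" shows "ell2_norm (U x v) = ell2_norm v"
proof -
  have "ell2_inner (U x v) (U x v) = ell2_inner v v" using rep assms by (simp add: unitary_rep_def)
  then have "(ell2_norm (U x v))\<^sup>2 = (ell2_norm v)\<^sup>2"
    using ell2_inner_self[OF assms] ell2_inner_self[OF U_ell2, of x v] by (metis of_real_eq_iff)
  then show ?thesis by (simp add: power2_eq_iff_nonneg ell2_norm_nonneg[OF assms] ell2_norm_nonneg[OF U_ell2])
qed

lemma coeff_bound:
  "v \<in> ell2 I \<Longrightarrow> u \<in> ell2 I \<Longrightarrow> cmod (ell2_inner v (U x u)) \<le> ell2_norm v * ell2_norm u"
  using ell2_cauchy_schwarz[of v I "U x u" I] by (simp add: U_ell2 U_norm)

lemma coeff_diff: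
  assumes "v \<in> ell2 I" "u \<in> ell2 I" "w \<in> ell2 I"
  shows "ell2_inner v (U x u) - ell2_inner v (U x w) = ell2_inner v (U x (\<lambda>n. u n - w n))"
  using U_lincomb[OF assms(2,3), of x 1 "-1"] ell2_inner_lincomb_right[OF U_ell2 U_ell2 assms(1), of 1 x u "-1" x w]
  by simp

lemma coeff_continuous:
  assumes "v \<in> ell2 I" "u \<in> ell2 I" shows "continuous_on UNIV (\<lambda>x. ell2_inner v (U x u))"
proof -
  have "((\<lambda>y. ell2_inner v (U y u)) \<longlongrightarrow> ell2_inner v (U x u)) (at x)" for x
  proof -
    have "((\<lambda>y. ell2_norm (\<lambda>n. U y u n - U x u n)) \<longlongrightarrow> 0) (at x)"
      using rep assms by (simp add: unitary_rep_def)
    then have "((\<lambda>y. ell2_norm v * ell2_norm (\<lambda>n. U y u n - U x u n)) \<longlongrightarrow> 0) (at x)"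
      by (rule tendsto_mult_right_zero)
    then have "((\<lambda>y. ell2_inner v (U y u) - ell2_inner v (U x u)) \<longlongrightarrow> 0) (at x)"
    proof (rule Lim_null_comparison[rotated])
      have "norm (ell2_inner v (U y u) - ell2_inner v (U x u)) \<le> ell2_norm v * ell2_norm (\<lambda>n. U y u n - U x u n)" for y
        using ell2_cauchy_schwarz[OF assms(1) ell2_diff[OF U_ell2 U_ell2], of y u x u]
          ell2_inner_lincomb_right[OF U_ell2 U_ell2 assms(1), of 1 y u "-1" x u] by simp
      then show "\<forall>\<^sub>F y in at x. norm (ell2_inner v (U y u) - ell2_inner v (U x u)) \<le> ell2_norm v * ell2_norm (\<lambda>n. U y u n - U x u n)"
        by simp
    qed
    then show ?thesis by (simp add: LIM_zero_iff)
  qed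
  then show ?thesis by (simp add: continuous_on_eq_continuous_at isCont_def)
qed

lemma coeff_measurable [measurable]:
  "v \<in> ell2 I \<Longrightarrow> u \<in> ell2 I \<Longrightarrow> (\<lambda>x. ell2_inner v (U x u)) \<in> borel_measurable borel"
  by (rule borel_measurable_continuous_onI[OF coeff_continuous])

lemma coeff_integrable:
  assumes "v \<in> ell2 I" "u \<in> ell2 I" "f \<in> L1"
  shows "integrable lborel (\<lambda>y. f y * ell2_inner v (U y u))"
  using L1_D[OF assms(3)] coeff_measurable[OF assms(1,2)] coeff_bound[OF assms(1,2)]
  by (intro integrable_mult_bounded[where B = "ell2_norm v * ell2_norm u"]) auto

lemma unit_vec_coeff: "n \<notin> I \<Longrightarrow> ell2_inner v (U y (unit_vec n)) = 0"
proof -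
  assume "n \<notin> I"
  then have "unit_vec n \<notin> ell2 I" by (auto simp: ell2_def unit_vec_def)
  then show ?thesis by (simp add: U_outside ell2_inner_def)
qed

lemma fourier_eq:
  "v \<in> ell2 I \<Longrightarrow> fourier f (I, U) v n = (LINT y|lborel. f y * ell2_inner v (U y (unit_vec n)))"
  by (cases "n \<in> I") (simp_all add: fourier_def adj_def unit_vec_coeff)

lemma coeff_truncate:
  assumes "v \<in> ell2 I" "\<And>n. n \<notin> I \<Longrightarrow> u n = 0"
  shows "ell2_inner v (U y (truncate N u)) = (\<Sum>n<N. cnj (u n) * ell2_inner v (U y (unit_vec n)))"
proof (induction N)
  case 0
  have "U y (\<lambda>n. 0) = (\<lambda>n. 0)" using U_lincomb[of "\<lambda>n. 0" "\<lambda>n. 0" y 0 0] by simp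
  then show ?case by (simp add: truncate_def ell2_inner_def)
next
  case (Suc N)
  show ?case
  proof (cases "N \<in> I")
    case True
    have *: "truncate (Suc N) u = (\<lambda>n. 1 * truncate N u n + u N * unit_vec N n)"
      by (auto simp: truncate_def unit_vec_def fun_eq_iff less_Suc_eq)
    have tr: "truncate N u \<in> ell2 I" by (rule truncate_ell2) (rule assms(2))
    show ?thesis
      unfolding * using U_lincomb[OF tr unit_vec_ell2[OF True], of y 1 "u N"]
        ell2_inner_lincomb_right[OF U_ell2 U_ell2 assms(1), of 1 y "truncate N u" "u N" y "unit_vec N"] assms(2) Suc
      by simp
  next
    case False
    then have "truncate (Suc N) u = truncate N u"
      using assms(2) by (auto simp: truncate_def fun_eq_iff less_Suc_eq)
    then show ?thesis using False Suc assms(2) by simp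
  qed
qed

lemma fourier_truncate:
  assumes "v \<in> ell2 I" "\<And>n. n \<notin> I \<Longrightarrow> u n = 0" "f \<in> L1"
  shows "(\<Sum>n<N. fourier f (I, U) v n * cnj (u n)) = (LINT y|lborel. f y * ell2_inner v (U y (truncate N u)))"
proof -
  have int: "integrable lborel (\<lambda>y. cnj (u n) * (f y * ell2_inner v (U y (unit_vec n))))" for n
    using coeff_integrable[OF assms(1) unit_vec_ell2 assms(3)] by (cases "n \<in> I") (auto simp: unit_vec_coeff)
  have "(LINT y|lborel. f y * ell2_inner v (U y (truncate N u))) =
      (LINT y|lborel. (\<Sum>n<N. cnj (u n) * (f y * ell2_inner v (U y (unit_vec n)))))"
  proof -
    have "ell2_inner v (U y (truncate N u)) = (\<Sum>n<N. cnj (u n) * ell2_inner v (U y (unit_vec n)))" for y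
      by (rule coeff_truncate[OF assms(1)]) (rule assms(2))
    then show ?thesis by (simp add: sum_distrib_left algebra_simps)
  qed
  also have "\<dots> = (\<Sum>n<N. LINT y|lborel. cnj (u n) * (f y * ell2_inner v (U y (unit_vec n))))"
    by (rule Bochner_Integration.integral_sum) (rule int)
  also have "\<dots> = (\<Sum>n<N. fourier f (I, U) v n * cnj (u n))"
    by (simp add: fourier_eq[OF assms(1)] mult.commute)
  finally show ?thesis by simp
qed

text \<open>If \<open>u\<close> is a truncation of the transform of \<open>v\<close>, pairing the transform with \<open>u\<close> gives
  \<open>\<parallel>u\<parallel>\<^sup>2 \<le> \<parallel>f\<parallel>\<^sub>1 \<parallel>v\<parallel> \<parallel>u\<parallel>\<close>.\<close>

lemma fourier_ell2:
  assumes v: "v \<in> ell2 I" and f: "f \<in> L1" shows "fourier f (I, U) v \<in> ell2 I"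
proof -
  define u where "u = fourier f (I, U) v"
  \<comment> \<open>one more than the norm of \<open>f\<close>, to have a positive factor\<close>
  define A where "A = (LINT y|lborel. cmod (f y)) + 1"
  have "0 \<le> (LINT y|lborel. cmod (f y))" by (intro Bochner_Integration.integral_nonneg) simp
  then have A: "A > 0" unfolding A_def by linarith
  have out: "n \<notin> I \<Longrightarrow> u n = 0" for n
    unfolding u_def by (simp add: fourier_eq[OF v] unit_vec_coeff)
  have "(\<Sum>n<N. (cmod (u n))\<^sup>2) \<le> (A * ell2_norm v)\<^sup>2" for N
  proof -
    define S where "S = ell2_norm (truncate N u)"
    have tr: "truncate N u \<in> ell2 I" by (rule truncate_ell2[OF out])
    have S0: "0 \<le> S" unfolding S_def by (rule ell2_norm_nonneg[OF tr])
    have "complex_of_real (S\<^sup>2) = (\<Sum>n<N. u n * cnj (u n))"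
      unfolding S_def truncate_norm_sq of_real_sum complex_norm_square ..
    also have "\<dots> = (LINT y|lborel. f y * ell2_inner v (U y (truncate N u)))"
      unfolding u_def by (rule fourier_truncate[OF v out[unfolded u_def] f])
    finally have "S\<^sup>2 = cmod (LINT y|lborel. f y * ell2_inner v (U y (truncate N u)))"
      by (metis norm_of_real abs_of_nonneg zero_le_power2)
    also have "\<dots> \<le> (LINT y|lborel. cmod (f y * ell2_inner v (U y (truncate N u))))"
      by (rule integral_norm_bound)
    also have "\<dots> \<le> (LINT y|lborel. cmod (f y) * (ell2_norm v * S))"
      using integrable_norm[OF coeff_integrable[OF v tr f]] L1_D[OF f] coeff_bound[OF v tr]
      by (intro integral_mono) (auto simp: norm_mult S_def intro!: mult_left_mono)
    also have "\<dots> \<le> A * ell2_norm v * S"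
      using S0 ell2_norm_nonneg[OF v] by (simp add: A_def algebra_simps)
    finally have "S * S \<le> (A * ell2_norm v) * S" by (simp add: power2_eq_square)
    then have "S \<le> A * ell2_norm v"
      using A S0 ell2_norm_nonneg[OF v] by (cases "S = 0") auto
    then have "S\<^sup>2 \<le> (A * ell2_norm v)\<^sup>2" by (intro power_mono S0)
    then show ?thesis by (simp add: S_def truncate_norm_sq)
  qed
  then have "(\<Sum>n\<le>N. (cmod (u n))\<^sup>2) \<le> (A * ell2_norm v)\<^sup>2" for N
    unfolding lessThan_Suc_atMost[symmetric] .
  then have "summable (\<lambda>n. (cmod (u n))\<^sup>2)"
    by (intro bounded_imp_summable[where B = "(A * ell2_norm v)\<^sup>2"]) auto
  then show ?thesis using out by (auto simp: ell2_def u_def)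
qed

text \<open>For truncations of \<open>u\<close> this is the coordinatewise definition of the transform; dominated convergence
  removes the truncation.\<close>

lemma fourier_inner:
  assumes v: "v \<in> ell2 I" and u: "u \<in> ell2 I" and f: "f \<in> L1"
  shows "ell2_inner (fourier f (I, U) v) u = (LINT y|lborel. f y * ell2_inner v (U y u))"
proof -
  have out: "n \<notin> I \<Longrightarrow> u n = 0" for n using u by (simp add: ell2_def)
  have "(\<lambda>N. LINT y|lborel. f y * ell2_inner v (U y (truncate N u))) \<longlonglongrightarrow> ell2_inner (fourier f (I, U) v) u"
    using ell2_inner_sums[OF fourier_ell2[OF v f] u] by (simp add: fourier_truncate[OF v out f])
  moreover have "(\<lambda>N. LINT y|lborel. f y * ell2_inner v (U y (truncate N u))) \<longlonglongrightarrow> (LINT y|lborel. f y * ell2_inner v (U y u))"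
  proof (rule integral_dominated_convergence)
    show "integrable lborel (\<lambda>y. cmod (f y) * (ell2_norm v * ell2_norm u))" using L1_D[OF f] by simp
    show "AE y in lborel. (\<lambda>N. f y * ell2_inner v (U y (truncate N u))) \<longlonglongrightarrow> f y * ell2_inner v (U y u)"
    proof (intro AE_I2 tendsto_intros)
      fix y
      have "(\<lambda>N. ell2_norm v * ell2_norm (\<lambda>n. truncate N u n - u n)) \<longlonglongrightarrow> 0"
        by (intro tendsto_mult_right_zero truncate_tendsto[OF u])
      then have "(\<lambda>N. ell2_inner v (U y (truncate N u)) - ell2_inner v (U y u)) \<longlonglongrightarrow> 0"
        using coeff_bound[OF v ell2_diff[OF truncate_ell2[OF out] u]]
        by (elim Lim_null_comparison[rotated]) (auto simp: coeff_diff[OF v truncate_ell2[OF out] u])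
      then show "(\<lambda>N. ell2_inner v (U y (truncate N u))) \<longlonglongrightarrow> ell2_inner v (U y u)" by (simp add: LIM_zero_iff)
    qed
    show "AE y in lborel. norm (f y * ell2_inner v (U y (truncate N u))) \<le> cmod (f y) * (ell2_norm v * ell2_norm u)" for N
    proof (rule AE_I2)
      fix y
      have "(ell2_norm (truncate N u))\<^sup>2 \<le> (ell2_norm u)\<^sup>2"
        using sum_le_suminf[OF ell2_summable[OF u], of "{..<N}"]
        unfolding truncate_norm_sq by (simp add: ell2_norm_def suminf_nonneg ell2_summable[OF u])
      then have "ell2_norm (truncate N u) \<le> ell2_norm u"
        by (rule power2_le_imp_le) (rule ell2_norm_nonneg[OF u])
      then have "cmod (ell2_inner v (U y (truncate N u))) \<le> ell2_norm v * ell2_norm u"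
        by (intro order_trans[OF coeff_bound[OF v truncate_ell2[OF out]]] mult_left_mono ell2_norm_nonneg[OF v])
      then show "norm (f y * ell2_inner v (U y (truncate N u))) \<le> cmod (f y) * (ell2_norm v * ell2_norm u)"
        by (auto simp: norm_mult intro!: mult_left_mono)
    qed
    show "(\<lambda>y. f y * ell2_inner v (U y u)) \<in> borel_measurable lborel"
      using f u v by (auto simp: L1_def intro!: borel_measurable_times coeff_measurable)
    show "(\<lambda>y. f y * ell2_inner v (U y (truncate N u))) \<in> borel_measurable lborel" for N
      using f v truncate_ell2[OF out] by (auto simp: L1_def intro!: borel_measurable_times coeff_measurable)
  qed
  ultimately show ?thesis by (rule LIMSEQ_unique)
qed

end


section \<open>Convolution\<close>

context graded
begin

lemma mult_measurable [measurable (raw)]: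
  assumes "f \<in> borel_measurable M" "g \<in> borel_measurable M"
  shows "(\<lambda>x. m (f x) (g x)) \<in> borel_measurable M"
  using assms
  by (rule borel_measurable_continuous_Pair)
    (use smooth_isCont[OF smooth_mult] in \<open>simp add: continuous_on_eq_continuous_at\<close>)

lemma dil_measurable [measurable (raw)]:
  "f \<in> borel_measurable M \<Longrightarrow> (\<lambda>x. dil \<upsilon> r (f x)) \<in> borel_measurable M"
  by (rule measurable_compose[OF _ borel_measurable_continuous_onI[OF continuous_dil]])

lemma left_integral:
  fixes f :: "_ \<Rightarrow> 'b::{banach, second_countable_topology}"
  assumes [measurable]: "f \<in> borel_measurable borel"
  shows "(LINT x|lborel. f (m a x)) = (LINT x|lborel. f x)"
  by (subst (2) left_invariant[symmetric, of a], subst integral_distr) auto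

lemma left_integrable:
  fixes f :: "_ \<Rightarrow> 'b::{banach, second_countable_topology}"
  assumes [measurable]: "f \<in> borel_measurable borel"
  shows "integrable lborel (\<lambda>x. f (m a x)) \<longleftrightarrow> integrable lborel f"
  by (subst (2) left_invariant[symmetric, of a], subst integrable_distr_eq) auto

lemma conv_integrable:
  assumes "h \<in> L1" "k \<in> L1"
  shows "integrable (lborel \<Otimes>\<^sub>M lborel) (\<lambda>(y, x). h y * k (m (- y) x))"
proof (rule lborel_pair.Fubini_integrable)
  have [measurable]: "h \<in> borel_measurable borel" "k \<in> borel_measurable borel"
    and int: "integrable lborel h" "integrable lborel k"
    using assms by (auto simp: L1_def)
  show "(\<lambda>(y, x). h y * k (m (- y) x)) \<in> borel_measurable (lborel \<Otimes>\<^sub>M lborel)" by measurable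
  have "(LINT x|lborel. norm (h y * k (m (- y) x))) = cmod (h y) * (LINT x|lborel. cmod (k x))" for y
    using left_integral[of "\<lambda>x. cmod (k x)" "- y"] by (simp add: norm_mult)
  then show "integrable lborel (\<lambda>y. LINT x|lborel. norm (case (y, x) of (y, x) \<Rightarrow> h y * k (m (- y) x)))"
    using int by simp
  show "AE y in lborel. integrable lborel (\<lambda>x. case (y, x) of (y, x) \<Rightarrow> h y * k (m (- y) x))"
    using int left_integrable[of k] by simp
qed

lemma conv_L1:
  assumes "h \<in> L1" "k \<in> L1" shows "conv m h k \<in> L1"
proof -
  have "integrable lborel (conv m h k)"
    using lborel_pair.integrable_snd[OF conv_integrable[OF assms]] by (simp add: conv_def[abs_def])
  then show ?thesis by (auto simp: L1_def)
qed

lemma conv_L2: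
  assumes h: "h \<in> L1" and k: "k \<in> L1" and B: "\<And>x. cmod (k x) \<le> B"
  shows "conv m h k \<in> L2"
proof (rule L1_bounded_imp_L2[OF conv_L1[OF h k]])
  fix x
  have [measurable]: "h \<in> borel_measurable borel" "k \<in> borel_measurable borel"
    using assms by (auto simp: L1_def)
  have "integrable lborel (\<lambda>y. h y * k (m (- y) x))"
    using L1_D[OF h] B by (intro integrable_mult_bounded) auto
  then have "cmod (conv m h k x) \<le> (LINT y|lborel. cmod (h y) * B)"
    unfolding conv_def
    using L1_D[OF h] B
    by (intro order_trans[OF integral_norm_bound] integral_mono)
      (auto simp: norm_mult intro!: mult_left_mono dest: integrable_norm)
  then show "cmod (conv m h k x) \<le> (LINT y|lborel. cmod (h y) * B)" .
qed

lemma product_integrable: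
  assumes "h \<in> L1" "k \<in> L1"
  shows "integrable (lborel \<Otimes>\<^sub>M lborel) (\<lambda>(y, w). h y * k w)"
proof (rule lborel_pair.Fubini_integrable)
  have [measurable]: "h \<in> borel_measurable borel" "k \<in> borel_measurable borel"
    and int: "integrable lborel h" "integrable lborel k"
    using assms by (auto simp: L1_def)
  show "(\<lambda>(y, w). h y * k w) \<in> borel_measurable (lborel \<Otimes>\<^sub>M lborel)" by measurable
  show "integrable lborel (\<lambda>y. LINT w|lborel. norm (case (y, w) of (y, w) \<Rightarrow> h y * k w))"
    using int by (simp add: norm_mult)
  show "AE y in lborel. integrable lborel (\<lambda>w. case (y, w) of (y, w) \<Rightarrow> h y * k w)"
    using int by simp
qed

text \<open>The Fourier transform is an anti-homomorphism, as \<open>\<pi>(y)*\<close> appears in its definition.\<close>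

lemma fourier_conv:
  assumes rep: "unitary_rep m (I, U)" and h: "h \<in> L1" and k: "k \<in> L1" and v: "v \<in> ell2 I"
  shows "fourier (conv m h k) (I, U) v = fourier k (I, U) (fourier h (I, U) v)"
proof
  fix n
  interpret urep m I U by unfold_locales (rule rep)
  have hv: "fourier h (I, U) v \<in> ell2 I" by (rule fourier_ell2[OF v h])
  show "fourier (conv m h k) (I, U) v n = fourier k (I, U) (fourier h (I, U) v) n"
  proof (cases "n \<in> I")
    case False
    then show ?thesis by (simp add: fourier_eq[OF v] fourier_eq[OF hv] unit_vec_coeff)
  next
    case True
    define e where "e = unit_vec n"
    define G where "G = (\<lambda>x. ell2_inner v (U x e))"
    have e: "e \<in> ell2 I" unfolding e_def by (rule unit_vec_ell2[OF True])
    have [measurable]: "h \<in> borel_measurable borel" "k \<in> borel_measurable borel" "G \<in> borel_measurable borel"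
      using h k coeff_measurable[OF v e] by (auto simp: L1_def G_def)
    have G_bound: "cmod (G x) \<le> ell2_norm v * ell2_norm e" for x
      unfolding G_def by (rule coeff_bound[OF v e])
    have int1: "integrable (lborel \<Otimes>\<^sub>M lborel) (\<lambda>(y, x). h y * k (m (- y) x) * G x)"
      using integrable_mult_bounded[OF conv_integrable[OF h k], of "\<lambda>(y, x). G x" "ell2_norm v * ell2_norm e"] G_bound
      by (simp add: case_prod_unfold)
    have int2: "integrable (lborel \<Otimes>\<^sub>M lborel) (\<lambda>(y, w). h y * k w * G (m y w))"
      using integrable_mult_bounded[OF product_integrable[OF h k], of "\<lambda>(y, w). G (m y w)" "ell2_norm v * ell2_norm e"] G_bound
      by (simp add: case_prod_unfold)
    have "fourier (conv m h k) (I, U) v n = (LINT x|lborel. LINT y|lborel. h y * k (m (- y) x) * G x)"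
      by (simp add: fourier_eq[OF v] conv_def G_def e_def)
    also have "\<dots> = (LINT y|lborel. LINT x|lborel. h y * k (m (- y) x) * G x)"
      by (rule lborel_pair.Fubini_integral[OF int1])
    also have "\<dots> = (LINT y|lborel. LINT w|lborel. h y * k w * G (m y w))"
    proof (rule Bochner_Integration.integral_cong[OF refl])
      fix y
      show "(LINT x|lborel. h y * k (m (- y) x) * G x) = (LINT w|lborel. h y * k w * G (m y w))"
        using left_integral[of "\<lambda>x. h y * k (m (- y) x) * G x" y] by simp
    qed
    also have "\<dots> = (LINT w|lborel. LINT y|lborel. h y * k w * G (m y w))"
      by (rule lborel_pair.Fubini_integral[OF int2, symmetric])
    also have "\<dots> = (LINT w|lborel. k w * (LINT y|lborel. h y * ell2_inner v (U y (U w e))))"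
      by (simp add: G_def U_mult[OF e] mult_ac flip: Bochner_Integration.integral_mult_right_zero)
    also have "\<dots> = fourier k (I, U) (fourier h (I, U) v) n"
      by (simp add: fourier_eq[OF hv] fourier_inner[OF v U_ell2 h] e_def)
    finally show ?thesis .
  qed
qed

section \<open>Positivity through the Plancherel formula\<close>

lemma unitary_dual_rep_of:
  assumes "c \<in> unitary_dual m" shows "rep_of c \<in> c" "rep_of c \<in> irreps m"
proof -
  obtain \<pi> where \<pi>: "\<pi> \<in> irreps m"
      "c = {(\<pi>, \<rho>). \<pi> \<in> irreps m \<and> \<rho> \<in> irreps m \<and> rep_equiv \<pi> \<rho>} `` {\<pi>}"
    using assms by (auto simp: unitary_dual_def elim: quotientE)
  have "rep_equiv \<pi> \<pi>"
    unfolding rep_equiv_def by (rule exI[of _ "\<lambda>x. x"]) (auto simp: linear_on_ell2_def bij_betw_def)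
  then have "\<pi> \<in> c" using \<pi> by auto
  then show "rep_of c \<in> c" unfolding rep_of_def by (rule someI)
  then show "rep_of c \<in> irreps m" using \<pi> by auto
qed

lemma hs_norm_sq_mono:
  assumes "\<And>j. j \<in> I \<Longrightarrow> (ell2_norm (S (unit_vec j)))\<^sup>2 \<le> (ell2_norm (T (unit_vec j)))\<^sup>2"
  shows "hs_norm_sq I S \<le> hs_norm_sq I T"
  unfolding hs_norm_sq_def by (rule nn_integral_mono) (use assms in auto)

lemma fourier_lincomb:
  assumes rep: "unitary_rep m (I, U)" and h: "h \<in> L1" and k: "k \<in> L1" and v: "v \<in> ell2 I"
  shows "fourier (\<lambda>x. h x + t * k x) (I, U) v = (\<lambda>n. fourier h (I, U) v n + t * fourier k (I, U) v n)"
proof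
  fix n
  interpret urep m I U by unfold_locales (rule rep)
  show "fourier (\<lambda>x. h x + t * k x) (I, U) v n = fourier h (I, U) v n + t * fourier k (I, U) v n"
  proof (cases "n \<in> I")
    case True
    note i = coeff_integrable[OF v unit_vec_ell2[OF True]]
    show ?thesis
      using i[OF h] integrable_mult_right[OF i[OF k], of t]
      by (simp add: fourier_eq[OF v] algebra_simps flip: Bochner_Integration.integral_mult_right_zero)
  qed (simp add: fourier_eq[OF v] unit_vec_coeff)
qed

text \<open>\<open>\<parallel>v + t T v\<parallel>\<^sup>2 = \<parallel>v\<parallel>\<^sup>2 + 2 t Re \<langle>T v, v\<rangle> + t\<^sup>2 \<parallel>T v\<parallel>\<^sup>2\<close>\<close>

lemma nonneg_op_expand:
  assumes v: "v \<in> ell2 I" "T v \<in> ell2 I" and T: "ell2_inner (T v) v \<in> \<real>\<^sub>\<ge>\<^sub>0" and t: "t \<ge> 0"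
  shows "(ell2_norm v)\<^sup>2 \<le> (ell2_norm (\<lambda>n. v n + complex_of_real t * T v n))\<^sup>2"
proof -
  have s: "summable (\<lambda>n. Re (T v n * cnj (v n)))"
    using ell2_mult_summable[OF v(2,1)] by (rule summable_Re)
  have "(\<Sum>n. Re (T v n * cnj (v n))) = Re (ell2_inner (T v) v)"
    unfolding ell2_inner_def using Re_suminf[OF ell2_mult_summable[OF v(2,1)]] by simp
  then have pos: "0 \<le> (\<Sum>n. Re (T v n * cnj (v n)))"
    using T by (simp add: complex_nonneg_Reals_iff)
  have w: "(\<lambda>n. v n + complex_of_real t * T v n) \<in> ell2 I"
    using ell2_lincomb[OF v, of 1 "of_real t"] by simp
  have eq: "(cmod (v n + complex_of_real t * T v n))\<^sup>2 =
      (cmod (v n))\<^sup>2 + (2 * t * Re (T v n * cnj (v n)) + t\<^sup>2 * (cmod (T v n))\<^sup>2)" for n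
    by (simp only: cmod_power2) (simp add: power2_eq_square algebra_simps)
  have s2: "summable (\<lambda>n. 2 * t * Re (T v n * cnj (v n)))" "summable (\<lambda>n. t\<^sup>2 * (cmod (T v n))\<^sup>2)"
    using s ell2_summable[OF v(2)] by (auto intro: summable_mult)
  have "(\<Sum>n. (cmod (v n + complex_of_real t * T v n))\<^sup>2) =
      (\<Sum>n. (cmod (v n))\<^sup>2) + (2 * t * (\<Sum>n. Re (T v n * cnj (v n))) + t\<^sup>2 * (\<Sum>n. (cmod (T v n))\<^sup>2))"
    unfolding eq using s2 ell2_summable[OF v(1)] s ell2_summable[OF v(2)]
    by (subst suminf_add[symmetric] , (simp_all add: summable_add)[2])
       (subst suminf_add[symmetric], simp_all add: suminf_mult)
  moreover have "0 \<le> 2 * t * (\<Sum>n. Re (T v n * cnj (v n))) + t\<^sup>2 * (\<Sum>n. (cmod (T v n))\<^sup>2)"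
    using pos t ell2_summable[OF v(2)] by (simp add: suminf_nonneg)
  ultimately show ?thesis
    using ell2_summable[OF v(1)] ell2_summable[OF w] by (simp add: ell2_norm_def suminf_nonneg)
qed

lemma integral_norm_sq_expand:
  assumes f: "f \<in> L2" and g: "g \<in> L2"
  shows "(LINT x|lborel. (cmod (f x + complex_of_real t * g x))\<^sup>2) =
    (LINT x|lborel. (cmod (f x))\<^sup>2) + 2 * t * Re (L2_inner g f) + t\<^sup>2 * (LINT x|lborel. (cmod (g x))\<^sup>2)"
proof -
  have eq: "(cmod (f x + complex_of_real t * g x))\<^sup>2 =
      (cmod (f x))\<^sup>2 + 2 * t * Re (g x * cnj (f x)) + t\<^sup>2 * (cmod (g x))\<^sup>2" for x
    by (simp only: cmod_power2) (simp add: power2_eq_square algebra_simps)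
  have "integrable lborel (\<lambda>x. Re (g x * cnj (f x)))"
    by (intro integrable_Re L2_mult_integrable f g)
  moreover have "(LINT x|lborel. Re (g x * cnj (f x))) = Re (L2_inner g f)"
    unfolding L2_inner_def by (rule integral_Re[OF L2_mult_integrable[OF g f]])
  moreover have "integrable lborel (\<lambda>x. (cmod (f x))\<^sup>2)" "integrable lborel (\<lambda>x. (cmod (g x))\<^sup>2)"
    using f g by (auto simp: L2_def)
  ultimately show ?thesis unfolding eq by (simp del: times_complex.sel)
qed

text \<open>If \<open>k\<close> has a non-negative Fourier transform, then \<open>1 + t k\<close> increases every Hilbert--Schmidt
  norm, so \<open>\<parallel>h + t h * k\<parallel> \<ge> \<parallel>h\<parallel>\<close> by the Plancherel formula; the derivative at \<open>t = 0\<close> is the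
  claim.  This way the formula is needed for norms only.\<close>

theorem conv_nonneg:
  assumes pl: "plancherel_measure m \<mu>" and h: "h \<in> L1 \<inter> L2"
    and k: "k \<in> L1" and B: "\<And>x. cmod (k x) \<le> B"
    and pos: "AE c in \<mu>. \<forall>\<pi>\<in>c. nonneg_op (fst \<pi>) (fourier k \<pi>)"
  shows "0 \<le> Re (L2_inner (conv m h k) h)"
proof -
  define g where "g = conv m h k"
  have g: "g \<in> L1 \<inter> L2" unfolding g_def using conv_L1 conv_L2 h k B by blast
  have le: "(LINT x|lborel. (cmod (h x))\<^sup>2) \<le> (LINT x|lborel. (cmod (h x + complex_of_real t * g x))\<^sup>2)"
    if t: "0 \<le> t" for t
  proof -
    define f where "f = (\<lambda>x. h x + complex_of_real t * g x)"
    have f: "f \<in> L1 \<inter> L2" unfolding f_def by (rule L2_L1_lincomb[OF h g])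
    have hs: "hs_norm_sq (fst (rep_of c)) (fourier h (rep_of c)) \<le> hs_norm_sq (fst (rep_of c)) (fourier f (rep_of c))"
      if c: "c \<in> unitary_dual m" "\<forall>\<pi>\<in>c. nonneg_op (fst \<pi>) (fourier k \<pi>)" for c
    proof -
      obtain I U where IU: "rep_of c = (I, U)" by (cases "rep_of c")
      have rep: "unitary_rep m (I, U)" and no: "nonneg_op I (fourier k (I, U))"
        using unitary_dual_rep_of[OF c(1)] c(2) unfolding IU irreps_def by auto
      interpret urep m I U by unfold_locales (rule rep)
      show ?thesis unfolding IU fst_conv
      proof (rule hs_norm_sq_mono)
        fix j assume "j \<in> I"
        then have e: "unit_vec j \<in> ell2 I" by (rule unit_vec_ell2)
        define v where "v = fourier h (I, U) (unit_vec j)"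
        have v: "v \<in> ell2 I" unfolding v_def using fourier_ell2[OF e] h by blast
        have "fourier f (I, U) (unit_vec j) = (\<lambda>n. v n + complex_of_real t * fourier k (I, U) v n)"
          unfolding f_def v_def using fourier_lincomb[OF rep _ _ e] fourier_conv[OF rep _ k e] h g
          by (simp add: g_def)
        then show "(ell2_norm (fourier h (I, U) (unit_vec j)))\<^sup>2 \<le> (ell2_norm (fourier f (I, U) (unit_vec j)))\<^sup>2"
          using nonneg_op_expand[of v I "fourier k (I, U)" t] v t no fourier_ell2[OF v k]
          by (simp add: nonneg_op_def v_def)
      qed
    qed
    have sp: "space \<mu> = unitary_dual m" using pl by (simp add: plancherel_measure_def)
    have "(\<integral>\<^sup>+ x. ennreal ((cmod (h x))\<^sup>2) \<partial>lborel) = (\<integral>\<^sup>+ c. hs_norm_sq (fst (rep_of c)) (fourier h (rep_of c)) \<partial>\<mu>)"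
      using pl h unfolding plancherel_measure_def by blast
    also have "\<dots> \<le> (\<integral>\<^sup>+ c. hs_norm_sq (fst (rep_of c)) (fourier f (rep_of c)) \<partial>\<mu>)"
      by (rule nn_integral_mono_AE) (use pos hs sp in \<open>auto intro: AE_mp\<close>)
    also have "\<dots> = (\<integral>\<^sup>+ x. ennreal ((cmod (f x))\<^sup>2) \<partial>lborel)"
      using pl f unfolding plancherel_measure_def by (metis (no_types, lifting))
    finally have "ennreal (LINT x|lborel. (cmod (h x))\<^sup>2) \<le> ennreal (LINT x|lborel. (cmod (f x))\<^sup>2)"
      using h f by (simp add: nn_integral_eq_integral L2_def)
    then show ?thesis by (simp add: f_def)
  qed
  have key: "0 \<le> 2 * Re (L2_inner g h) + t * (LINT x|lborel. (cmod (g x))\<^sup>2)" if "t > 0" for t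
  proof -
    have "0 \<le> t * (2 * Re (L2_inner g h) + t * (LINT x|lborel. (cmod (g x))\<^sup>2))"
      using le[of t] that integral_norm_sq_expand[of h g t] h g
      by (simp add: distrib_left power2_eq_square[of t] mult.assoc mult.left_commute[of 2])
    then show ?thesis using that by (simp add: zero_le_mult_iff)
  qed
  have "((\<lambda>t. 2 * Re (L2_inner g h) + t * (LINT x|lborel. (cmod (g x))\<^sup>2)) \<longlongrightarrow> 2 * Re (L2_inner g h) + 0 * (LINT x|lborel. (cmod (g x))\<^sup>2)) (at_right 0)"
    by (intro tendsto_intros)
  then have "0 \<le> 2 * Re (L2_inner g h) + 0 * (LINT x|lborel. (cmod (g x))\<^sup>2)"
    by (rule tendsto_lowerbound) (auto simp: eventually_at_filter key)
  then show ?thesis by (simp add: g_def)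
qed

lemma fourier_injective:
  assumes pl: "plancherel_measure m \<mu>" and f: "f \<in> L1 \<inter> L2" and cont: "continuous_on UNIV f"
    and zero: "\<And>\<pi> v. \<pi> \<in> irreps m \<Longrightarrow> v \<in> ell2 (fst \<pi>) \<Longrightarrow> fourier f \<pi> v = (\<lambda>n. 0)"
  shows "f x = 0"
proof -
  have sp: "space \<mu> = unitary_dual m" using pl by (simp add: plancherel_measure_def)
  have hs: "hs_norm_sq (fst (rep_of c)) (fourier f (rep_of c)) = 0" if "c \<in> unitary_dual m" for c
  proof -
    have "ell2_norm (fourier f (rep_of c) (unit_vec j)) = 0" if "j \<in> fst (rep_of c)" for j
      using zero[OF unitary_dual_rep_of(2)[OF \<open>c \<in> _\<close>] unit_vec_ell2[OF that]] by (simp add: ell2_norm_def)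
    then have "hs_norm_sq (fst (rep_of c)) (fourier f (rep_of c)) = (\<integral>\<^sup>+ j. 0 \<partial>count_space (fst (rep_of c)))"
      unfolding hs_norm_sq_def by (intro nn_integral_cong) simp
    then show ?thesis by simp
  qed
  have "(\<integral>\<^sup>+ x. ennreal ((cmod (f x))\<^sup>2) \<partial>lborel) = (\<integral>\<^sup>+ c. hs_norm_sq (fst (rep_of c)) (fourier f (rep_of c)) \<partial>\<mu>)"
    using pl f unfolding plancherel_measure_def by blast
  also have "\<dots> = (\<integral>\<^sup>+ c. 0 \<partial>\<mu>)" by (intro nn_integral_cong) (simp add: hs sp)
  also have "\<dots> = 0" by simp
  finally have "AE x in lborel. f x = 0"
    using f by (subst (asm) nn_integral_0_iff_AE) (auto simp: L2_def)
  then have "AE x in lebesgue. x \<in> {x. f x = 0}" by (auto intro: AE_completion)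
  moreover have "closed {x. f x = 0}"
    by (rule closed_Collect_eq[OF cont continuous_on_const])
  ultimately show ?thesis using mem_closed_if_AE_lebesgue by blast
qed

end


section \<open>Decay\<close>

lemma inverse_square_integrable: "(\<integral>\<^sup>+x. ennreal (1 / (1 + \<bar>x\<bar>)\<^sup>2) \<partial>(lborel :: real measure)) < \<infinity>"
proof -
  let ?f = "\<lambda>x::real. 1 / (1 + \<bar>x\<bar>)\<^sup>2"
  have [measurable]: "?f \<in> borel_measurable borel" by measurable
  have half: "(\<integral>\<^sup>+x. ennreal (?f x) * indicator {0..} x \<partial>lborel) = ennreal (0 - (- 1 / (1 + 0)))"
  proof (rule nn_integral_FTC_atLeast)
    show "((\<lambda>x::real. - 1 / (1 + x)) \<longlongrightarrow> 0) at_top"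
      by (intro tendsto_divide_0[OF tendsto_const] filterlim_at_top_imp_at_infinity
          filterlim_tendsto_add_at_top[OF tendsto_const filterlim_ident])
    fix x :: real assume "0 \<le> x"
    then show "DERIV (\<lambda>x. - 1 / (1 + x)) x :> ?f x"
      by (auto intro!: derivative_eq_intros simp: power2_eq_square)
  qed auto
  have "(\<integral>\<^sup>+x. ennreal (?f x) \<partial>lborel) \<le>
      (\<integral>\<^sup>+x. ennreal (?f x) * indicator {0..} x + ennreal (?f (- x)) * indicator {0..} (- x) \<partial>lborel)"
    by (intro nn_integral_mono) (auto split: split_indicator)
  also have "\<dots> = (\<integral>\<^sup>+x. ennreal (?f x) * indicator {0..} x \<partial>lborel) + (\<integral>\<^sup>+x. ennreal (?f (- x)) * indicator {0..} (- x) \<partial>lborel)"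
    by (rule nn_integral_add) measurable
  also have "(\<integral>\<^sup>+x. ennreal (?f (- x)) * indicator {0..} (- x) \<partial>lborel) = (\<integral>\<^sup>+x. ennreal (?f x) * indicator {0..} x \<partial>lborel)"
    using nn_integral_real_affine[of "\<lambda>x. ennreal (?f x) * indicator {0..} x" "-1" 0] by simp
  finally show ?thesis unfolding half by (simp add: order_le_less_trans)
qed

lemma decay_integrable:
  "integrable lborel (\<lambda>x::'a::euclidean_space. 1 / (1 + norm x) ^ (2 * DIM('a)))"
proof (rule integrableI_bounded)
  have "(\<integral>\<^sup>+x. ennreal (norm (1 / (1 + norm x) ^ (2 * DIM('a)))) \<partial>(lborel :: 'a measure)) \<le>
      (\<integral>\<^sup>+x. (\<Prod>b\<in>Basis. ennreal (1 / (1 + \<bar>x \<bullet> b\<bar>)\<^sup>2)) \<partial>(lborel :: 'a measure))"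
  proof (rule nn_integral_mono)
    fix x :: 'a
    have "(\<Prod>b\<in>Basis. (1 + \<bar>x \<bullet> b\<bar>)\<^sup>2) \<le> (\<Prod>b\<in>(Basis :: 'a set). (1 + norm x)\<^sup>2)"
      by (intro prod_mono conjI power_mono add_left_mono Basis_le_norm) auto
    also have "\<dots> = (1 + norm x) ^ (2 * DIM('a))" by (simp add: power_mult)
    finally have "1 / (1 + norm x) ^ (2 * DIM('a)) \<le> 1 / (\<Prod>b\<in>Basis. (1 + \<bar>x \<bullet> b\<bar>)\<^sup>2)"
      by (intro divide_left_mono mult_pos_pos prod_pos zero_less_power) (auto simp: add_pos_nonneg)
    also have "\<dots> = (\<Prod>b\<in>Basis. 1 / (1 + \<bar>x \<bullet> b\<bar>)\<^sup>2)" by (simp add: prod_dividef)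
    finally show "ennreal (norm (1 / (1 + norm x) ^ (2 * DIM('a)))) \<le> (\<Prod>b\<in>Basis. ennreal (1 / (1 + \<bar>x \<bullet> b\<bar>)\<^sup>2))"
      by (subst prod_ennreal) (auto intro!: ennreal_leI)
  qed
  also have "\<dots> = (\<Prod>b\<in>(Basis :: 'a set). \<integral>\<^sup>+x. ennreal (1 / (1 + \<bar>x\<bar>)\<^sup>2) \<partial>lborel)"
    by (rule nn_integral_lborel_prod) auto
  also have "\<dots> < \<infinity>"
    using inverse_square_integrable by (simp add: power_less_top_ennreal)
  finally show "(\<integral>\<^sup>+x. ennreal (norm (1 / (1 + norm x) ^ (2 * DIM('a)))) \<partial>(lborel :: 'a measure)) < \<infinity>" .
qed measurable

lemma weighted_bound_imp_decay:
  "(1 + norm y) ^ N * norm z \<le> C \<Longrightarrow> norm z \<le> C / (1 + norm y) ^ N"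
  by (subst pos_le_divide_eq) (auto simp: mult.commute add_pos_nonneg)

lemma seminorm_bound:
  assumes "bounded (range (\<lambda>x. (1 + norm x) ^ N *\<^sub>R f x))"
  shows "(1 + norm y) ^ N * norm (f y) \<le> schwartz_seminorm N [] f"
proof -
  have "bdd_above (range (\<lambda>x. (1 + norm x) ^ N * norm (f x)))"
    using assms unfolding bounded_iff bdd_above_def by (auto simp: abs_mult power_abs)
  then show ?thesis
    unfolding schwartz_seminorm_def by (intro cSUP_upper2[of _ _ y]) auto
qed

lemma schwartz_bounded:
  assumes "f \<in> schwartz" shows "bounded (range (\<lambda>x. (1 + norm x) ^ N *\<^sub>R f x))"
  using assms unfolding schwartz_def by (auto dest!: spec[of _ N] bspec[of _ _ "[]"])

lemma weighted_bounded_lincomb: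
  fixes f g :: "'a::euclidean_space \<Rightarrow> complex"
  assumes "bounded (range (\<lambda>x. (1 + norm x) ^ N *\<^sub>R f x))" "bounded (range (\<lambda>x. (1 + norm x) ^ N *\<^sub>R g x))"
  shows "bounded (range (\<lambda>x. (1 + norm x) ^ N *\<^sub>R (a * f x + b * g x)))"
proof -
  obtain A B where A: "\<And>x. norm ((1 + norm x) ^ N *\<^sub>R f x) \<le> A" and B: "\<And>x. norm ((1 + norm x) ^ N *\<^sub>R g x) \<le> B"
    using assms unfolding bounded_iff by auto
  have "norm ((1 + norm x) ^ N *\<^sub>R (a * f x + b * g x)) \<le> norm a * A + norm b * B" for x
  proof -
    have "(1 + norm x) ^ N *\<^sub>R (a * f x + b * g x) = a * ((1 + norm x) ^ N *\<^sub>R f x) + b * ((1 + norm x) ^ N *\<^sub>R g x)"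
      by (simp add: scaleR_add_right)
    also have "norm \<dots> \<le> norm (a * ((1 + norm x) ^ N *\<^sub>R f x)) + norm (b * ((1 + norm x) ^ N *\<^sub>R g x))"
      by (rule norm_triangle_ineq)
    also have "\<dots> \<le> norm a * A + norm b * B"
      unfolding norm_mult by (intro add_mono mult_left_mono A B) auto
    finally show ?thesis .
  qed
  then show ?thesis unfolding bounded_iff by blast
qed

lemma schwartz_continuous: "f \<in> schwartz \<Longrightarrow> continuous_on UNIV f"
  by (auto simp: schwartz_def continuous_on_eq_continuous_at intro: smooth_isCont)

lemma schwartz_tendsto_pointwise:
  assumes t: "schwartz_tendsto g l F" and g: "\<And>t. bounded (range (\<lambda>x. (1 + norm x) ^ 0 *\<^sub>R g t x))"
    and l: "bounded (range (\<lambda>x. (1 + norm x) ^ 0 *\<^sub>R l x))"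
  shows "((\<lambda>t. g t y) \<longlongrightarrow> l y) F"
proof -
  have "((\<lambda>t. schwartz_seminorm 0 [] (\<lambda>y. g t y - l y)) \<longlongrightarrow> 0) F"
    using t unfolding schwartz_tendsto_def by auto
  moreover have "norm (g t y - l y) \<le> schwartz_seminorm 0 [] (\<lambda>y. g t y - l y)" for t
    using seminorm_bound[of 0 "\<lambda>y. g t y - l y" y] weighted_bounded_lincomb[OF g l, of 1 t "-1"] by simp
  ultimately have "((\<lambda>t. g t y - l y) \<longlongrightarrow> 0) F"
    by (elim Lim_null_comparison[rotated]) auto
  then show ?thesis by (simp add: LIM_zero_iff)
qed

lemma decay_L1_L2:
  fixes f :: "'a::euclidean_space \<Rightarrow> complex"
  assumes f: "f \<in> borel_measurable borel" and B: "\<And>y. norm (f y) \<le> C / (1 + norm y) ^ (2 * DIM('a))"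
  shows "f \<in> L1" "f \<in> L2" "norm (f y) \<le> C"
proof -
  have C: "0 \<le> C" using B[of 0] norm_ge_zero[of "f 0"] by (simp del: norm_ge_zero)
  have "integrable lborel (\<lambda>y::'a. C * (1 / (1 + norm y) ^ (2 * DIM('a))))"
    by (intro integrable_mult_right decay_integrable)
  then have "integrable lborel f" by (rule integrable_dominated) (use f B in auto)
  then show L1: "f \<in> L1" using f by (simp add: L1_def)
  have bd: "norm (f y) \<le> C" for y
  proof -
    have "C / (1 + norm y) ^ (2 * DIM('a)) \<le> C / 1"
      using C by (intro divide_left_mono one_le_power) (auto simp: add_pos_nonneg)
    then show ?thesis using B[of y] by simp
  qed
  show "norm (f y) \<le> C" by (rule bd)
  show "f \<in> L2" by (rule L1_bounded_imp_L2[OF L1 bd])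
qed

section \<open>Families of Schwartz kernels\<close>

lemma compact_local_bound:
  fixes F :: "'a::metric_space \<Rightarrow> 'b \<Rightarrow> real"
  assumes K: "compact K" and loc: "\<And>x. x \<in> K \<Longrightarrow> \<exists>e>0. \<exists>C. \<forall>x'. dist x' x < e \<longrightarrow> (\<forall>y. F x' y \<le> C)"
  shows "\<exists>C. \<forall>x\<in>K. \<forall>y. F x y \<le> C"
proof -
  obtain e C where e: "\<And>x. x \<in> K \<Longrightarrow> e x > 0"
    and C: "\<And>x x' y. x \<in> K \<Longrightarrow> dist x' x < e x \<Longrightarrow> F x' y \<le> C x"
    using loc by metis
  have "K \<subseteq> (\<Union>x\<in>K. ball x (e x))" using e by force
  then obtain T where T: "T \<subseteq> K" "finite T" "K \<subseteq> (\<Union>x\<in>T. ball x (e x))"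
    using compactE_image[OF K, of K "\<lambda>x. ball x (e x)"] by auto
  have "F x y \<le> Max (insert 0 (C ` T))" if x: "x \<in> K" for x y
  proof -
    obtain t where t: "t \<in> T" "dist x t < e t" using T(3) x by (auto simp: dist_commute)
    then have "F x y \<le> C t" using C T(1) by blast
    also have "\<dots> \<le> Max (insert 0 (C ` T))" using t T(2) by (intro Max_ge) auto
    finally show ?thesis .
  qed
  then show ?thesis by blast
qed

text \<open>A compactly supported kernel with its derivatives in the parameter: \<open>D bs x\<close> is the iterated
  derivative of \<open>x \<mapsto> \<kappa>\<^sub>x\<close> along \<open>bs\<close>.\<close>

locale cc_kernel =
  fixes D :: "'a::euclidean_space list \<Rightarrow> 'a \<Rightarrow> 'a \<Rightarrow> complex" and K
  assumes compact_K: "compact K" and off0: "x \<notin> K \<Longrightarrow> D [] x y = 0"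
    and schw: "bs \<in> lists Basis \<Longrightarrow> D bs x \<in> schwartz"
    and cont: "bs \<in> lists Basis \<Longrightarrow> schwartz_tendsto (D bs) (D bs x) (at x)"
    and deriv: "bs \<in> lists Basis \<Longrightarrow> b \<in> Basis \<Longrightarrow>
      schwartz_tendsto (\<lambda>t y. (D bs (x + t *\<^sub>R b) y - D bs x y) / complex_of_real t) (D (b # bs) x) (at 0)"
begin

lemma has_vector_derivative_D:
  assumes bs: "bs \<in> lists Basis" and b: "b \<in> Basis"
  shows "((\<lambda>t. D bs (x + t *\<^sub>R b) y) has_vector_derivative D (b # bs) x y) (at 0)"
proof -
  have "((\<lambda>t. (D bs (x + t *\<^sub>R b) y - D bs x y) / complex_of_real t) \<longlongrightarrow> D (b # bs) x y) (at 0)"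
  proof (rule schwartz_tendsto_pointwise[OF deriv[OF bs b]])
    show "bounded (range (\<lambda>y. (1 + norm y) ^ 0 *\<^sub>R D (b # bs) x y))"
      using schw bs b by (intro schwartz_bounded) auto
    show "bounded (range (\<lambda>y. (1 + norm y) ^ 0 *\<^sub>R ((D bs (x + t *\<^sub>R b) y - D bs x y) / complex_of_real t)))" for t
      using weighted_bounded_lincomb[OF schwartz_bounded[OF schw[OF bs]] schwartz_bounded[OF schw[OF bs]],
          of 0 "1 / complex_of_real t" "x + t *\<^sub>R b" "- 1 / complex_of_real t" x]
      by (simp add: diff_divide_distrib)
  qed
  then show ?thesis
    unfolding has_vector_derivative_at_0_iff by (simp add: scaleR_conv_of_real divide_inverse mult.commute)
qed

lemma off:
  assumes "bs \<in> lists Basis" "x \<notin> K" shows "D bs x y = 0"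
  using assms
proof (induction bs arbitrary: x rule: list.induct)
  case (Cons b bs)
  have "open (- K)" using compact_K by (simp add: compact_imp_closed open_Compl)
  moreover have "((\<lambda>t. x + t *\<^sub>R b) \<longlongrightarrow> x + 0 *\<^sub>R b) (at 0)" by (intro tendsto_intros)
  ultimately have ev: "\<forall>\<^sub>F t in at 0. x + t *\<^sub>R b \<in> - K"
    using Cons.prems(2) by (intro topological_tendstoD) auto
  have "((\<lambda>t. (D bs (x + t *\<^sub>R b) y - D bs (x + 0 *\<^sub>R b) y) /\<^sub>R t) \<longlongrightarrow> D (b # bs) x y) (at 0)"
    using has_vector_derivative_D[of bs b x y] Cons.prems(1) unfolding has_vector_derivative_at_0_iff by simp
  moreover have "\<forall>\<^sub>F t in at 0. (D bs (x + t *\<^sub>R b) y - D bs (x + 0 *\<^sub>R b) y) /\<^sub>R t = 0"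
    using ev by eventually_elim (use Cons in auto)
  ultimately have "((\<lambda>t::real. 0) \<longlongrightarrow> D (b # bs) x y) (at 0)"
    by (rule Lim_transform_eventually)
  then show ?case by (metis tendsto_const_iff trivial_limit_at)
qed (simp add: off0)

lemma decay:
  assumes bs: "bs \<in> lists Basis"
  obtains C where "0 \<le> C" "\<And>x y. norm (D bs x y) \<le> C / (1 + norm y) ^ N"
proof -
  have "\<exists>C. \<forall>x\<in>K. \<forall>y. (1 + norm y) ^ N * norm (D bs x y) \<le> C"
  proof (rule compact_local_bound[OF compact_K])
    fix x
    have "((\<lambda>x'. schwartz_seminorm N [] (\<lambda>y. D bs x' y - D bs x y)) \<longlongrightarrow> 0) (at x)"
      using cont[OF bs, of x] by (simp add: schwartz_tendsto_def)
    then have "\<forall>\<^sub>F x' in at x. schwartz_seminorm N [] (\<lambda>y. D bs x' y - D bs x y) < 1"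
      by (rule order_tendstoD) simp
    then obtain e where e: "e > 0" "\<And>x'. x' \<noteq> x \<Longrightarrow> dist x' x < e \<Longrightarrow> schwartz_seminorm N [] (\<lambda>y. D bs x' y - D bs x y) < 1"
      unfolding eventually_at by auto
    have b: "bounded (range (\<lambda>y. (1 + norm y) ^ N *\<^sub>R D bs x y))" for x by (rule schwartz_bounded[OF schw[OF bs]])
    have "(1 + norm y) ^ N * norm (D bs x' y) \<le> 1 + schwartz_seminorm N [] (D bs x)" if "dist x' x < e" for x' y
    proof (cases "x' = x")
      case True
      then show ?thesis using seminorm_bound[OF b, of y x] by simp
    next
      case False
      have "(1 + norm y) ^ N * norm (D bs x' y) \<le> (1 + norm y) ^ N * (norm (D bs x' y - D bs x y) + norm (D bs x y))"
        using norm_triangle_ineq[of "D bs x' y - D bs x y" "D bs x y"] by (intro mult_left_mono) auto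
      also have "\<dots> = (1 + norm y) ^ N * norm (D bs x' y - D bs x y) + (1 + norm y) ^ N * norm (D bs x y)"
        by (simp add: distrib_left)
      also have "\<dots> \<le> schwartz_seminorm N [] (\<lambda>y. D bs x' y - D bs x y) + schwartz_seminorm N [] (D bs x)"
        using weighted_bounded_lincomb[OF b b, of 1 x' "-1" x]
        by (intro add_mono seminorm_bound b) simp_all
      finally show ?thesis using e(2)[OF False that] by simp
    qed
    then show "\<exists>e>0. \<exists>C. \<forall>x'. dist x' x < e \<longrightarrow> (\<forall>y. (1 + norm y) ^ N * norm (D bs x' y) \<le> C)"
      using e(1) by blast
  qed
  then obtain C where C: "\<And>x y. x \<in> K \<Longrightarrow> (1 + norm y) ^ N * norm (D bs x y) \<le> C" by blast
  have "(1 + norm y) ^ N * norm (D bs x y) \<le> max C 0" for x y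
    using C[of x y] off[OF bs, of x y] by (cases "x \<in> K") auto
  then show ?thesis by (intro that[of "max C 0"] weighted_bound_imp_decay) auto
qed

lemma decay_uniform:
  assumes "finite S" "S \<subseteq> lists Basis"
  shows "\<exists>C\<ge>0. \<forall>bs\<in>S. \<forall>x y. norm (D bs x y) \<le> C / (1 + norm y) ^ N"
  using assms
proof (induction S rule: finite_induct)
  case (insert bs S)
  then obtain C where C: "0 \<le> C" "\<forall>bs\<in>S. \<forall>x y. norm (D bs x y) \<le> C / (1 + norm y) ^ N" by auto
  obtain C' where C': "0 \<le> C'" "\<And>x y. norm (D bs x y) \<le> C' / (1 + norm y) ^ N"
    using decay[of bs N] insert.prems by auto
  have "C / (1 + norm y) ^ N \<le> (C + C') / (1 + norm y) ^ N" "C' / (1 + norm y) ^ N \<le> (C + C') / (1 + norm y) ^ N" for y :: 'a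
    using C(1) C'(1) by (auto intro!: divide_right_mono)
  note le = this
  have "norm (D bs' x y) \<le> (C + C') / (1 + norm y) ^ N" if "bs' \<in> insert bs S" for bs' x y
  proof (cases "bs' = bs")
    case True
    then show ?thesis using order_trans[OF C'(2) le(2)] by blast
  next
    case False
    then have "norm (D bs' x y) \<le> C / (1 + norm y) ^ N" using C(2) that by blast
    then show ?thesis by (rule order_trans[OF _ le(1)])
  qed
  then show ?case using C(1) C'(1) by (intro exI[of _ "C + C'"]) simp
qed auto

lemma continuous_kernel: "continuous_on UNIV (\<lambda>p. D [] (fst p) (snd p))"
proof -
  have "((\<lambda>p. D [] (fst p) (snd p)) \<longlongrightarrow> D [] x y) (at (x, y))" for x y
  proof -
    define S where "S = (\<lambda>x'. if x' = x then 0 else schwartz_seminorm 0 [] (\<lambda>y. D [] x' y - D [] x y))"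
    have b: "bounded (range (\<lambda>y. (1 + norm y) ^ 0 *\<^sub>R D [] x y))" for x
      by (intro schwartz_bounded schw) auto
    have S: "norm (D [] x' y' - D [] x y') \<le> S x'" for x' y'
      using seminorm_bound[of 0 "\<lambda>y. D [] x' y - D [] x y" y'] weighted_bounded_lincomb[OF b b, of 1 x' "-1" x]
      by (simp add: S_def)
    have "(S \<longlongrightarrow> 0) (at x)"
    proof (rule Lim_transform_eventually)
      show "((\<lambda>x'. schwartz_seminorm 0 [] (\<lambda>y. D [] x' y - D [] x y)) \<longlongrightarrow> 0) (at x)"
        using cont[of "[]" x] by (simp add: schwartz_tendsto_def)
    qed (simp add: S_def eventually_at_filter)
    then have "isCont S x" by (simp add: isCont_def S_def)
    then have "isCont (\<lambda>p. S (fst p)) (x, y)"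
      using isCont_o2[where f = fst and g = S and a = "(x, y)"] continuous_fst[OF continuous_ident] by auto
    then have "((\<lambda>p. S (fst p)) \<longlongrightarrow> 0) (at (x, y))" by (simp add: isCont_def S_def)
    moreover have "isCont (D [] x) y"
      using schwartz_continuous[OF schw[of "[]" x]] by (simp add: continuous_on_eq_continuous_at)
    then have "isCont (\<lambda>p. D [] x (snd p)) (x, y)"
      using isCont_o2[where f = snd and g = "D [] x" and a = "(x, y)"] continuous_snd[OF continuous_ident] by auto
    then have "((\<lambda>p. D [] x (snd p)) \<longlongrightarrow> D [] x y) (at (x, y))" by (simp add: isCont_def)
    then have "((\<lambda>p. norm (D [] x (snd p) - D [] x y)) \<longlongrightarrow> 0) (at (x, y))"
      by (simp add: tendsto_norm_zero_iff LIM_zero_iff)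
    ultimately have "((\<lambda>p. S (fst p) + norm (D [] x (snd p) - D [] x y)) \<longlongrightarrow> 0) (at (x, y))"
      using tendsto_add[of _ 0 _ _ 0] by fastforce
    then have "((\<lambda>p. D [] (fst p) (snd p) - D [] x y) \<longlongrightarrow> 0) (at (x, y))"
    proof (rule Lim_null_comparison[rotated])
      have "norm (D [] (fst p) (snd p) - D [] x y) \<le> S (fst p) + norm (D [] x (snd p) - D [] x y)" for p
        using S[of "fst p" "snd p"] norm_triangle_ineq[of "D [] (fst p) (snd p) - D [] x (snd p)" "D [] x (snd p) - D [] x y"]
        by simp
      then show "\<forall>\<^sub>F p in at (x, y). norm (D [] (fst p) (snd p) - D [] x y) \<le> S (fst p) + norm (D [] x (snd p) - D [] x y)"
        by simp
    qed
    then show ?thesis by (simp add: LIM_zero_iff)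
  qed
  then show ?thesis by (auto simp: continuous_on_eq_continuous_at isCont_def)
qed

end

lemma Cc_schwartz_obtain:
  assumes "\<kappa> \<in> Cc_schwartz" obtains D K where "cc_kernel D K" "D [] = \<kappa>"
proof -
  obtain K D where "compact K" "\<forall>x. x \<notin> K \<longrightarrow> \<kappa> x = (\<lambda>y. 0)" "D [] = \<kappa>"
    "\<forall>bs\<in>lists Basis. \<forall>x. D bs x \<in> schwartz \<and> schwartz_tendsto (D bs) (D bs x) (at x) \<and>
           (\<forall>b\<in>Basis. schwartz_tendsto
              (\<lambda>t y. (D bs (x + t *\<^sub>R b) y - D bs x y) / complex_of_real t) (D (b # bs) x) (at 0))"
    using assms unfolding Cc_schwartz_def by blast
  then have "cc_kernel D K" by unfold_locales auto
  then show ?thesis using \<open>D [] = \<kappa>\<close> that by blast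
qed

section \<open>Taylor estimates from bounds on partial derivatives\<close>

text \<open>Derivatives of the kernels are given along the coordinate axes, so an increment is split into
  increments along the axes.  In the next estimate, linearizing the path at 0 costs \<open>2 B\<close> and its
  derivative there costs \<open>B\<close>.\<close>

lemma axis_increment:
  fixes F :: "'a::euclidean_space \<Rightarrow> complex"
  assumes d: "\<And>x. ((\<lambda>t. F (x + t *\<^sub>R b)) has_vector_derivative F' x) (at 0)"
    and B: "\<And>s. \<bar>s\<bar> \<le> \<bar>\<tau>\<bar> \<Longrightarrow> norm (F' (p + s *\<^sub>R b) - c) \<le> B"
  shows "norm (F (p + \<tau> *\<^sub>R b) - F p - \<tau> *\<^sub>R c) \<le> 3 * \<bar>\<tau>\<bar> * B"
proof -
  define g where "g = (\<lambda>t. F (p + t *\<^sub>R b) - t *\<^sub>R c)"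
  have g: "(g has_vector_derivative F' (p + t *\<^sub>R b) - c) (at t)" for t
  proof -
    have "((\<lambda>t. F (p + t *\<^sub>R b)) has_vector_derivative F' (p + t *\<^sub>R b)) (at t)"
      by (rule has_vector_derivative_shift) (use d[of "p + t *\<^sub>R b"] in \<open>simp add: algebra_simps\<close>)
    then show ?thesis unfolding g_def by (auto intro!: derivative_eq_intros)
  qed
  have "norm (g \<tau> - g 0 - (\<tau> - 0) *\<^sub>R (F' (p + 0 *\<^sub>R b) - c)) \<le> norm (\<tau> - 0) * (2 * B)"
  proof (rule vector_differentiable_bound_linearization[where S = "{- \<bar>\<tau>\<bar>..\<bar>\<tau>\<bar>}"])
    show "closed_segment 0 \<tau> \<subseteq> {- \<bar>\<tau>\<bar>..\<bar>\<tau>\<bar>}" by (auto simp: closed_segment_eq_real_ivl)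
    show "norm (F' (p + t *\<^sub>R b) - c - (F' (p + 0 *\<^sub>R b) - c)) \<le> 2 * B" if "t \<in> {- \<bar>\<tau>\<bar>..\<bar>\<tau>\<bar>}" for t
    proof -
      have "norm (F' (p + t *\<^sub>R b) - c) \<le> B" "norm (F' (p + 0 *\<^sub>R b) - c) \<le> B"
        using B[of t] B[of 0] that by (auto simp: abs_le_iff)
      then show ?thesis
        using norm_triangle_ineq4[of "F' (p + t *\<^sub>R b) - c" "F' (p + 0 *\<^sub>R b) - c"] by linarith
    qed
  qed (auto intro: has_vector_derivative_at_within g)
  then have "norm (g \<tau> - g 0) \<le> norm (\<tau> *\<^sub>R (F' p - c)) + \<bar>\<tau>\<bar> * (2 * B)"
    using norm_triangle_ineq2[of "g \<tau> - g 0" "\<tau> *\<^sub>R (F' p - c)"] by simp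
  also have "\<dots> \<le> \<bar>\<tau>\<bar> * B + \<bar>\<tau>\<bar> * (2 * B)"
    using B[of 0] by (auto simp: mult.commute[of B] intro!: mult_left_mono)
  finally show ?thesis by (simp add: g_def algebra_simps)
qed

lemma telescoping_bound:
  fixes F :: "'a::euclidean_space \<Rightarrow> complex" and B :: real
  assumes S: "S \<subseteq> Basis"
    and step: "\<And>b T. b \<in> Basis \<Longrightarrow> T \<subseteq> Basis \<Longrightarrow>
      norm (F (x + (\<Sum>c\<in>T. (h \<bullet> c) *\<^sub>R c) + (h \<bullet> b) *\<^sub>R b) - F (x + (\<Sum>c\<in>T. (h \<bullet> c) *\<^sub>R c)) - (h \<bullet> b) *\<^sub>R G b) \<le> B"
  shows "norm (F (x + (\<Sum>c\<in>S. (h \<bullet> c) *\<^sub>R c)) - F x - (\<Sum>c\<in>S. (h \<bullet> c) *\<^sub>R G c)) \<le> card S * B"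
proof -
  have "finite S" by (rule finite_subset[OF S finite_Basis])
  then show ?thesis using S
  proof (induction S rule: finite_induct)
    case (insert b T)
    define p where "p = x + (\<Sum>c\<in>T. (h \<bullet> c) *\<^sub>R c)"
    have eq: "x + (\<Sum>c\<in>insert b T. (h \<bullet> c) *\<^sub>R c) = p + (h \<bullet> b) *\<^sub>R b"
      using insert.hyps by (simp add: p_def algebra_simps)
    have "F (p + (h \<bullet> b) *\<^sub>R b) - F x - (\<Sum>c\<in>insert b T. (h \<bullet> c) *\<^sub>R G c) =
        (F (p + (h \<bullet> b) *\<^sub>R b) - F p - (h \<bullet> b) *\<^sub>R G b) + (F p - F x - (\<Sum>c\<in>T. (h \<bullet> c) *\<^sub>R G c))"
      using insert.hyps by simp
    also have "norm \<dots> \<le> B + card T * B"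
    proof (rule norm_triangle_mono)
      show "norm (F (p + (h \<bullet> b) *\<^sub>R b) - F p - (h \<bullet> b) *\<^sub>R G b) \<le> B"
        unfolding p_def using insert.prems by (intro step) auto
      show "norm (F p - F x - (\<Sum>c\<in>T. (h \<bullet> c) *\<^sub>R G c)) \<le> card T * B"
        unfolding p_def using insert.prems by (intro insert.IH) auto
    qed
    finally show ?case unfolding eq using insert.hyps by (simp add: algebra_simps)
  qed simp
qed

lemma norm_partial_sum_le:
  fixes h :: "'a::euclidean_space"
  assumes "T \<subseteq> Basis" shows "norm (\<Sum>c\<in>T. (h \<bullet> c) *\<^sub>R c) \<le> DIM('a) * norm h"
proof -
  have "norm (\<Sum>c\<in>T. (h \<bullet> c) *\<^sub>R c) \<le> (\<Sum>c\<in>T. norm h)"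
    using assms by (intro sum_norm_le) (auto simp: Basis_le_norm)
  also have "\<dots> \<le> DIM('a) * norm h"
    using card_mono[OF finite_Basis assms] by (simp add: mult_right_mono)
  finally show ?thesis .
qed

lemma increment_bound:
  fixes F :: "'a::euclidean_space \<Rightarrow> complex" and A :: real
  assumes d: "\<And>b x. b \<in> Basis \<Longrightarrow> ((\<lambda>t. F (x + t *\<^sub>R b)) has_vector_derivative F' b x) (at 0)"
    and A: "\<And>b x. b \<in> Basis \<Longrightarrow> norm (F' b x) \<le> A"
  shows "norm (F (x + h) - F x) \<le> 3 * real DIM('a) * A * norm h"
proof -
  have "0 \<le> A" using A[OF SOME_Basis] norm_ge_zero order_trans by blast
  have "norm (F (x + (\<Sum>c\<in>Basis. (h \<bullet> c) *\<^sub>R c)) - F x - (\<Sum>c\<in>Basis. (h \<bullet> c) *\<^sub>R (0::complex))) \<le> DIM('a) * (3 * norm h * A)"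
  proof (rule telescoping_bound)
    fix b :: 'a and T :: "'a set" assume b: "b \<in> Basis"
    have "norm (F (x + (\<Sum>c\<in>T. (h \<bullet> c) *\<^sub>R c) + (h \<bullet> b) *\<^sub>R b) - F (x + (\<Sum>c\<in>T. (h \<bullet> c) *\<^sub>R c)) - (h \<bullet> b) *\<^sub>R 0) \<le> 3 * \<bar>h \<bullet> b\<bar> * A"
      by (rule axis_increment[OF d[OF b]]) (simp add: A[OF b])
    also have "\<dots> \<le> 3 * norm h * A"
      using Basis_le_norm[OF b, of h] \<open>0 \<le> A\<close> by (intro mult_right_mono) auto
    finally show "norm (F (x + (\<Sum>c\<in>T. (h \<bullet> c) *\<^sub>R c) + (h \<bullet> b) *\<^sub>R b) - F (x + (\<Sum>c\<in>T. (h \<bullet> c) *\<^sub>R c)) - (h \<bullet> b) *\<^sub>R 0) \<le> 3 * norm h * A" .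
  qed simp
  then show ?thesis by (simp add: euclidean_representation algebra_simps)
qed

lemma second_increment_bound:
  fixes F :: "'a::euclidean_space \<Rightarrow> complex" and A :: real
  assumes d: "\<And>b x. b \<in> Basis \<Longrightarrow> ((\<lambda>t. F (x + t *\<^sub>R b)) has_vector_derivative F' b x) (at 0)"
    and d2: "\<And>b c x. b \<in> Basis \<Longrightarrow> c \<in> Basis \<Longrightarrow> ((\<lambda>t. F' b (x + t *\<^sub>R c)) has_vector_derivative F'' c b x) (at 0)"
    and A: "\<And>b c x. b \<in> Basis \<Longrightarrow> c \<in> Basis \<Longrightarrow> norm (F'' c b x) \<le> A"
  shows "norm (F (x + h) - F x - (\<Sum>b\<in>Basis. (h \<bullet> b) *\<^sub>R F' b x)) \<le> 9 * (real DIM('a))\<^sup>2 * (real DIM('a) + 1) * A * (norm h)\<^sup>2"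
proof -
  define n where "n = real DIM('a)"
  have "0 \<le> A" using A[OF SOME_Basis SOME_Basis] norm_ge_zero order_trans by blast
  have n0: "0 \<le> n" by (simp add: n_def)
  define B where "B = 3 * n * A * ((n + 1) * norm h)"
  have B0: "0 \<le> B" using \<open>0 \<le> A\<close> n0 by (simp add: B_def)
  have "norm (F (x + (\<Sum>c\<in>Basis. (h \<bullet> c) *\<^sub>R c)) - F x - (\<Sum>c\<in>Basis. (h \<bullet> c) *\<^sub>R F' c x)) \<le> DIM('a) * (3 * norm h * B)"
  proof (rule telescoping_bound)
    fix b :: 'a and T :: "'a set" assume b: "b \<in> Basis" and T: "T \<subseteq> Basis"
    define q where "q = (\<Sum>c\<in>T. (h \<bullet> c) *\<^sub>R c)"
    have "norm (F (x + q + (h \<bullet> b) *\<^sub>R b) - F (x + q) - (h \<bullet> b) *\<^sub>R F' b x) \<le> 3 * \<bar>h \<bullet> b\<bar> * B"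
    proof (rule axis_increment[OF d[OF b]])
      fix s assume s: "\<bar>s\<bar> \<le> \<bar>h \<bullet> b\<bar>"
      have "norm (F' b (x + (q + s *\<^sub>R b)) - F' b x) \<le> 3 * n * A * norm (q + s *\<^sub>R b)"
        unfolding n_def by (rule increment_bound) (use d2[OF b] A[OF b] in auto)
      also have "norm (q + s *\<^sub>R b) \<le> (n + 1) * norm h"
      proof -
        have "norm (q + s *\<^sub>R b) \<le> norm q + norm (s *\<^sub>R b)" by (rule norm_triangle_ineq)
        also have "\<dots> \<le> n * norm h + norm h"
          using norm_partial_sum_le[OF T, of h] s Basis_le_norm[OF b, of h] b
          by (intro add_mono) (auto simp: q_def n_def)
        finally show ?thesis by (simp add: algebra_simps)
      qed
      then have "3 * n * A * norm (q + s *\<^sub>R b) \<le> B"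
        unfolding B_def using n0 \<open>0 \<le> A\<close> by (intro mult_left_mono) auto
      finally show "norm (F' b (x + q + s *\<^sub>R b) - F' b x) \<le> B" by (simp add: add.assoc)
    qed
    also have "\<dots> \<le> 3 * norm h * B"
      using Basis_le_norm[OF b, of h] B0 by (intro mult_right_mono) auto
    finally show "norm (F (x + (\<Sum>c\<in>T. (h \<bullet> c) *\<^sub>R c) + (h \<bullet> b) *\<^sub>R b) - F (x + (\<Sum>c\<in>T. (h \<bullet> c) *\<^sub>R c)) - (h \<bullet> b) *\<^sub>R F' b x) \<le> 3 * norm h * B"
      unfolding q_def .
  qed simp
  then show ?thesis
    by (simp add: euclidean_representation B_def n_def power2_eq_square mult_ac)
qed


lemma smooth_lipschitz:
  fixes f :: "'a::euclidean_space \<Rightarrow> 'b::real_normed_vector"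
  assumes f: "smooth f"
  obtains L where "0 \<le> L" "\<And>x y. norm x \<le> r \<Longrightarrow> norm y \<le> r \<Longrightarrow> norm (f x - f y) \<le> L * norm (x - y)"
proof -
  have "\<exists>C\<ge>0. \<forall>x\<in>cball 0 r. norm (partial b f x) \<le> C" if "b \<in> Basis" for b
  proof -
    have "isCont (partial b f) x" for x
      using smooth_isCont[OF smooth_partials[OF f, of "[b]"]] that by simp
    then have "compact (partial b f ` cball 0 r)"
      by (intro compact_continuous_image compact_cball continuous_at_imp_continuous_on) auto
    then obtain C where "\<forall>x\<in>cball 0 r. norm (partial b f x) \<le> C"
      using compact_imp_bounded bounded_iff by (metis imageI)
    then show ?thesis by (intro exI[of _ "max 0 C"]) (auto simp: le_max_iff_disj)
  qed
  then obtain C where C0: "\<And>b. b \<in> Basis \<Longrightarrow> 0 \<le> C b"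
    and C: "\<And>b x. b \<in> Basis \<Longrightarrow> x \<in> cball 0 r \<Longrightarrow> norm (partial b f x) \<le> C b"
    by metis
  have bound: "norm (f x - f y) \<le> (\<Sum>b\<in>Basis. C b) * norm (x - y)" if "norm x \<le> r" "norm y \<le> r" for x y
  proof (rule differentiable_bound[where S = "cball 0 r" and f' = "\<lambda>x. frechet_derivative f (at x)"])
    show "(f has_derivative frechet_derivative f (at x)) (at x within cball 0 r)" for x
      by (rule has_derivative_at_withinI[OF smooth_has_derivative[OF f]])
    fix x :: 'a assume x: "x \<in> cball 0 r"
    show "onorm (frechet_derivative f (at x)) \<le> (\<Sum>b\<in>Basis. C b)"
    proof (rule onorm_bound)
      fix h
      have "norm (frechet_derivative f (at x) h) \<le> (\<Sum>b\<in>Basis. C b * norm h)"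
        unfolding smooth_frechet_eq[OF f]
      proof (rule sum_norm_le)
        fix b :: 'a assume b: "b \<in> Basis"
        have "norm ((h \<bullet> b) *\<^sub>R partial b f x) \<le> norm h * C b"
          using Basis_le_norm[OF b, of h] C[OF b x] by (auto intro!: mult_mono)
        then show "norm ((h \<bullet> b) *\<^sub>R partial b f x) \<le> C b * norm h" by (simp add: mult.commute)
      qed
      then show "norm (frechet_derivative f (at x) h) \<le> (\<Sum>b\<in>Basis. C b) * norm h"
        by (simp add: sum_distrib_right)
    qed (simp add: sum_nonneg C0)
  qed (use that in auto)
  show ?thesis by (rule that[OF _ bound]) (simp_all add: sum_nonneg C0)
qed

context exp_group
begin

lemma mult_lipschitz:
  obtains L where "0 \<le> L"
    "\<And>x v w. norm x \<le> r \<Longrightarrow> norm v \<le> r \<Longrightarrow> norm w \<le> r \<Longrightarrow> norm (m x v - m x w) \<le> L * norm (v - w)"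
proof -
  obtain L where L: "0 \<le> L" "\<And>p q. norm p \<le> 2 * r \<Longrightarrow> norm q \<le> 2 * r \<Longrightarrow>
      norm (m (fst p) (snd p) - m (fst q) (snd q)) \<le> L * norm (p - q)"
    using smooth_lipschitz[OF smooth_mult, of "2 * r"] by metis
  have "norm (m x v - m x w) \<le> L * norm (v - w)" if "norm x \<le> r" "norm v \<le> r" "norm w \<le> r" for x v w
  proof -
    have "norm (x, v) \<le> 2 * r" "norm (x, w) \<le> 2 * r"
      using norm_Pair_le[of x v] norm_Pair_le[of x w] that by linarith+
    from L(2)[OF this] show ?thesis by (simp add: norm_Pair)
  qed
  then show ?thesis by (rule that[OF L(1)])
qed

lemma left_field_lipschitz:
  obtains L where "0 \<le> L"
    "\<And>p q v. norm p \<le> r \<Longrightarrow> norm q \<le> r \<Longrightarrow> norm (left_field p v - left_field q v) \<le> L * norm (p - q) * norm v"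
proof -
  have "\<exists>L\<ge>0. \<forall>p q. norm p \<le> r \<longrightarrow> norm q \<le> r \<longrightarrow> norm (left_field p b - left_field q b) \<le> L * norm (p - q)"
    if b: "b \<in> Basis" for b
  proof -
    let ?M = "\<lambda>p. m (fst p) (snd p)"
    have sm: "smooth (partial (0, b) ?M)"
      using smooth_partials[OF smooth_mult, of "[(0, b)]"] b by (simp add: Basis_prod_def)
    obtain L where L: "0 \<le> L" "\<And>p q. norm p \<le> r \<Longrightarrow> norm q \<le> r \<Longrightarrow>
        norm (partial (0, b) ?M p - partial (0, b) ?M q) \<le> L * norm (p - q)"
      by (rule smooth_lipschitz[OF sm, of r]) (rule that)
    have "left_field p b = partial (0, b) ?M (p, 0)" for p
      unfolding left_field_def dm_def
      by (rule has_derivative_imp_partial[OF smooth_has_derivative[OF smooth_mult], symmetric])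
    then have "norm (left_field p b - left_field q b) \<le> L * norm (p - q)" if "norm p \<le> r" "norm q \<le> r" for p q
      using L(2)[of "(p, 0)" "(q, 0)"] that by (simp add: norm_Pair)
    then show ?thesis using L(1) by blast
  qed
  then obtain L where L0: "\<And>b. b \<in> Basis \<Longrightarrow> 0 \<le> L b"
    and L: "\<And>b p q. b \<in> Basis \<Longrightarrow> norm p \<le> r \<Longrightarrow> norm q \<le> r \<Longrightarrow> norm (left_field p b - left_field q b) \<le> L b * norm (p - q)"
    by metis
  have expand: "left_field p v = (\<Sum>b\<in>Basis. (v \<bullet> b) *\<^sub>R left_field p b)" for p v
    using linear_sum[OF linear_left_field, of p "\<lambda>b. (v \<bullet> b) *\<^sub>R b" Basis]
    by (simp add: euclidean_representation linear_cmul[OF linear_left_field])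
  have bound: "norm (left_field p v - left_field q v) \<le> (\<Sum>b\<in>Basis. L b) * norm (p - q) * norm v"
    if pq: "norm p \<le> r" "norm q \<le> r" for p q v
  proof -
    have "left_field p v - left_field q v = (\<Sum>b\<in>Basis. (v \<bullet> b) *\<^sub>R (left_field p b - left_field q b))"
      unfolding expand[of p v] expand[of q v] by (simp add: scaleR_diff_right sum_subtractf)
    also have "norm \<dots> \<le> (\<Sum>b\<in>Basis. L b * norm (p - q) * norm v)"
    proof (rule sum_norm_le)
      fix b :: 'a assume b: "b \<in> Basis"
      have "norm ((v \<bullet> b) *\<^sub>R (left_field p b - left_field q b)) \<le> norm v * (L b * norm (p - q))"
        using Basis_le_norm[OF b, of v] L[OF b pq] by (auto intro!: mult_mono)
      then show "norm ((v \<bullet> b) *\<^sub>R (left_field p b - left_field q b)) \<le> L b * norm (p - q) * norm v"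
        by (simp add: mult_ac)
    qed
    finally show ?thesis by (simp add: sum_distrib_right)
  qed
  show ?thesis by (rule that[OF _ bound]) (simp_all add: sum_nonneg L0)
qed

lemma translation_small:
  obtains L where "0 \<le> L" "\<And>x v. norm x \<le> r \<Longrightarrow> norm v \<le> 1 \<Longrightarrow> norm (m x v - x) \<le> L * norm v"
proof -
  obtain L where L: "0 \<le> L"
    "\<And>x v w. norm x \<le> \<bar>r\<bar> + 1 \<Longrightarrow> norm v \<le> \<bar>r\<bar> + 1 \<Longrightarrow> norm w \<le> \<bar>r\<bar> + 1 \<Longrightarrow> norm (m x v - m x w) \<le> L * norm (v - w)"
    using mult_lipschitz[of "\<bar>r\<bar> + 1"] by metis
  have "norm (m x v - x) \<le> L * norm v" if "norm x \<le> r" "norm v \<le> 1" for x v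
    using L(2)[of x v 0] that by simp
  then show ?thesis by (rule that[OF L(1)])
qed

text \<open>The curve \<open>t \<mapsto> x(tv) + x(-tv)\<close> has as its derivative the difference of one left-invariant field
  at two points that are \<open>O(|v|)\<close> apart.\<close>

lemma translation_second_difference:
  obtains C where "0 \<le> C"
    "\<And>x v. norm x \<le> r \<Longrightarrow> norm v \<le> 1 \<Longrightarrow> norm ((m x v - x) + (m x (- v) - x)) \<le> C * (norm v)\<^sup>2"
proof -
  obtain L1 where L1: "0 \<le> L1" "\<And>x v. norm x \<le> r \<Longrightarrow> norm v \<le> 1 \<Longrightarrow> norm (m x v - x) \<le> L1 * norm v"
    using translation_small[of r] by metis
  obtain L2 where L2: "0 \<le> L2" "\<And>p q v. norm p \<le> r + L1 \<Longrightarrow> norm q \<le> r + L1 \<Longrightarrow>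
      norm (left_field p v - left_field q v) \<le> L2 * norm (p - q) * norm v"
    using left_field_lipschitz[of "r + L1"] by metis
  have "norm ((m x v - x) + (m x (- v) - x)) \<le> 2 * L1 * L2 * (norm v)\<^sup>2" if x: "norm x \<le> r" and v: "norm v \<le> 1" for x v
  proof -
    have path: "((\<lambda>t. m x (t *\<^sub>R w)) has_vector_derivative left_field (m x (t *\<^sub>R w)) w) (at t)" for t w
    proof (rule has_vector_derivative_shift)
      have "m x ((t + h) *\<^sub>R w) = m (m x (t *\<^sub>R w)) (h *\<^sub>R w)" for h by (simp add: assoc line)
      then show "((\<lambda>h. m x ((t + h) *\<^sub>R w)) has_vector_derivative left_field (m x (t *\<^sub>R w)) w) (at 0)"
        using left_field_deriv by simp
    qed
    define \<phi> where "\<phi> = (\<lambda>t. m x (t *\<^sub>R v) + m x (t *\<^sub>R (- v)))"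
    define \<phi>' where "\<phi>' = (\<lambda>t. left_field (m x (t *\<^sub>R v)) v + left_field (m x (t *\<^sub>R (- v))) (- v))"
    have d: "(\<phi> has_vector_derivative \<phi>' t) (at t)" for t
      unfolding \<phi>_def \<phi>'_def by (intro has_vector_derivative_add path)
    have \<phi>'0: "\<phi>' 0 = 0" by (simp add: \<phi>'_def linear_neg[OF linear_left_field])
    have bound: "norm (\<phi>' t) \<le> 2 * L1 * L2 * (norm v)\<^sup>2" if t: "t \<in> {0..1}" for t
    proof -
      have small: "norm (m x (t *\<^sub>R w) - x) \<le> L1 * norm v" if "norm w = norm v" for w
      proof -
        have "norm (t *\<^sub>R w) \<le> 1 * norm v" using t that by (auto intro!: mult_left_le_one_le)
        then have "norm (m x (t *\<^sub>R w) - x) \<le> L1 * norm (t *\<^sub>R w)" "L1 * norm (t *\<^sub>R w) \<le> L1 * norm v"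
          using L1 x v by (auto intro!: L1(2) mult_left_mono simp del: norm_scaleR)
        then show ?thesis by linarith
      qed
      have L1v: "L1 * norm v \<le> L1" using L1(1) v by (simp add: mult_left_le)
      let ?p = "m x (t *\<^sub>R v)" and ?q = "m x (t *\<^sub>R (- v))"
      have p: "norm (?p - x) \<le> L1 * norm v" and q: "norm (?q - x) \<le> L1 * norm v"
        by (rule small; simp)+
      have "norm ?p \<le> r + L1" "norm ?q \<le> r + L1"
        using p q x L1v norm_triangle_sub[of ?p x] norm_triangle_sub[of ?q x] by linarith+
      then have "norm (left_field ?p v - left_field ?q v) \<le> L2 * norm (?p - ?q) * norm v"
        by (rule L2(2))
      also have "norm (?p - ?q) \<le> 2 * L1 * norm v"
        using p q norm_triangle_ineq4[of "?p - x" "?q - x"] by simp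
      then have "L2 * norm (?p - ?q) * norm v \<le> L2 * (2 * L1 * norm v) * norm v"
        using L2(1) by (intro mult_right_mono mult_left_mono) auto
      finally show ?thesis
        by (simp add: \<phi>'_def linear_neg[OF linear_left_field] power2_eq_square mult_ac)
    qed
    have "norm (\<phi> 1 - \<phi> 0 - (1 - 0) *\<^sub>R \<phi>' 0) \<le> norm (1 - 0 :: real) * (2 * L1 * L2 * (norm v)\<^sup>2)"
      by (rule vector_differentiable_bound_linearization[where S = "{0..1}"])
        (auto intro: has_vector_derivative_at_within d bound simp: \<phi>'0 closed_segment_eq_real_ivl)
    then show ?thesis by (simp add: \<phi>'0) (simp add: \<phi>_def algebra_simps)
  qed
  then show ?thesis using that[of "2 * L1 * L2"] L1(1) L2(1) by auto
qed

text \<open>The increment of \<open>x\<close> under right translation by \<open>v\<close> is \<open>O(|v|)\<close>, and for \<open>v\<close> and \<open>-v\<close> the increments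
  add up to \<open>O(|v|\<^sup>2)\<close>.  In the symmetric difference the linear terms of the Taylor expansion of
  \<open>x \<mapsto> \<kappa>\<^sub>x\<close> therefore cancel to second order.\<close>

lemma kernel_differences:
  assumes "cc_kernel D K"
  obtains C where "0 \<le> C"
    "\<And>x v w. norm v \<le> 1 \<Longrightarrow> norm (D [] (m x v) w - D [] x w) \<le> C * norm v / (1 + norm w) ^ N"
    "\<And>x v w. norm v \<le> 1 \<Longrightarrow>
      norm ((D [] (m x v) w - D [] x w) + (D [] (m x (- v)) w - D [] x w)) \<le> C * (norm v)\<^sup>2 / (1 + norm w) ^ N"
proof -
  interpret cc_kernel D K by fact
  define n where "n = real DIM('a)"
  obtain R0 where R0: "\<And>x. x \<in> K \<Longrightarrow> norm x \<le> R0"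
    using compact_imp_bounded[OF compact_K] unfolding bounded_iff by blast
  obtain L0 where L0: "0 \<le> L0" "\<And>x v. norm x \<le> R0 \<Longrightarrow> norm v \<le> 1 \<Longrightarrow> norm (m x v - x) \<le> L0 * norm v"
    using translation_small[of R0] by metis
  define R where "R = R0 + L0"
  \<comment> \<open>outside a large ball all kernels that occur vanish; on it the constants of the group law are
    uniform\<close>
  have far: "D [] x w = 0" "norm v \<le> 1 \<Longrightarrow> D [] (m x v) w = 0" if "\<not> norm x \<le> R" for x v w
  proof -
    have "x \<notin> K" using R0[of x] that L0(1) by (auto simp: R_def)
    then show "D [] x w = 0" by (rule off0)
    show "D [] (m x v) w = 0" if v: "norm v \<le> 1"
    proof (rule off0, rule notI)
      assume k: "m x v \<in> K"
      have "norm (m (m x v) (- v) - m x v) \<le> L0 * norm v" using L0(2)[OF R0[OF k], of "- v"] v by simp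
      also have "\<dots> \<le> L0" using L0(1) v by (simp add: mult_left_le)
      finally have "norm x \<le> R" using R0[OF k] norm_triangle_sub[of x "m x v"] by (simp add: R_def)
      then show False using \<open>\<not> norm x \<le> R\<close> by blast
    qed
  qed
  obtain L where L: "0 \<le> L" "\<And>x v. norm x \<le> R \<Longrightarrow> norm v \<le> 1 \<Longrightarrow> norm (m x v - x) \<le> L * norm v"
    using translation_small[of R] by metis
  obtain L2 where L2: "0 \<le> L2" "\<And>x v. norm x \<le> R \<Longrightarrow> norm v \<le> 1 \<Longrightarrow> norm ((m x v - x) + (m x (- v) - x)) \<le> L2 * (norm v)\<^sup>2"
    using translation_second_difference[of R] by metis
  define S where "S = (\<lambda>b. [b]) ` Basis \<union> (\<lambda>(c, b). [c, b]) ` (Basis \<times> (Basis :: 'a set))"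
  have "finite S" "S \<subseteq> lists Basis" by (auto simp: S_def)
  then obtain A where A: "0 \<le> A" "\<forall>bs\<in>S. \<forall>x y. norm (D bs x y) \<le> A / (1 + norm y) ^ N"
    using decay_uniform by blast
  have D1: "norm (D [b] x w) \<le> A / (1 + norm w) ^ N" if "b \<in> Basis" for b x w
    using A(2) that by (auto simp: S_def)
  have D2: "norm (D [c, b] x w) \<le> A / (1 + norm w) ^ N" if "b \<in> Basis" "c \<in> Basis" for b c x w
  proof -
    have "[c, b] \<in> S" using that by (force simp: S_def)
    then show ?thesis using A(2) by blast
  qed
  have n0: "0 \<le> n" by (simp add: n_def)
  have pos: "0 < (1 + norm w) ^ N" for w :: 'a by (simp add: add_pos_nonneg)
  have d1: "((\<lambda>t. D [] (x + t *\<^sub>R b) w) has_vector_derivative D [b] x w) (at 0)" if "b \<in> Basis" for b x w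
    using has_vector_derivative_D[of "[]" b] that by simp
  have d2: "((\<lambda>t. D [b] (x + t *\<^sub>R c) w) has_vector_derivative D [c, b] x w) (at 0)" if "b \<in> Basis" "c \<in> Basis" for b c x w
    using has_vector_derivative_D[of "[b]" c] that by simp
  define C1 where "C1 = 3 * n * A * L"
  define C2 where "C2 = 2 * (9 * n\<^sup>2 * (n + 1) * A * L\<^sup>2) + n * L2 * A"
  have C10: "0 \<le> C1" and C20: "0 \<le> C2"
    unfolding C1_def C2_def using n0 A(1) A(1) L(1) L2(1) by auto
  have first: "norm (D [] (m x v) w - D [] x w) \<le> C1 * norm v / (1 + norm w) ^ N" if v: "norm v \<le> 1" for x v w
  proof (cases "norm x \<le> R")
    case True
    have "norm (D [] (x + (m x v - x)) w - D [] x w) \<le> 3 * n * (A / (1 + norm w) ^ N) * norm (m x v - x)"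
      unfolding n_def by (rule increment_bound[where F = "\<lambda>x. D [] x w" and F' = "\<lambda>b x. D [b] x w"]) (auto intro: d1 D1)
    also have "\<dots> \<le> 3 * n * (A / (1 + norm w) ^ N) * (L * norm v)"
      using n0 A(1) pos[of w] by (intro mult_left_mono L(2) True v) auto
    finally show ?thesis by (simp add: C1_def mult_ac)
  next
    case False
    then show ?thesis using far(1)[OF False, of w] far(2)[OF False v, of w] C10 pos[of w] by simp
  qed
  have second: "norm ((D [] (m x v) w - D [] x w) + (D [] (m x (- v)) w - D [] x w)) \<le> C2 * (norm v)\<^sup>2 / (1 + norm w) ^ N"
    if v: "norm v \<le> 1" for x v w
  proof (cases "norm x \<le> R")
    case True
    define G where "G = (\<lambda>h. \<Sum>b\<in>Basis. (h \<bullet> b) *\<^sub>R D [b] x w)"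
    define E where "E = 9 * n\<^sup>2 * (n + 1) * (A / (1 + norm w) ^ N) * (L * norm v)\<^sup>2"
    \<comment> \<open>the linear terms \<open>G\<close> of the two Taylor expansions almost cancel\<close>
    have r: "norm (D [] (m x u) w - D [] x w - G (m x u - x)) \<le> E" if u: "norm u = norm v" for u
    proof -
      have "norm (D [] (x + (m x u - x)) w - D [] x w - (\<Sum>b\<in>Basis. ((m x u - x) \<bullet> b) *\<^sub>R D [b] x w))
          \<le> 9 * n\<^sup>2 * (n + 1) * (A / (1 + norm w) ^ N) * (norm (m x u - x))\<^sup>2"
        unfolding n_def
        by (rule second_increment_bound[where F = "\<lambda>x. D [] x w" and F' = "\<lambda>b x. D [b] x w" and F'' = "\<lambda>c b x. D [c, b] x w"])
          (auto intro: d1 d2 D2)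
      also have "\<dots> \<le> E"
        unfolding E_def using n0 A(1) pos[of w] L(2)[OF True, of u] u v
        by (intro mult_left_mono power_mono) auto
      finally show ?thesis by (simp add: G_def)
    qed
    have G_add: "G (m x v - x) + G (m x (- v) - x) = G ((m x v - x) + (m x (- v) - x))"
      unfolding G_def by (simp add: inner_add_left scaleR_add_left sum.distrib)
    have "norm (G ((m x v - x) + (m x (- v) - x))) \<le> (\<Sum>b\<in>(Basis :: 'a set). L2 * (norm v)\<^sup>2 * (A / (1 + norm w) ^ N))"
      unfolding G_def
    proof (rule sum_norm_le)
      fix b :: 'a assume b: "b \<in> Basis"
      have "\<bar>((m x v - x) + (m x (- v) - x)) \<bullet> b\<bar> \<le> L2 * (norm v)\<^sup>2"
        using Basis_le_norm[OF b] L2(2)[OF True v] order_trans by blast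
      then show "norm ((((m x v - x) + (m x (- v) - x)) \<bullet> b) *\<^sub>R D [b] x w) \<le> L2 * (norm v)\<^sup>2 * (A / (1 + norm w) ^ N)"
        using D1[OF b, of x w] L2(1) by (auto intro!: mult_mono simp del: times_divide_eq_right)
    qed
    also have "\<dots> = n * (L2 * (norm v)\<^sup>2 * (A / (1 + norm w) ^ N))" by (simp add: n_def)
    finally have G_bound: "norm (G ((m x v - x) + (m x (- v) - x))) \<le> n * (L2 * (norm v)\<^sup>2 * (A / (1 + norm w) ^ N))" .
    have "(D [] (m x v) w - D [] x w) + (D [] (m x (- v)) w - D [] x w) =
        ((D [] (m x v) w - D [] x w - G (m x v - x)) + (D [] (m x (- v)) w - D [] x w - G (m x (- v) - x)))
        + G ((m x v - x) + (m x (- v) - x))"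
      by (simp flip: G_add)
    also have "norm \<dots> \<le> (E + E) + n * (L2 * (norm v)\<^sup>2 * (A / (1 + norm w) ^ N))"
      by (intro norm_triangle_mono r G_bound) auto
    also have "\<dots> = C2 * (norm v)\<^sup>2 / (1 + norm w) ^ N"
      by (simp add: E_def C2_def power_mult_distrib add_divide_distrib algebra_simps)
    finally show ?thesis .
  next
    case False
    then show ?thesis using far(1)[OF False, of w] far(2)[OF False, of v w] far(2)[OF False, of "- v" w] v C20 pos[of w]
      by simp
  qed
  have max1: "C1 * a / (1 + norm w) ^ N \<le> max C1 C2 * a / (1 + norm w) ^ N"
    and max2: "C2 * a / (1 + norm w) ^ N \<le> max C1 C2 * a / (1 + norm w) ^ N" if "0 \<le> a" for a and w :: 'a
    using that pos[of w] by (auto intro!: divide_right_mono mult_right_mono)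
  show ?thesis
  proof (rule that[of "max C1 C2"])
    show "0 \<le> max C1 C2" using C10 by simp
    show "norm (D [] (m x v) w - D [] x w) \<le> max C1 C2 * norm v / (1 + norm w) ^ N" if "norm v \<le> 1" for x v w
      by (rule order_trans[OF first[OF that] max1]) simp
    show "norm ((D [] (m x v) w - D [] x w) + (D [] (m x (- v)) w - D [] x w)) \<le> max C1 C2 * (norm v)\<^sup>2 / (1 + norm w) ^ N"
      if "norm v \<le> 1" for x v w
      by (rule order_trans[OF second[OF that] max2]) simp
  qed
qed

end


section \<open>Dilated kernels\<close>

lemma has_derivative_lincomb:
  fixes f g :: "'a::real_normed_vector \<Rightarrow> complex"
  assumes "(f has_derivative f') (at x)" "(g has_derivative g') (at x)"
  shows "((\<lambda>x. a * f x + b * g x) has_derivative (\<lambda>h. a * f' h + b * g' h)) (at x)"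
  using assms by (auto intro!: derivative_eq_intros)

lemma smooth_partials_has_derivative:
  assumes "smooth f" "bs \<in> lists Basis"
  shows "(partials bs f has_derivative frechet_derivative (partials bs f) (at x)) (at x)"
  by (rule smooth_has_derivative[OF smooth_partials[OF assms]])

lemma partials_lincomb:
  fixes f g :: "'a::euclidean_space \<Rightarrow> complex"
  assumes "smooth f" "smooth g" "bs \<in> lists Basis"
  shows "partials bs (\<lambda>x. a * f x + b * g x) = (\<lambda>x. a * partials bs f x + b * partials bs g x)"
  using assms(3)
proof (induction bs rule: list.induct)
  case (Cons c bs)
  then have bs: "bs \<in> lists Basis" by auto
  show ?case
  proof
    fix x
    note f = smooth_partials_has_derivative[OF assms(1) bs, of x]
    note g = smooth_partials_has_derivative[OF assms(2) bs, of x]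
    show "partials (c # bs) (\<lambda>x. a * f x + b * g x) x = a * partials (c # bs) f x + b * partials (c # bs) g x"
      using has_derivative_imp_partial[OF has_derivative_lincomb[OF f g], of c a b]
      by (simp add: Cons.IH[OF bs] has_derivative_imp_partial[OF f] has_derivative_imp_partial[OF g])
  qed
qed simp

lemma schwartz_lincomb:
  assumes f: "f \<in> schwartz" and g: "g \<in> schwartz" shows "(\<lambda>x. a * f x + b * g x) \<in> schwartz"
proof -
  have sm: "smooth f" "smooth g" using f g by (auto simp: schwartz_def)
  have "partials bs (\<lambda>x. a * f x + b * g x) differentiable (at x)" if "bs \<in> lists Basis" for bs x
    unfolding partials_lincomb[OF sm that] differentiable_def
    by (rule exI, rule has_derivative_lincomb[OF smooth_partials_has_derivative[OF sm(1) that]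
          smooth_partials_has_derivative[OF sm(2) that]])
  moreover have "bounded (range (\<lambda>x. (1 + norm x) ^ N *\<^sub>R partials bs (\<lambda>x. a * f x + b * g x) x))"
    if "bs \<in> lists Basis" for bs N
    unfolding partials_lincomb[OF sm that]
    using f g that by (intro weighted_bounded_lincomb) (auto simp: schwartz_def)
  ultimately show ?thesis by (auto simp: schwartz_def smooth_def)
qed

lemma schwartz_seminorm_upper:
  assumes "f \<in> schwartz" "bs \<in> lists Basis"
  shows "(1 + norm y) ^ N * norm (partials bs f y) \<le> schwartz_seminorm N bs f"
  using seminorm_bound[of N "partials bs f" y] assms by (simp add: schwartz_def schwartz_seminorm_def)

lemma schwartz_seminorm_nonneg:
  assumes "f \<in> schwartz" "bs \<in> lists Basis" shows "0 \<le> schwartz_seminorm N bs f"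
  by (rule order_trans[OF _ schwartz_seminorm_upper[OF assms, of 0 N]]) simp

context graded
begin

definition hdim :: nat where "hdim = (\<Sum>j\<in>UNIV. \<upsilon> j)"

definition axis_scale :: "real \<Rightarrow> (real, 'n) vec \<Rightarrow> real" where
  "axis_scale r b = dil \<upsilon> r b \<bullet> b"

lemma axis_scale_axis: "axis_scale r (axis i 1) = r ^ \<upsilon> i"
  by (simp add: axis_scale_def inner_axis)

lemma dil_Basis: "b \<in> Basis \<Longrightarrow> dil \<upsilon> r b = axis_scale r b *\<^sub>R b"
proof -
  assume "b \<in> Basis"
  then obtain i where b: "b = axis i 1" by (auto simp: Basis_vec_def)
  show ?thesis unfolding b axis_scale_axis by (simp add: vec_eq_iff axis_def)
qed

lemma dil_expand: "dil \<upsilon> r x = (\<Sum>b\<in>Basis. (axis_scale r b * (x \<bullet> b)) *\<^sub>R b)"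
proof -
  have "dil \<upsilon> r x = dil \<upsilon> r (\<Sum>b\<in>Basis. (x \<bullet> b) *\<^sub>R b)" by (simp add: euclidean_representation)
  also have "\<dots> = (\<Sum>b\<in>Basis. (axis_scale r b * (x \<bullet> b)) *\<^sub>R b)"
    by (simp add: linear_sum[OF linear_dil] linear_cmul[OF linear_dil] dil_Basis mult.commute)
  finally show ?thesis .
qed

lemma lborel_dil:
  assumes "0 < r"
  shows "(lborel :: (real, 'n) vec measure) = density (distr lborel borel (dil \<upsilon> r)) (\<lambda>_. ennreal (r ^ hdim))"
proof -
  have "axis_scale r b \<noteq> 0" if "b \<in> Basis" for b
    using that assms by (auto simp: Basis_vec_def axis_scale_axis)
  from lborel_affine_euclidean[of "axis_scale r" 0, OF this]
  have "(lborel :: (real, 'n) vec measure) = density (distr lborel borel (dil \<upsilon> r)) (\<lambda>_. ennreal (\<Prod>b\<in>Basis. \<bar>axis_scale r b\<bar>))"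
    by (simp add: dil_expand[abs_def] prod_ennreal)
  moreover have "(\<Prod>b\<in>Basis. \<bar>axis_scale r b\<bar>) = r ^ hdim"
    unfolding prod_Basis_cart hdim_def using assms by (simp add: axis_scale_axis power_sum)
  ultimately show ?thesis by simp
qed

lemma dil_borel [measurable]: "dil \<upsilon> r \<in> borel_measurable borel"
  by (rule borel_measurable_continuous_onI[OF continuous_dil])

lemma dil_integral:
  fixes f :: "(real, 'n) vec \<Rightarrow> 'b::{banach, second_countable_topology}"
  assumes [measurable]: "f \<in> borel_measurable borel" and r: "0 < r"
  shows "(LINT x|lborel. f x) = r ^ hdim *\<^sub>R (LINT x|lborel. f (dil \<upsilon> r x))"
  using r by (subst lborel_dil[OF r]) (simp add: integral_density integral_distr)

lemma dil_integrable:
  fixes f :: "(real, 'n) vec \<Rightarrow> 'b::{banach, second_countable_topology}"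
  assumes [measurable]: "f \<in> borel_measurable borel" and r: "0 < r"
  shows "integrable lborel (\<lambda>x. f (dil \<upsilon> r x)) \<longleftrightarrow> integrable lborel f"
proof -
  have "integrable lborel f \<longleftrightarrow> integrable lborel (\<lambda>x. r ^ hdim *\<^sub>R f (dil \<upsilon> r x))"
    using r by (subst lborel_dil[OF r]) (simp add: integrable_density integrable_distr_eq)
  also have "\<dots> \<longleftrightarrow> integrable lborel (\<lambda>x. f (dil \<upsilon> r x))"
    using integrable_scaleR_right[of "1 / r ^ hdim" lborel "\<lambda>x. r ^ hdim *\<^sub>R f (dil \<upsilon> r x)"] r by auto
  finally show ?thesis ..
qed

lemma dil_AE:
  assumes r: "0 < r" and P: "AE x in (lborel :: (real, 'n) vec measure). P x"
  shows "AE x in lborel. P (dil \<upsilon> r x)"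
proof -
  have "AE x in distr lborel borel (dil \<upsilon> r). P x"
    using P r by (subst (asm) lborel_dil[OF r], subst (asm) AE_density) auto
  then show ?thesis by (rule AE_distrD[rotated]) simp
qed

lemma has_derivative_dil: "(dil \<upsilon> r has_derivative dil \<upsilon> r) (at x)"
  by (rule linear_imp_has_derivative[OF linear_dil])

lemma has_derivative_comp_dil:
  fixes f :: "(real, 'n) vec \<Rightarrow> complex"
  assumes "(f has_derivative f') (at (dil \<upsilon> r x))"
  shows "((\<lambda>y. c * f (dil \<upsilon> r y)) has_derivative (\<lambda>h. c * f' (dil \<upsilon> r h))) (at x)"
  by (intro has_derivative_mult_right has_derivative_compose[OF has_derivative_dil assms])

lemma partials_dil:
  fixes f :: "(real, 'n) vec \<Rightarrow> complex"
  assumes f: "smooth f" and bs: "bs \<in> lists Basis"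
  shows "partials bs (\<lambda>y. c * f (dil \<upsilon> r y)) = (\<lambda>y. (c * prod_list (map (\<lambda>b. complex_of_real (axis_scale r b)) bs)) * partials bs f (dil \<upsilon> r y))"
  using bs
proof (induction bs rule: list.induct)
  case (Cons b bs)
  then have bs: "bs \<in> lists Basis" and b: "b \<in> Basis" by auto
  show ?case
  proof
    fix y
    note d = smooth_partials_has_derivative[OF f bs, of "dil \<upsilon> r y"]
    have lin: "frechet_derivative (partials bs f) (at (dil \<upsilon> r y)) (dil \<upsilon> r b) =
        complex_of_real (axis_scale r b) * partial b (partials bs f) (dil \<upsilon> r y)"
      unfolding dil_Basis[OF b] linear_cmul[OF has_derivative_linear[OF d]] has_derivative_imp_partial[OF d]
      by (rule scaleR_conv_of_real)
    show "partials (b # bs) (\<lambda>y. c * f (dil \<upsilon> r y)) y =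
        c * prod_list (map (\<lambda>b. complex_of_real (axis_scale r b)) (b # bs)) * partials (b # bs) f (dil \<upsilon> r y)"
      using has_derivative_imp_partial[OF has_derivative_comp_dil[OF d], of b "c * prod_list (map (\<lambda>b. complex_of_real (axis_scale r b)) bs)"]
      by (simp add: Cons.IH[OF bs] lin mult_ac)
  qed
qed simp

lemma dil_weight:
  assumes "r \<noteq> 0" obtains M where "1 \<le> M" "\<And>x N. (1 + norm x) ^ N \<le> M ^ N * (1 + norm (dil \<upsilon> r x)) ^ N"
proof -
  define M where "M = 1 + onorm (dil \<upsilon> (1 / r))"
  have bl: "bounded_linear (dil \<upsilon> (1 / r))" using linear_dil linear_conv_bounded_linear by blast
  have M: "1 \<le> M" using onorm_pos_le[OF bl] by (simp add: M_def)
  have "1 + norm x \<le> M * (1 + norm (dil \<upsilon> r x))" for x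
  proof -
    have "norm x \<le> onorm (dil \<upsilon> (1 / r)) * norm (dil \<upsilon> r x)"
      using onorm[OF bl, of "dil \<upsilon> r x"] assms by simp
    moreover have "M * (1 + norm (dil \<upsilon> r x)) = 1 + norm (dil \<upsilon> r x) + onorm (dil \<upsilon> (1 / r)) + onorm (dil \<upsilon> (1 / r)) * norm (dil \<upsilon> r x)"
      by (simp add: M_def algebra_simps)
    ultimately show ?thesis using onorm_pos_le[OF bl] norm_ge_zero[of "dil \<upsilon> r x"] by linarith
  qed
  then have "(1 + norm x) ^ N \<le> M ^ N * (1 + norm (dil \<upsilon> r x)) ^ N" for x N
    unfolding power_mult_distrib[symmetric] by (intro power_mono) auto
  then show ?thesis using M that by blast
qed

lemma schwartz_dil:
  assumes f: "f \<in> schwartz" and r: "r \<noteq> 0" and bs: "bs \<in> lists Basis"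
    and M: "1 \<le> M" "\<And>x N. (1 + norm x) ^ N \<le> M ^ N * (1 + norm (dil \<upsilon> r x)) ^ N"
  shows "(1 + norm x) ^ N * norm (partials bs (\<lambda>y. c * f (dil \<upsilon> r y)) x) \<le>
      norm (c * prod_list (map (\<lambda>b. complex_of_real (axis_scale r b)) bs)) * M ^ N * schwartz_seminorm N bs f"
proof -
  have sm: "smooth f" using f by (simp add: schwartz_def)
  define k where "k = norm (c * prod_list (map (\<lambda>b. complex_of_real (axis_scale r b)) bs))"
  have "(1 + norm x) ^ N * norm (partials bs f (dil \<upsilon> r x)) \<le> M ^ N * ((1 + norm (dil \<upsilon> r x)) ^ N * norm (partials bs f (dil \<upsilon> r x)))"
    unfolding mult.assoc[symmetric] by (intro mult_right_mono M) auto
  also have "\<dots> \<le> M ^ N * schwartz_seminorm N bs f"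
    using M(1) by (intro mult_left_mono schwartz_seminorm_upper f bs) auto
  finally have "k * ((1 + norm x) ^ N * norm (partials bs f (dil \<upsilon> r x))) \<le> k * (M ^ N * schwartz_seminorm N bs f)"
    by (intro mult_left_mono) (auto simp: k_def)
  then show ?thesis unfolding partials_dil[OF sm bs] by (simp add: norm_mult k_def mult_ac)
qed

lemma schwartz_comp_dil:
  assumes f: "f \<in> schwartz" and r: "r \<noteq> 0" shows "(\<lambda>y. c * f (dil \<upsilon> r y)) \<in> schwartz"
proof -
  have sm: "smooth f" using f by (simp add: schwartz_def)
  obtain M where M: "1 \<le> M" "\<And>x N. (1 + norm x) ^ N \<le> M ^ N * (1 + norm (dil \<upsilon> r x)) ^ N"
    using dil_weight[OF r] by blast
  have "partials bs (\<lambda>y. c * f (dil \<upsilon> r y)) differentiable (at x)" if "bs \<in> lists Basis" for bs x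
    unfolding partials_dil[OF sm that] differentiable_def
    by (rule exI, rule has_derivative_comp_dil[OF smooth_partials_has_derivative[OF sm that]])
  moreover have "bounded (range (\<lambda>x. (1 + norm x) ^ N *\<^sub>R partials bs (\<lambda>y. c * f (dil \<upsilon> r y)) x))"
    if "bs \<in> lists Basis" for bs N
    unfolding bounded_iff using schwartz_dil[OF f r that M, of _ N c]
    by (auto simp: power_abs)
  ultimately show ?thesis by (auto simp: schwartz_def smooth_def)
qed

lemma schwartz_tendsto_dil:
  assumes t: "schwartz_tendsto g l F" and g: "\<And>t. g t \<in> schwartz" and l: "l \<in> schwartz" and r: "r \<noteq> 0"
  shows "schwartz_tendsto (\<lambda>t y. c * g t (dil \<upsilon> r y)) (\<lambda>y. c * l (dil \<upsilon> r y)) F"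
  unfolding schwartz_tendsto_def
proof (intro allI ballI)
  fix N :: nat and bs :: "(real, 'n) vec list" assume bs: "bs \<in> lists Basis"
  obtain M where M: "1 \<le> M" "\<And>x N. (1 + norm x) ^ N \<le> M ^ N * (1 + norm (dil \<upsilon> r x)) ^ N"
    using dil_weight[OF r] by blast
  define k where "k = norm (c * prod_list (map (\<lambda>b. complex_of_real (axis_scale r b)) bs)) * M ^ N"
  define h where "h = (\<lambda>t y. g t y - l y)"
  have h: "h t \<in> schwartz" for t using schwartz_lincomb[OF g l, of 1 t "-1"] by (simp add: h_def)
  have "((\<lambda>t. schwartz_seminorm N bs (h t)) \<longlongrightarrow> 0) F"
    using t bs by (simp add: schwartz_tendsto_def h_def)
  then have "((\<lambda>t. k * schwartz_seminorm N bs (h t)) \<longlongrightarrow> 0) F" by (rule tendsto_mult_right_zero)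
  then show "((\<lambda>t. schwartz_seminorm N bs (\<lambda>y. c * g t (dil \<upsilon> r y) - c * l (dil \<upsilon> r y))) \<longlongrightarrow> 0) F"
  proof (rule Lim_null_comparison[rotated])
    have eq: "(\<lambda>y. c * g t (dil \<upsilon> r y) - c * l (dil \<upsilon> r y)) = (\<lambda>y. c * h t (dil \<upsilon> r y))" for t
      by (simp add: h_def right_diff_distrib)
    have "schwartz_seminorm N bs (\<lambda>y. c * h t (dil \<upsilon> r y)) \<le> k * schwartz_seminorm N bs (h t)" for t
      unfolding schwartz_seminorm_def[of N bs "\<lambda>y. c * h t (dil \<upsilon> r y)"] k_def
      by (intro cSUP_least schwartz_dil[OF h r bs M]) auto
    moreover have "0 \<le> schwartz_seminorm N bs (\<lambda>y. c * h t (dil \<upsilon> r y))" for t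
      by (intro schwartz_seminorm_nonneg schwartz_comp_dil h r bs)
    ultimately show "\<forall>\<^sub>F t in F. norm (schwartz_seminorm N bs (\<lambda>y. c * g t (dil \<upsilon> r y) - c * l (dil \<upsilon> r y)))
        \<le> k * schwartz_seminorm N bs (h t)"
      unfolding eq by simp
  qed
qed

lemma Cc_schwartz_dil:
  assumes "\<kappa> \<in> Cc_schwartz" and r: "r \<noteq> 0"
  shows "(\<lambda>x y. c * \<kappa> x (dil \<upsilon> r y)) \<in> Cc_schwartz"
proof -
  obtain D K where cc: "cc_kernel D K" and D0: "D [] = \<kappa>" using Cc_schwartz_obtain[OF assms(1)] by blast
  interpret cc_kernel D K by fact
  define D' where "D' = (\<lambda>bs x y. c * D bs x (dil \<upsilon> r y))"
  have s: "D' bs x \<in> schwartz" if "bs \<in> lists Basis" for bs x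
    unfolding D'_def by (intro schwartz_comp_dil schw that r)
  have ct: "schwartz_tendsto (D' bs) (D' bs x) (at x)" if "bs \<in> lists Basis" for bs x
    unfolding D'_def by (intro schwartz_tendsto_dil cont schw that r)
  have dt: "schwartz_tendsto (\<lambda>t y. (D' bs (x + t *\<^sub>R b) y - D' bs x y) / complex_of_real t) (D' (b # bs) x) (at 0)"
    if bs: "bs \<in> lists Basis" and b: "b \<in> Basis" for bs b x
  proof -
    have q: "(\<lambda>y. (D bs (x + t *\<^sub>R b) y - D bs x y) / complex_of_real t) \<in> schwartz" for t
      using schwartz_lincomb[OF schw[OF bs] schw[OF bs], of "1 / complex_of_real t" "x + t *\<^sub>R b" "- 1 / complex_of_real t" x]
      by (simp add: diff_divide_distrib)
    have eq: "(D' bs (x + t *\<^sub>R b) y - D' bs x y) / complex_of_real t =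
        c * ((D bs (x + t *\<^sub>R b) (dil \<upsilon> r y) - D bs x (dil \<upsilon> r y)) / complex_of_real t)" for t y
      by (simp add: D'_def right_diff_distrib)
    show ?thesis unfolding eq unfolding D'_def
      using bs b by (intro schwartz_tendsto_dil[OF deriv[OF bs b] q _ r] schw) auto
  qed
  have "\<exists>D. D [] = (\<lambda>x y. c * \<kappa> x (dil \<upsilon> r y)) \<and>
        (\<forall>bs\<in>lists Basis. \<forall>x.
           D bs x \<in> schwartz \<and>
           schwartz_tendsto (D bs) (D bs x) (at x) \<and>
           (\<forall>b\<in>Basis. schwartz_tendsto
              (\<lambda>t y. (D bs (x + t *\<^sub>R b) y - D bs x y) / complex_of_real t) (D (b # bs) x) (at 0)))"
    using s ct dt by (intro exI[of _ D']) (auto simp: D'_def D0)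
  moreover have "\<exists>K. compact K \<and> (\<forall>x. x \<notin> K \<longrightarrow> (\<lambda>y. c * \<kappa> x (dil \<upsilon> r y)) = (\<lambda>y. 0))"
    using compact_K off0 by (auto simp flip: D0 intro!: exI[of _ K])
  ultimately show ?thesis unfolding Cc_schwartz_def by simp
qed

lemma dil_rep_irreps:
  assumes \<pi>: "\<pi> \<in> irreps m" and r: "r \<noteq> 0" shows "dil_rep \<upsilon> r \<pi> \<in> irreps m"
proof -
  obtain I U where IU: "\<pi> = (I, U)" by (cases \<pi>)
  have rep: "unitary_rep m (I, U)" and I: "I \<noteq> {}"
    and irr: "\<And>W. closed_subspace I W \<Longrightarrow> (\<forall>x. \<forall>v\<in>W. U x v \<in> W) \<Longrightarrow> W = {\<lambda>n. 0} \<or> W = ell2 I"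
    using \<pi> by (auto simp: irreps_def IU)
  have cont: "((\<lambda>y. ell2_norm (\<lambda>n. U (dil \<upsilon> r y) v n - U (dil \<upsilon> r x) v n)) \<longlongrightarrow> 0) (at x)"
    if "v \<in> ell2 I" for v x
  proof -
    have "((\<lambda>z. ell2_norm (\<lambda>n. U z v n - U (dil \<upsilon> r x) v n)) \<longlongrightarrow> 0) (at (dil \<upsilon> r x))"
      using rep that by (simp add: unitary_rep_def)
    then have "isCont (\<lambda>z. ell2_norm (\<lambda>n. U z v n - U (dil \<upsilon> r x) v n)) (dil \<upsilon> r x)"
      by (simp add: isCont_def ell2_norm_def)
    moreover have "isCont (dil \<upsilon> r) x"
      using continuous_dil[of \<upsilon> r] by (simp add: continuous_on_eq_continuous_at)
    ultimately have "isCont (\<lambda>y. ell2_norm (\<lambda>n. U (dil \<upsilon> r y) v n - U (dil \<upsilon> r x) v n)) x"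
      by (intro isCont_o2[where f = "dil \<upsilon> r" and g = "\<lambda>z. ell2_norm (\<lambda>n. U z v n - U (dil \<upsilon> r x) v n)"])
    then show ?thesis by (simp add: isCont_def ell2_norm_def)
  qed
  have "unitary_rep m (I, \<lambda>x. U (dil \<upsilon> r x))"
    using rep cont unfolding unitary_rep_def by (simp add: dil_mult)
  moreover have "W = {\<lambda>n. 0} \<or> W = ell2 I" if W: "closed_subspace I W" "\<forall>x. \<forall>v\<in>W. U (dil \<upsilon> r x) v \<in> W" for W
    using irr[OF W(1)] W(2) dil_inverse(2)[OF r] by metis
  ultimately show ?thesis using I by (auto simp: irreps_def dil_rep_def IU)
qed

lemma Cc_schwartz_decay:
  assumes "\<kappa> \<in> Cc_schwartz"
  obtains C where "0 \<le> C" "\<And>x y. norm (\<kappa> x y) \<le> C / (1 + norm y) ^ N"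
proof -
  obtain D K where cc: "cc_kernel D K" and D0: "D [] = \<kappa>" using Cc_schwartz_obtain[OF assms] by blast
  show ?thesis by (rule cc_kernel.decay[OF cc, of "[]" N]) (auto simp: D0 intro: that)
qed

lemma Cc_schwartz_continuous:
  assumes "\<kappa> \<in> Cc_schwartz" shows "continuous_on UNIV (\<lambda>p. \<kappa> (fst p) (snd p))"
proof -
  obtain D K where cc: "cc_kernel D K" and D0: "D [] = \<kappa>" using Cc_schwartz_obtain[OF assms] by blast
  show ?thesis using cc_kernel.continuous_kernel[OF cc] by (simp add: D0)
qed

lemma Cc_schwartz_slice_continuous:
  assumes "\<kappa> \<in> Cc_schwartz" shows "continuous_on UNIV (\<kappa> x)"
proof -
  have "continuous_on UNIV ((\<lambda>p. \<kappa> (fst p) (snd p)) \<circ> (\<lambda>y. (x, y)))"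
    by (intro continuous_on_compose continuous_on_subset[OF Cc_schwartz_continuous[OF assms]] continuous_intros) auto
  then show ?thesis by (simp add: o_def)
qed

lemma Cc_schwartz_L1_L2:
  fixes \<kappa> :: "'a::euclidean_space \<Rightarrow> 'a \<Rightarrow> complex"
  assumes "\<kappa> \<in> Cc_schwartz" shows "\<kappa> x \<in> L1 \<inter> L2"
proof -
  obtain C where "\<And>x y. norm (\<kappa> x y) \<le> C / (1 + norm y) ^ (2 * DIM('a))"
    using Cc_schwartz_decay[OF assms] by metis
  then show ?thesis
    using decay_L1_L2(1,2)[OF borel_measurable_continuous_onI[OF Cc_schwartz_slice_continuous[OF assms]]] by blast
qed

lemma kernel_unique:
  assumes pl: "plancherel_measure m \<mu>" and k: "has_kernel m \<sigma> \<kappa>" "has_kernel m \<sigma> \<kappa>'"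
  shows "\<kappa> = \<kappa>'"
proof (intro ext)
  fix x y
  have cc: "\<kappa> \<in> Cc_schwartz" "\<kappa>' \<in> Cc_schwartz" using k by (auto simp: has_kernel_def)
  note L = Cc_schwartz_L1_L2[OF cc(1), of x] Cc_schwartz_L1_L2[OF cc(2), of x]
  have "\<kappa> x y + (- 1) * \<kappa>' x y = 0"
  proof (rule fourier_injective[OF pl, of "\<lambda>y. \<kappa> x y + (- 1) * \<kappa>' x y"])
    show "(\<lambda>y. \<kappa> x y + (- 1) * \<kappa>' x y) \<in> L1 \<inter> L2" by (rule L2_L1_lincomb[OF L])
    show "continuous_on UNIV (\<lambda>y. \<kappa> x y + (- 1) * \<kappa>' x y)"
      by (intro continuous_intros Cc_schwartz_slice_continuous cc)
    fix \<pi> v assume \<pi>: "\<pi> \<in> irreps m" and v: "v \<in> ell2 (fst \<pi>)"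
    obtain I U where IU: "\<pi> = (I, U)" by (cases \<pi>)
    have rep: "unitary_rep m (I, U)" using \<pi> by (simp add: irreps_def IU)
    have "fourier (\<kappa> x) (I, U) v = fourier (\<kappa>' x) (I, U) v"
      using k \<pi> v unfolding has_kernel_def IU by (metis fst_conv)
    then show "fourier (\<lambda>y. \<kappa> x y + (- 1) * \<kappa>' x y) \<pi> v = (\<lambda>n. 0)"
      using fourier_lincomb[OF rep _ _ , of "\<kappa> x" "\<kappa>' x" v "-1"] L v by (simp add: IU)
  qed
  then show "\<kappa> x y = \<kappa>' x y" by simp
qed

lemma has_kernel_dil:
  assumes k: "has_kernel m \<sigma> \<kappa>" and r: "0 < r"
  shows "has_kernel m (\<lambda>x \<pi>. \<sigma> x (dil_rep \<upsilon> r \<pi>)) (\<lambda>x y. complex_of_real ((1 / r) ^ hdim) * \<kappa> x (dil \<upsilon> (1 / r) y))"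
proof -
  have cc: "\<kappa> \<in> Cc_schwartz" using k by (simp add: has_kernel_def)
  have "\<sigma> x (dil_rep \<upsilon> r \<pi>) v = fourier (\<lambda>y. complex_of_real ((1 / r) ^ hdim) * \<kappa> x (dil \<upsilon> (1 / r) y)) \<pi> v"
    if \<pi>: "\<pi> \<in> irreps m" and v: "v \<in> ell2 (fst \<pi>)" for x \<pi> v
  proof -
    obtain I U where IU: "\<pi> = (I, U)" by (cases \<pi>)
    have rep: "unitary_rep m (I, U)" using \<pi> by (simp add: irreps_def IU)
    interpret urep m I U by unfold_locales (rule rep)
    have vI: "v \<in> ell2 I" using v by (simp add: IU)
    have [measurable]: "\<kappa> x \<in> borel_measurable borel"
      by (rule borel_measurable_continuous_onI[OF Cc_schwartz_slice_continuous[OF cc]])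
    have "\<sigma> x (dil_rep \<upsilon> r \<pi>) v = fourier (\<kappa> x) (dil_rep \<upsilon> r \<pi>) v"
      using k dil_rep_irreps[OF \<pi>] r v unfolding has_kernel_def by (auto simp: dil_rep_def)
    also have "\<dots> = fourier (\<lambda>y. complex_of_real ((1 / r) ^ hdim) * \<kappa> x (dil \<upsilon> (1 / r) y)) \<pi> v"
    proof
      fix n
      define G where "G = (\<lambda>y. adj I (U y) v n)"
      have [measurable]: "G \<in> borel_measurable borel"
        using coeff_measurable[OF vI unit_vec_ell2] by (cases "n \<in> I") (auto simp: G_def adj_def)
      have "fourier (\<kappa> x) (dil_rep \<upsilon> r \<pi>) v n = (LINT y|lborel. \<kappa> x y * G (dil \<upsilon> r y))"
        using vI by (simp add: fourier_def dil_rep_def IU G_def)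
      also have "\<dots> = (1 / r) ^ hdim *\<^sub>R (LINT y|lborel. \<kappa> x (dil \<upsilon> (1 / r) y) * G (dil \<upsilon> r (dil \<upsilon> (1 / r) y)))"
        by (rule dil_integral) (use r in auto)
      also have "\<dots> = (LINT y|lborel. complex_of_real ((1 / r) ^ hdim) * \<kappa> x (dil \<upsilon> (1 / r) y) * G y)"
        using r by (simp add: scaleR_conv_of_real mult.assoc)
      finally show "fourier (\<kappa> x) (dil_rep \<upsilon> r \<pi>) v n =
          fourier (\<lambda>y. complex_of_real ((1 / r) ^ hdim) * \<kappa> x (dil \<upsilon> (1 / r) y)) \<pi> v n"
        using vI by (simp add: fourier_def IU G_def)
    qed
    finally show ?thesis .
  qed
  moreover have "1 / r \<noteq> 0" using r by simp
  ultimately show ?thesis unfolding has_kernel_def using Cc_schwartz_dil[OF cc] by blast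
qed

text \<open>Uniqueness of the kernel resolves the choice in the definition of the quantization.\<close>

lemma Op_eps_eq:
  assumes pl: "plancherel_measure m \<mu>" and k: "has_kernel m \<sigma> \<kappa>" and r: "0 < \<epsilon>"
  shows "Op_eps \<upsilon> m \<epsilon> \<sigma> f x = conv m f (\<lambda>y. complex_of_real ((1 / \<epsilon>) ^ hdim) * \<kappa> x (dil \<upsilon> (1 / \<epsilon>) y)) x"
proof -
  let ?\<sigma> = "\<lambda>x \<pi>. \<sigma> x (dil_rep \<upsilon> \<epsilon> \<pi>)"
  let ?\<kappa> = "\<lambda>x y. complex_of_real ((1 / \<epsilon>) ^ hdim) * \<kappa> x (dil \<upsilon> (1 / \<epsilon>) y)"
  have "(SOME \<kappa>'. has_kernel m ?\<sigma> \<kappa>') = ?\<kappa>"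
    using has_kernel_dil[OF k r] kernel_unique[OF pl] by (intro some_equality) blast+
  then show ?thesis by (simp add: Op_eps_def Op_KN_def)
qed

end


section \<open>A bump function\<close>

definition tent :: "'a::euclidean_space \<Rightarrow> real" where
  "tent u = max 0 (1 - norm u)"

text \<open>The regularity of the bump matters for the size of \<open>\<integral> (g(uh) - g(u))\<^sup>2 du\<close>, which is quadratic in \<open>h\<close>
  already for a Lipschitz function.\<close>

definition bump :: "'a::euclidean_space \<Rightarrow> real" where
  "bump u = tent u / sqrt (LINT x|(lborel :: 'a measure). (tent x)\<^sup>2)"

lemma tent_continuous: "continuous_on UNIV tent"
  unfolding tent_def by (intro continuous_intros)

lemma tent_measurable [measurable]: "tent \<in> borel_measurable borel"
  by (rule borel_measurable_continuous_onI[OF tent_continuous])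

lemma tent_sq_integrable: "integrable (lborel :: 'a::euclidean_space measure) (\<lambda>x. (tent x)\<^sup>2)"
proof (rule integrable_dominated)
  show "integrable lborel (indicator (cball 0 1) :: 'a \<Rightarrow> real)"
    by (rule integrable_real_indicator) (use emeasure_bounded_finite[OF bounded_cball] in auto)
  fix x :: 'a
  have "(tent x)\<^sup>2 \<le> 1\<^sup>2" by (intro power_mono) (auto simp: tent_def)
  then show "norm ((tent x)\<^sup>2) \<le> indicator (cball 0 1) x"
    by (auto simp: tent_def split: split_indicator)
qed simp

lemma tent_sq_integral_pos: "0 < (LINT x|(lborel :: 'a::euclidean_space measure). (tent x)\<^sup>2)"
proof (rule ccontr)
  assume "\<not> 0 < (LINT x|(lborel :: 'a measure). (tent x)\<^sup>2)"
  moreover have "0 \<le> (LINT x|(lborel :: 'a measure). (tent x)\<^sup>2)" by simp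
  ultimately have "(LINT x|(lborel :: 'a measure). (tent x)\<^sup>2) = 0" by linarith
  then have "AE x in (lborel :: 'a measure). (tent x)\<^sup>2 = 0"
    using integral_nonneg_eq_0_iff_AE[OF tent_sq_integrable] by auto
  then have "AE x in (lebesgue :: 'a measure). x \<in> {x. tent x = 0}" by (auto intro: AE_completion)
  moreover have "closed {x :: 'a. tent x = 0}" by (rule closed_Collect_eq[OF tent_continuous continuous_on_const])
  ultimately have "(0 :: 'a) \<in> {x. tent x = 0}" using mem_closed_if_AE_lebesgue by blast
  then show False by (simp add: tent_def)
qed

lemma bump_measurable [measurable]: "bump \<in> borel_measurable borel"
  unfolding bump_def[abs_def] by measurable

lemma bump_nonneg: "0 \<le> bump u"
  using tent_sq_integral_pos by (simp add: bump_def tent_def)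

lemma bump_minus [simp]: "bump (- u) = bump u"
  by (simp add: bump_def tent_def)

lemma bump_outside: "1 < norm u \<Longrightarrow> bump u = 0"
  by (simp add: bump_def tent_def)

lemma bump_sq_integrable: "integrable lborel (\<lambda>x::'a::euclidean_space. (bump x)\<^sup>2)"
  using tent_sq_integrable[where 'a = 'a] by (simp add: bump_def power_divide)

lemma bump_sq_integral: "(LINT x|(lborel :: 'a::euclidean_space measure). (bump x)\<^sup>2) = 1"
  using tent_sq_integral_pos[where 'a = 'a] by (simp add: bump_def power_divide)

lemma bump_lipschitz:
  obtains L where "0 \<le> L" "\<And>u v :: 'a::euclidean_space. \<bar>bump u - bump v\<bar> \<le> L * norm (u - v)"
    "\<And>u :: 'a. bump u \<le> L"
proof -
  define c where "c = sqrt (LINT x|(lborel :: 'a measure). (tent x)\<^sup>2)"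
  have c: "0 < c" using tent_sq_integral_pos[where 'a = 'a] by (simp add: c_def)
  have "\<bar>tent u - tent v\<bar> \<le> norm (u - v)" for u v :: 'a
    using norm_triangle_ineq2[of u v] norm_triangle_ineq2[of v u] norm_minus_commute[of u v] by (auto simp: tent_def)
  then have "\<bar>bump u - bump v\<bar> \<le> 1 / c * norm (u - v)" for u v :: 'a
    using c by (simp add: bump_def divide_right_mono flip: c_def diff_divide_distrib)
  moreover have "bump u \<le> 1 / c" for u :: 'a
  proof -
    have "tent u \<le> 1" by (simp add: tent_def)
    then show ?thesis using c by (simp add: bump_def divide_right_mono flip: c_def)
  qed
  ultimately show ?thesis using c by (intro that[of "1 / c"]) auto
qed

context graded
begin

lemma inversion_integral:
  fixes f :: "(real, 'n) vec \<Rightarrow> 'b::{banach, second_countable_topology}"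
  assumes [measurable]: "f \<in> borel_measurable borel"
  shows "(LINT u|lborel. f (- u)) = (LINT u|lborel. f u)"
  by (subst (2) inversion_invariant[symmetric], subst integral_distr) auto

lemma inversion_integrable:
  fixes f :: "(real, 'n) vec \<Rightarrow> 'b::{banach, second_countable_topology}"
  assumes [measurable]: "f \<in> borel_measurable borel"
  shows "integrable lborel (\<lambda>u. f (- u)) \<longleftrightarrow> integrable lborel f"
  by (subst (2) inversion_invariant[symmetric], subst integrable_distr_eq) auto

lemma right_integral:
  fixes f :: "(real, 'n) vec \<Rightarrow> 'b::{banach, second_countable_topology}"
  assumes [measurable]: "f \<in> borel_measurable borel"
  shows "(LINT u|lborel. f (m u a)) = (LINT u|lborel. f u)"
  by (subst (2) right_invariant[symmetric, of a], subst integral_distr) auto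

lemma right_integrable:
  fixes f :: "(real, 'n) vec \<Rightarrow> 'b::{banach, second_countable_topology}"
  assumes [measurable]: "f \<in> borel_measurable borel"
  shows "integrable lborel (\<lambda>u. f (m u a)) \<longleftrightarrow> integrable lborel f"
  by (subst (2) right_invariant[symmetric, of a], subst integrable_distr_eq) auto

lemma bump_right_translate:
  "integrable lborel (\<lambda>u. (bump (m u h))\<^sup>2)" "(LINT u|lborel. (bump (m u h))\<^sup>2) = 1"
  using right_integrable[of "\<lambda>u. (bump u)\<^sup>2" h] right_integral[of "\<lambda>u. (bump u)\<^sup>2" h]
  by (simp_all add: bump_sq_integrable bump_sq_integral)

text \<open>Since \<open>|f(x)| |f(y)| \<le> (|f(x)|\<^sup>2 + |f(y)|\<^sup>2) / 2\<close>, one variable can be integrated first in each term;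
  by invariance of the measure and evenness of \<open>\<rho>\<close> this gives \<open>\<integral> \<rho>\<close>.\<close>

lemma schur_test:
  assumes f: "f \<in> L2" and \<rho>: "integrable lborel \<rho>" and \<rho>0: "\<And>w. 0 \<le> \<rho> w" and even: "\<And>w. \<rho> (- w) = \<rho> w"
  defines "A \<equiv> \<lambda>p. cmod (f (fst p)) * cmod (f (snd p)) * \<rho> (m (- snd p) (fst p))"
  shows "integrable (lborel \<Otimes>\<^sub>M lborel) A"
    and "(LINT p|(lborel \<Otimes>\<^sub>M lborel). A p) \<le> (LINT w|lborel. \<rho> w) * (LINT x|lborel. (cmod (f x))\<^sup>2)"
proof -
  let ?P = "(lborel :: (real, 'n) vec measure) \<Otimes>\<^sub>M (lborel :: (real, 'n) vec measure)"
  have [measurable]: "f \<in> borel_measurable borel" "\<rho> \<in> borel_measurable borel"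
    using f \<rho> by (auto simp: L2_def)
  define B where "B = (\<lambda>p. (cmod (f (fst p)))\<^sup>2 * \<rho> (m (- fst p) (snd p)))"
  define B' where "B' = (\<lambda>p. (cmod (f (snd p)))\<^sup>2 * \<rho> (m (- snd p) (fst p)))"
  have B_meas [measurable]: "B \<in> borel_measurable ?P" unfolding B_def by measurable
  have sq: "integrable lborel (\<lambda>x. (cmod (f x))\<^sup>2)" using f by (simp add: L2_def)
  have B: "integrable ?P B"
  proof (rule lborel_pair.Fubini_integrable[OF B_meas])
    show "integrable lborel (\<lambda>x. LINT y|lborel. norm (B (x, y)))"
      using sq \<rho>0 left_integral[of \<rho>] by (simp add: B_def abs_mult)
    show "AE x in lborel. integrable lborel (\<lambda>y. B (x, y))"
      using left_integrable[of \<rho>] \<rho> by (simp add: B_def)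
  qed
  have B': "integrable ?P B'" and B'_eq: "(LINT p|?P. B' p) = (LINT p|?P. B p)"
    using lborel_pair.integrable_product_swap[OF B] lborel_pair.integral_product_swap[OF B_meas]
    by (simp_all add: case_prod_unfold B_def B'_def)
  have le: "A p \<le> (B p + B' p) / 2" for p
  proof -
    have "A p \<le> ((cmod (f (fst p)))\<^sup>2 + (cmod (f (snd p)))\<^sup>2) / 2 * \<rho> (m (- snd p) (fst p))"
      unfolding A_def by (intro mult_right_mono mult_le_half_squares \<rho>0)
    also have "\<rho> (m (- snd p) (fst p)) = \<rho> (m (- fst p) (snd p))"
      using even[of "m (- snd p) (fst p)"] by (simp add: minus_mult)
    then have "((cmod (f (fst p)))\<^sup>2 + (cmod (f (snd p)))\<^sup>2) / 2 * \<rho> (m (- snd p) (fst p)) = (B p + B' p) / 2"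
      by (simp add: B_def B'_def algebra_simps)
    finally show ?thesis .
  qed
  have BB: "integrable ?P (\<lambda>p. (B p + B' p) / 2)" using B B' by simp
  show int: "integrable ?P A"
  proof (rule integrable_dominated[OF BB])
    show "A \<in> borel_measurable ?P" unfolding A_def by measurable
    show "norm (A p) \<le> (B p + B' p) / 2" for p using le[of p] \<rho>0 by (simp add: A_def abs_mult)
  qed
  have "(LINT p|?P. A p) \<le> (LINT p|?P. (B p + B' p) / 2)" by (rule integral_mono[OF int BB]) (rule le)
  also have "\<dots> = (LINT p|?P. B p)" using B B' by (simp add: B'_eq)
  also have "\<dots> = (LINT w|lborel. \<rho> w) * (LINT x|lborel. (cmod (f x))\<^sup>2)"
    using lborel_pair.integral_fst'[OF B] left_integral[of \<rho>] by (simp add: B_def mult.commute)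
  finally show "(LINT p|?P. A p) \<le> (LINT w|lborel. \<rho> w) * (LINT x|lborel. (cmod (f x))\<^sup>2)" .
qed

text \<open>For \<open>|h| \<le> 1\<close> the bump is Lipschitz and everything is supported in a fixed ball; for \<open>|h| > 1\<close> the
  trivial bound \<open>4 \<le> 4 |h|\<^sup>2\<close> applies.\<close>

lemma bump_translation:
  obtains C where "0 \<le> C" "\<And>h. integrable lborel (\<lambda>u. (bump (m u h) - bump u)\<^sup>2)"
    "\<And>h. (LINT u|lborel. (bump (m u h) - bump u)\<^sup>2) \<le> C * (norm h)\<^sup>2"
proof -
  obtain Lg where Lg: "0 \<le> Lg" "\<And>u v :: (real, 'n) vec. \<bar>bump u - bump v\<bar> \<le> Lg * norm (u - v)"
    using bump_lipschitz by metis
  obtain L where L: "0 \<le> L" "\<And>x v. norm x \<le> 1 \<Longrightarrow> norm v \<le> 1 \<Longrightarrow> norm (m x v - x) \<le> L * norm v"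
    using translation_small[of 1] by metis
  define R where "R = 1 + L"
  obtain L' where L': "0 \<le> L'" "\<And>x v. norm x \<le> R \<Longrightarrow> norm v \<le> 1 \<Longrightarrow> norm (m x v - x) \<le> L' * norm v"
    using translation_small[of R] by metis
  define V where "V = measure lborel (cball (0 :: (real, 'n) vec) R)"
  have V: "0 \<le> V" by (simp add: V_def)
  have dom: "(bump (m u h) - bump u)\<^sup>2 \<le> 2 * (bump (m u h))\<^sup>2 + 2 * (bump u)\<^sup>2" for u h
    using norm_add_squares[of "bump (m u h)" "- bump u"] by simp
  have int2: "integrable lborel (\<lambda>u. 2 * (bump (m u h))\<^sup>2 + 2 * (bump u)\<^sup>2)" for h
    by (intro Bochner_Integration.integrable_add integrable_mult_right bump_right_translate(1) bump_sq_integrable)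
  have int: "integrable lborel (\<lambda>u. (bump (m u h) - bump u)\<^sup>2)" for h
    by (rule integrable_dominated[OF int2[of h]]) (use dom in auto)
  have small: "(LINT u|lborel. (bump (m u h) - bump u)\<^sup>2) \<le> (Lg * L')\<^sup>2 * V * (norm h)\<^sup>2" if h: "norm h \<le> 1" for h
  proof -
    have pt: "(bump (m u h) - bump u)\<^sup>2 \<le> (Lg * L' * norm h)\<^sup>2 * indicator (cball 0 R) u" for u
    proof (cases "norm u \<le> R")
      case True
      have "\<bar>bump (m u h) - bump u\<bar> \<le> Lg * (L' * norm h)"
        using Lg(2)[of "m u h" u] mult_left_mono[OF L'(2)[OF True h] Lg(1)] by linarith
      then have "\<bar>bump (m u h) - bump u\<bar>\<^sup>2 \<le> (Lg * L' * norm h)\<^sup>2" by (intro power_mono) (auto simp: mult.assoc)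
      then show ?thesis using True by simp
    next
      case False
      have "1 < norm (m u h)"
      proof (rule ccontr)
        assume "\<not> 1 < norm (m u h)"
        then have *: "norm (m u h) \<le> 1" by simp
        have "norm (m (m u h) (- h) - m u h) \<le> L * norm h" using L(2)[OF *, of "- h"] h by simp
        also have "\<dots> \<le> L" using L(1) h by (simp add: mult_left_le)
        finally have "norm u \<le> R" using * norm_triangle_sub[of u "m u h"] by (simp add: R_def)
        with False show False by simp
      qed
      moreover have "1 < norm u" using False L(1) by (simp add: R_def)
      ultimately show ?thesis using False by (simp add: bump_outside)
    qed
    have "integrable lborel (indicator (cball 0 R) :: (real, 'n) vec \<Rightarrow> real)"
      by (rule integrable_real_indicator) (use emeasure_bounded_finite[OF bounded_cball] in auto)
    then have "integrable lborel (\<lambda>u :: (real, 'n) vec. (Lg * L' * norm h)\<^sup>2 * indicator (cball 0 R) u)"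
      by (rule integrable_mult_right)
    then have "(LINT u|lborel. (bump (m u h) - bump u)\<^sup>2) \<le> (LINT u|lborel. (Lg * L' * norm h)\<^sup>2 * indicator (cball (0 :: (real, 'n) vec) R) u)"
      by (rule integral_mono[OF int]) (rule pt)
    also have "\<dots> = (Lg * L')\<^sup>2 * V * (norm h)\<^sup>2" by (simp add: V_def power_mult_distrib mult_ac)
    finally show ?thesis .
  qed
  have large: "(LINT u|lborel. (bump (m u h) - bump u)\<^sup>2) \<le> 4 * (norm h)\<^sup>2" if h: "\<not> norm h \<le> 1" for h
  proof -
    have "(LINT u|lborel. (bump (m u h) - bump u)\<^sup>2) \<le> (LINT u|lborel. 2 * (bump (m u h))\<^sup>2 + 2 * (bump u)\<^sup>2)"
      by (rule integral_mono[OF int int2]) (rule dom)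
    also have "\<dots> = 2 * (LINT u|lborel. (bump (m u h))\<^sup>2) + 2 * (LINT u|(lborel :: (real, 'n) vec measure). (bump u)\<^sup>2)"
      by (subst Bochner_Integration.integral_add)
        (intro integrable_mult_right bump_right_translate(1) bump_sq_integrable, intro integrable_mult_right bump_right_translate(1) bump_sq_integrable, simp)
    also have "\<dots> = 4" by (simp add: bump_right_translate(2) bump_sq_integral)
    also have "\<dots> \<le> 4 * (norm h)\<^sup>2" using h power_mono[of 1 "norm h" 2] by simp
    finally show ?thesis .
  qed
  define C where "C = (Lg * L')\<^sup>2 * V + 4"
  have "(LINT u|lborel. (bump (m u h) - bump u)\<^sup>2) \<le> C * (norm h)\<^sup>2" for h
  proof (cases "norm h \<le> 1")
    case True
    have "(Lg * L')\<^sup>2 * V * (norm h)\<^sup>2 \<le> C * (norm h)\<^sup>2" unfolding C_def by (intro mult_right_mono) auto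
    then show ?thesis using small[OF True] by linarith
  next
    case False
    have "4 * (norm h)\<^sup>2 \<le> C * (norm h)\<^sup>2" unfolding C_def using V by (intro mult_right_mono) auto
    then show ?thesis using large[OF False] by linarith
  qed
  then show ?thesis using V by (intro that[of C] int) (auto simp: C_def)
qed

section \<open>The wave packet quantization\<close>

text \<open>With \<open>u = z\<inverse> \<delta>\<^sub>s x'\<close> and \<open>w = y\<inverse> x'\<close>, this is the integral over \<open>z\<close> of
  \<open>g(z\<inverse> \<delta>\<^sub>s x') g(z\<inverse> \<delta>\<^sub>s y) \<kappa>(\<delta>\<^sub>s z, w)\<close>, at \<open>x = \<delta>\<^sub>r x'\<close> with \<open>r = s\<^sup>2\<close>.\<close>

definition packet_kernel :: "((real, 'n) vec \<Rightarrow> (real, 'n) vec \<Rightarrow> complex) \<Rightarrow> real \<Rightarrow> (real, 'n) vec \<Rightarrow> (real, 'n) vec \<Rightarrow> complex" where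
  "packet_kernel \<kappa> s x w =
    (LINT u|lborel. complex_of_real (bump u * bump (m u (- dil \<upsilon> s w))) * \<kappa> (m x (- dil \<upsilon> s u)) w)"

lemma kernel_measurable:
  assumes "\<kappa> \<in> Cc_schwartz" "f \<in> borel_measurable M" "g \<in> borel_measurable M"
  shows "(\<lambda>p. \<kappa> (f p) (g p)) \<in> borel_measurable M"
  by (rule borel_measurable_continuous_Pair[OF assms(2,3) Cc_schwartz_continuous[OF assms(1)]])

text \<open>Write \<open>b(u) = g(uh)\<close>, \<open>\<Delta> = b - g\<close> and let \<open>F(u) = O(s)\<close> be the variation of the kernel.  As
  \<open>g b = (g\<^sup>2 + b\<^sup>2 - \<Delta>\<^sup>2) / 2\<close> and \<open>\<integral> g\<^sup>2 = \<integral> b\<^sup>2 = 1\<close>, the error consists of \<open>\<Delta>\<^sup>2 \<kappa>\<^sub>x\<close>, of \<open>g \<Delta> F\<close> and of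
  \<open>g\<^sup>2 F\<close>, and the last may be replaced by \<open>g\<^sup>2 (F(u) + F(-u)) / 2\<close>.  All three are \<open>O(s\<^sup>2)\<close>; the factor
  \<open>|w|\<^sup>2\<close> from \<open>\<Delta>\<close> is absorbed by two more powers of decay of \<open>\<kappa>\<close>.\<close>

lemma packet_kernel_estimate:
  assumes \<kappa>: "\<kappa> \<in> Cc_schwartz"
  obtains C where "0 \<le> C" "\<And>s x w. 0 < s \<Longrightarrow> s \<le> 1 \<Longrightarrow>
    cmod (packet_kernel \<kappa> s x w - \<kappa> x w) \<le> C * s\<^sup>2 / (1 + norm w) ^ (2 * DIM((real, 'n) vec))"
proof -
  define d where "d = 2 * DIM((real, 'n) vec)"
  obtain D K where cc: "cc_kernel D K" and D0: "D [] = \<kappa>" using Cc_schwartz_obtain[OF \<kappa>] by blast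
  obtain C1 where C1: "0 \<le> C1"
    "\<And>x v w. norm v \<le> 1 \<Longrightarrow> norm (\<kappa> (m x v) w - \<kappa> x w) \<le> C1 * norm v / (1 + norm w) ^ (d + 2)"
    "\<And>x v w. norm v \<le> 1 \<Longrightarrow>
      norm ((\<kappa> (m x v) w - \<kappa> x w) + (\<kappa> (m x (- v)) w - \<kappa> x w)) \<le> C1 * (norm v)\<^sup>2 / (1 + norm w) ^ (d + 2)"
    using kernel_differences[OF cc, of "d + 2"] unfolding D0 by blast
  obtain C0 where C0: "0 \<le> C0" "\<And>x w. norm (\<kappa> x w) \<le> C0 / (1 + norm w) ^ (d + 2)"
    using Cc_schwartz_decay[OF \<kappa>, of "d + 2"] by blast
  obtain CT where CT: "0 \<le> CT" "\<And>h. integrable lborel (\<lambda>u. (bump (m u h) - bump u)\<^sup>2)"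
    "\<And>h. (LINT u|lborel. (bump (m u h) - bump u)\<^sup>2) \<le> CT * (norm h)\<^sup>2"
    using bump_translation by blast
  have est: "cmod (packet_kernel \<kappa> s x w - \<kappa> x w) \<le> (C0 * CT + C1 * CT + C1) * s\<^sup>2 / (1 + norm w) ^ d"
    if s: "0 < s" "s \<le> 1" for s x w
  proof -
    define h where "h = - dil \<upsilon> s w"
    define P where "P = (1 + norm w) ^ (d + 2)"
    have P: "0 < P" by (simp add: P_def add_pos_nonneg)
    define b where "b = (\<lambda>u. bump (m u h))"
    define \<Delta> where "\<Delta> = (\<lambda>u. b u - bump u)"
    define F where "F = (\<lambda>u. \<kappa> (m x (- dil \<upsilon> s u)) w - \<kappa> x w)"
    have [measurable]: "b \<in> borel_measurable borel" "\<Delta> \<in> borel_measurable borel" "F \<in> borel_measurable borel"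
      unfolding b_def \<Delta>_def F_def by (auto intro!: kernel_measurable[OF \<kappa>] borel_measurable_diff)
    have \<Delta>: "integrable lborel (\<lambda>u. (\<Delta> u)\<^sup>2)" unfolding \<Delta>_def b_def by (rule CT(2))
    have \<Delta>_le: "(LINT u|lborel. (\<Delta> u)\<^sup>2) \<le> CT * (s * norm w)\<^sup>2"
    proof -
      have "norm h \<le> s * norm w" using norm_dil_le[of s w] s by (simp add: h_def)
      then have "CT * (norm h)\<^sup>2 \<le> CT * (s * norm w)\<^sup>2" by (intro mult_left_mono power_mono CT(1)) auto
      then show ?thesis using CT(3)[of h] by (simp add: \<Delta>_def b_def)
    qed
    have sq: "integrable lborel (\<lambda>u. (b u)\<^sup>2)" "(LINT u|lborel. (b u)\<^sup>2) = 1"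
      unfolding b_def by (rule bump_right_translate)+
    have small: "norm (dil \<upsilon> s u) \<le> s" if "norm u \<le> 1" for u
      using norm_dil_le[of s u] s that mult_left_le[of "norm u" s] by linarith
    have F1: "cmod (F u) \<le> C1 * s / P" if u: "norm u \<le> 1" for u
    proof -
      have "cmod (F u) \<le> C1 * norm (- dil \<upsilon> s u) / P"
        unfolding F_def P_def using small[OF u] s by (intro C1(2)) auto
      also have "\<dots> \<le> C1 * s / P"
        using small[OF u] C1(1) P by (intro divide_right_mono mult_left_mono) auto
      finally show ?thesis .
    qed
    have F2: "cmod (F u + F (- u)) \<le> C1 * s\<^sup>2 / P" if u: "norm u \<le> 1" for u
    proof -
      have "cmod (F u + F (- u)) \<le> C1 * (norm (- dil \<upsilon> s u))\<^sup>2 / P"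
        unfolding F_def P_def dil_minus using small[OF u] s by (intro C1(3)) auto
      also have "\<dots> \<le> C1 * s\<^sup>2 / P"
        using small[OF u] C1(1) P by (intro divide_right_mono mult_left_mono power_mono) auto
      finally show ?thesis .
    qed
    define Q where "Q = (\<lambda>u. complex_of_real (- (\<Delta> u)\<^sup>2 / 2) * \<kappa> x w + complex_of_real (bump u * \<Delta> u) * F u
        + complex_of_real ((bump u)\<^sup>2 / 2) * (F u + F (- u)))"
    define q where "q = (\<lambda>u. (\<Delta> u)\<^sup>2 / 2 * (C0 / P) + C1 / P * ((s\<^sup>2 * (bump u)\<^sup>2 + (\<Delta> u)\<^sup>2) / 2) + (bump u)\<^sup>2 / 2 * (C1 * s\<^sup>2 / P))"
    have gF: "integrable lborel (\<lambda>u. complex_of_real ((bump u)\<^sup>2) * F u)"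
    proof (rule integrable_dominated)
      show "integrable lborel (\<lambda>u. (bump u)\<^sup>2 * (C1 * s / P))" using bump_sq_integrable by (rule integrable_mult_left)
      show "cmod (complex_of_real ((bump u)\<^sup>2) * F u) \<le> (bump u)\<^sup>2 * (C1 * s / P)" for u
        using F1[of u] bump_outside[of u]
        by (cases "norm u \<le> 1") (auto simp: norm_mult norm_power simp del: times_divide_eq_right intro!: mult_left_mono)
    qed measurable
    have qi: "integrable lborel q" unfolding q_def
      by (intro Bochner_Integration.integrable_add integrable_mult_left integrable_mult_right integrable_divide
          \<Delta> bump_sq_integrable)
    have Qq: "cmod (Q u) \<le> q u" for u
    proof -
      have 1: "cmod (complex_of_real (- (\<Delta> u)\<^sup>2 / 2) * \<kappa> x w) \<le> (\<Delta> u)\<^sup>2 / 2 * (C0 / P)"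
        unfolding norm_mult norm_of_real P_def using C0(2)[of x w] by (intro mult_mono) auto
      have 2: "cmod (complex_of_real (bump u * \<Delta> u) * F u) \<le> C1 / P * ((s\<^sup>2 * (bump u)\<^sup>2 + (\<Delta> u)\<^sup>2) / 2)"
      proof (cases "norm u \<le> 1")
        case True
        have "s * (\<bar>bump u\<bar> * \<bar>\<Delta> u\<bar>) \<le> (s\<^sup>2 * (bump u)\<^sup>2 + (\<Delta> u)\<^sup>2) / 2"
          using mult_le_half_squares[of "s * \<bar>bump u\<bar>" "\<bar>\<Delta> u\<bar>"] by (simp add: power_mult_distrib mult_ac)
        then have "C1 / P * (s * (\<bar>bump u\<bar> * \<bar>\<Delta> u\<bar>)) \<le> C1 / P * ((s\<^sup>2 * (bump u)\<^sup>2 + (\<Delta> u)\<^sup>2) / 2)"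
          using C1(1) P by (intro mult_left_mono) auto
        moreover have "cmod (complex_of_real (bump u * \<Delta> u) * F u) \<le> (\<bar>bump u\<bar> * \<bar>\<Delta> u\<bar>) * (C1 * s / P)"
          unfolding norm_mult norm_of_real abs_mult by (rule mult_left_mono[OF F1[OF True]]) simp
        ultimately show ?thesis by (simp add: mult_ac)
      next
        case False
        then show ?thesis using bump_outside[of u] C1(1) P by simp
      qed
      have 3: "cmod (complex_of_real ((bump u)\<^sup>2 / 2) * (F u + F (- u))) \<le> (bump u)\<^sup>2 / 2 * (C1 * s\<^sup>2 / P)"
        unfolding norm_mult norm_of_real
        using F2[of u] bump_outside[of u] by (cases "norm u \<le> 1") (auto simp del: times_divide_eq_right intro!: mult_left_mono)
      show ?thesis unfolding Q_def q_def by (intro norm_triangle_mono 1 2 3)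
    qed
    have Qi: "integrable lborel Q"
      by (rule integrable_dominated[OF qi _ Qq]) (auto simp: Q_def[abs_def])
    have gF': "integrable lborel (\<lambda>u. complex_of_real ((bump u)\<^sup>2) * F (- u))"
      and gF_eq: "(LINT u|lborel. complex_of_real ((bump u)\<^sup>2) * F (- u)) = (LINT u|lborel. complex_of_real ((bump u)\<^sup>2) * F u)"
      using inversion_integrable[of "\<lambda>u. complex_of_real ((bump u)\<^sup>2) * F u"]
        inversion_integral[of "\<lambda>u. complex_of_real ((bump u)\<^sup>2) * F u"] gF by simp_all
    \<comment> \<open>the last term is odd in \<open>u\<close>\<close>
    have eq: "complex_of_real (bump u * bump (m u (- dil \<upsilon> s w))) * \<kappa> (m x (- dil \<upsilon> s u)) w =
        complex_of_real (((bump u)\<^sup>2 + (b u)\<^sup>2) / 2) * \<kappa> x w + Q u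
        + (complex_of_real ((bump u)\<^sup>2) * F u - complex_of_real ((bump u)\<^sup>2) * F (- u)) / 2" for u
    proof -
      have \<kappa>_eq: "\<kappa> (m x (- dil \<upsilon> s u)) w = \<kappa> x w + F u" by (simp add: F_def)
      have b_eq: "bump (m u (- dil \<upsilon> s w)) = bump u + \<Delta> u" by (simp add: \<Delta>_def b_def h_def)
      have "b u = bump u + \<Delta> u" by (simp add: \<Delta>_def)
      then show ?thesis unfolding \<kappa>_eq b_eq Q_def
        by (simp add: power2_eq_square field_simps)
    qed
    have int1: "integrable lborel (\<lambda>u. complex_of_real (((bump u)\<^sup>2 + (b u)\<^sup>2) / 2) * \<kappa> x w)"
      by (intro integrable_mult_left integrable_of_real integrable_divide Bochner_Integration.integrable_add sq(1) bump_sq_integrable)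
    have val1: "(LINT u|lborel. complex_of_real (((bump u)\<^sup>2 + (b u)\<^sup>2) / 2) * \<kappa> x w) = \<kappa> x w"
    proof -
      have "(LINT u|lborel. ((bump u)\<^sup>2 + (b u)\<^sup>2) / 2) = 1"
        using sq bump_sq_integrable[where 'a = "(real, 'n) vec"] by (simp add: bump_sq_integral)
      then show ?thesis
        by (simp only: Bochner_Integration.integral_mult_left_zero integral_complex_of_real) simp
    qed
    have "packet_kernel \<kappa> s x w = (LINT u|lborel. complex_of_real (((bump u)\<^sup>2 + (b u)\<^sup>2) / 2) * \<kappa> x w + Q u
        + (complex_of_real ((bump u)\<^sup>2) * F u - complex_of_real ((bump u)\<^sup>2) * F (- u)) / 2)"
      unfolding packet_kernel_def eq ..
    also have "\<dots> = \<kappa> x w + (LINT u|lborel. Q u)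
        + ((LINT u|lborel. complex_of_real ((bump u)\<^sup>2) * F u) - (LINT u|lborel. complex_of_real ((bump u)\<^sup>2) * F (- u))) / 2"
      using int1 val1 Qi gF gF'
      by (simp del: of_real_add of_real_divide of_real_power)
    finally have "packet_kernel \<kappa> s x w - \<kappa> x w = (LINT u|lborel. Q u)" unfolding gF_eq by simp
    then have "cmod (packet_kernel \<kappa> s x w - \<kappa> x w) \<le> (LINT u|lborel. q u)"
      using order_trans[OF integral_norm_bound integral_mono[OF integrable_norm[OF Qi] qi Qq]] by simp
    also have "\<dots> = (LINT u|lborel. (\<Delta> u)\<^sup>2) / 2 * (C0 / P) + C1 / P * ((s\<^sup>2 + (LINT u|lborel. (\<Delta> u)\<^sup>2)) / 2) + 1 / 2 * (C1 * s\<^sup>2 / P)"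
      unfolding q_def using \<Delta> bump_sq_integrable[where 'a = "(real, 'n) vec"] by (simp add: bump_sq_integral)
    also have "\<dots> \<le> CT * (s * norm w)\<^sup>2 / 2 * (C0 / P) + C1 / P * ((s\<^sup>2 + CT * (s * norm w)\<^sup>2) / 2) + 1 / 2 * (C1 * s\<^sup>2 / P)"
      using \<Delta>_le C0(1) C1(1) P by (intro add_mono mult_right_mono mult_left_mono divide_right_mono) auto
    also have "\<dots> \<le> (C0 * CT + C1 * CT + C1) * s\<^sup>2 * (1 + norm w)\<^sup>2 / P"
    proof -
      define W where "W = (1 + norm w)\<^sup>2"
      have W1: "1 \<le> W" unfolding W_def by (rule one_le_power) simp
      have W2: "(norm w)\<^sup>2 \<le> W" unfolding W_def by (intro power_mono) auto
      have "CT * (s * norm w)\<^sup>2 / 2 * (C0 / P) + C1 / P * ((s\<^sup>2 + CT * (s * norm w)\<^sup>2) / 2) + 1 / 2 * (C1 * s\<^sup>2 / P)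
        = ((C0 * CT / 2 + C1 * CT / 2) * s\<^sup>2 * (norm w)\<^sup>2 + C1 * s\<^sup>2) / P"
        using P by (simp add: power_mult_distrib field_simps)
      also have "\<dots> \<le> ((C0 * CT + C1 * CT) * s\<^sup>2 * W + C1 * s\<^sup>2 * W) / P"
      proof (intro divide_right_mono add_mono)
        show "(C0 * CT / 2 + C1 * CT / 2) * s\<^sup>2 * (norm w)\<^sup>2 \<le> (C0 * CT + C1 * CT) * s\<^sup>2 * W"
          using mult_nonneg_nonneg[OF C0(1) CT(1)] mult_nonneg_nonneg[OF C1(1) CT(1)] W2
          by (intro mult_mono) auto
        show "C1 * s\<^sup>2 \<le> C1 * s\<^sup>2 * W"
          using mult_left_mono[OF W1, of "C1 * s\<^sup>2"] C1(1) by simp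
      qed (use P in simp)
      also have "\<dots> = (C0 * CT + C1 * CT + C1) * s\<^sup>2 * (1 + norm w)\<^sup>2 / P"
        by (simp add: W_def algebra_simps)
      finally show ?thesis .
    qed
    also have "\<dots> = (C0 * CT + C1 * CT + C1) * s\<^sup>2 / (1 + norm w) ^ d"
    proof -
      have "1 + norm w \<noteq> 0" using norm_ge_zero[of w] by linarith
      then show ?thesis by (simp add: P_def power_add power2_eq_square)
    qed
    finally show ?thesis .
  qed
  show ?thesis
  proof (rule that)
    show "0 \<le> C0 * CT + C1 * CT + C1" using C0(1) C1(1) CT(1) by simp
  qed (use est in \<open>simp add: d_def\<close>)
qed

end


context graded
begin

lemma symbol_positivity:
  assumes pl: "plancherel_measure m \<mu>" and k: "has_kernel m \<sigma> \<kappa>" and nonneg: "nonneg_symbol \<mu> \<sigma>"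
  shows "AE x in lborel. \<forall>h\<in>L1 \<inter> L2. 0 \<le> Re (L2_inner (conv m h (\<kappa> x)) h)"
proof -
  have sf: "sigma_finite_measure \<mu>" and sp: "space \<mu> = unitary_dual m"
    using pl by (auto simp: plancherel_measure_def)
  interpret pair_sigma_finite "lborel :: (real, 'n) vec measure" \<mu>
    by (intro pair_sigma_finite.intro sf sigma_finite_lborel)
  have cc: "\<kappa> \<in> Cc_schwartz" using k by (simp add: has_kernel_def)
  obtain C where C: "\<And>x y. norm (\<kappa> x y) \<le> C / (1 + norm y) ^ 0"
    using Cc_schwartz_decay[OF cc] by metis
  have "AE x in lborel. AE c in \<mu>. \<forall>\<pi>\<in>c. nonneg_op (fst \<pi>) (\<sigma> x \<pi>)"
    using AE_pair[OF nonneg[unfolded nonneg_symbol_def]] by simp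
  then show ?thesis
  proof (rule AE_mp[OF _ AE_I2], intro impI ballI)
    fix x and h :: "(real, 'n) vec \<Rightarrow> complex"
    assume ae: "AE c in \<mu>. \<forall>\<pi>\<in>c. nonneg_op (fst \<pi>) (\<sigma> x \<pi>)" and h: "h \<in> L1 \<inter> L2"
    have "AE c in \<mu>. \<forall>\<pi>\<in>c. nonneg_op (fst \<pi>) (fourier (\<kappa> x) \<pi>)"
      using ae
    proof (rule AE_mp[OF _ AE_I2], intro impI ballI)
      fix c \<pi> assume c: "c \<in> space \<mu>" and n: "\<forall>\<pi>\<in>c. nonneg_op (fst \<pi>) (\<sigma> x \<pi>)" and \<pi>: "\<pi> \<in> c"
      have "\<pi> \<in> irreps m" using c \<pi> unfolding sp unitary_dual_def by (auto elim: quotientE)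
      then show "nonneg_op (fst \<pi>) (fourier (\<kappa> x) \<pi>)"
        using n \<pi> k by (auto simp: nonneg_op_def has_kernel_def)
    qed
    moreover have "\<kappa> x \<in> L1" using Cc_schwartz_L1_L2[OF cc] by blast
    moreover have "\<And>y. cmod (\<kappa> x y) \<le> C" using C by simp
    ultimately show "0 \<le> Re (L2_inner (conv m h (\<kappa> x)) h)"
      using conv_nonneg[OF pl h] by blast
  qed
qed

lemma reflected_translation_integral:
  fixes F :: "(real, 'n) vec \<Rightarrow> 'b::{banach, second_countable_topology}"
  assumes [measurable]: "F \<in> borel_measurable borel"
  shows "(LINT z|lborel. F z) = (LINT u|lborel. F (m a (- u)))"
  using inversion_integral[of "\<lambda>u. F (m a u)"] left_integral[of F a] by simp

lemma bump_orbit: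
  shows "integrable lborel (\<lambda>z. bump (m (- z) a) * bump (m (- z) b))"
    and "(LINT z|lborel. bump (m (- z) a) * bump (m (- z) b)) \<le> 1"
proof -
  have sq: "integrable lborel (\<lambda>z. (bump (m (- z) a))\<^sup>2)" "(LINT z|lborel. (bump (m (- z) a))\<^sup>2) = 1" for a
    using inversion_integrable[of "\<lambda>u. (bump (m u a))\<^sup>2"] inversion_integral[of "\<lambda>u. (bump (m u a))\<^sup>2"]
    by (simp_all add: bump_right_translate)
  have le: "bump (m (- z) a) * bump (m (- z) b) \<le> ((bump (m (- z) a))\<^sup>2 + (bump (m (- z) b))\<^sup>2) / 2" for z
    by (rule mult_le_half_squares)
  have i: "integrable lborel (\<lambda>z. ((bump (m (- z) a))\<^sup>2 + (bump (m (- z) b))\<^sup>2) / 2)"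
    using sq(1) by simp
  show int: "integrable lborel (\<lambda>z. bump (m (- z) a) * bump (m (- z) b))"
    by (rule integrable_dominated[OF i]) (use le in \<open>auto simp: abs_mult bump_nonneg\<close>)
  have "(LINT z|lborel. bump (m (- z) a) * bump (m (- z) b)) \<le> (LINT z|lborel. ((bump (m (- z) a))\<^sup>2 + (bump (m (- z) b))\<^sup>2) / 2)"
    by (rule integral_mono[OF int i]) (rule le)
  also have "\<dots> = 1" using sq by simp
  finally show "(LINT z|lborel. bump (m (- z) a) * bump (m (- z) b)) \<le> 1" .
qed

text \<open>Localization makes \<open>f\<close> integrable, as the Plancherel formula requires.\<close>

lemma localize_L1_L2:
  assumes f: "f \<in> L2" and s: "0 < s"
  shows "(\<lambda>y. f y * complex_of_real (bump (m (- z) (dil \<upsilon> s y)))) \<in> L1 \<inter> L2"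
proof -
  define g where "g = (\<lambda>y. bump (m (- z) (dil \<upsilon> s y)))"
  have [measurable]: "f \<in> borel_measurable borel" "g \<in> borel_measurable borel"
    using f by (auto simp: L2_def g_def)
  have f2: "integrable lborel (\<lambda>x. (cmod (f x))\<^sup>2)" using f by (simp add: L2_def)
  have "integrable lborel (\<lambda>y. (bump (m (- z) y))\<^sup>2)"
    using left_integrable[of "\<lambda>u. (bump u)\<^sup>2" "- z"] by (simp add: bump_sq_integrable)
  then have g2: "integrable lborel (\<lambda>y. (g y)\<^sup>2)"
    unfolding g_def using dil_integrable[of "\<lambda>y. (bump (m (- z) y))\<^sup>2" s] s by simp
  obtain L where L: "0 \<le> L" "\<And>u :: (real, 'n) vec. bump u \<le> L" using bump_lipschitz by metis
  have "integrable lborel (\<lambda>y. f y * complex_of_real (g y))"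
  proof (rule integrable_dominated)
    show "integrable lborel (\<lambda>y. ((cmod (f y))\<^sup>2 + \<bar>g y\<bar>\<^sup>2) / 2)" using f2 g2 by simp
    show "norm (f y * complex_of_real (g y)) \<le> ((cmod (f y))\<^sup>2 + \<bar>g y\<bar>\<^sup>2) / 2" for y
      unfolding norm_mult norm_of_real by (rule mult_le_half_squares)
  qed measurable
  moreover have "integrable lborel (\<lambda>y. (cmod (f y * complex_of_real (g y)))\<^sup>2)"
  proof (rule integrable_dominated)
    show "integrable lborel (\<lambda>y. (cmod (f y))\<^sup>2 * L\<^sup>2)" using f2 by simp
    have "(g y)\<^sup>2 \<le> L\<^sup>2" for y unfolding g_def by (intro power_mono L bump_nonneg)
    then show "norm ((cmod (f y * complex_of_real (g y)))\<^sup>2) \<le> (cmod (f y))\<^sup>2 * L\<^sup>2" for y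
      by (simp add: norm_mult power_mult_distrib mult_left_mono)
  qed measurable
  ultimately show ?thesis by (simp add: L1_def L2_def g_def)
qed

text \<open>By Fubini the average of the non-negative localized forms is the form of the packet kernel, which
  the Schur test compares with the form of \<open>\<kappa>\<close>.  Absolute convergence of the triple integral holds
  since \<open>\<integral> g(z\<inverse>a) g(z\<inverse>b) dz \<le> 1\<close>.\<close>

theorem wave_packet_lower_bound:
  assumes \<kappa>: "\<kappa> \<in> Cc_schwartz"
    and pos: "AE x in lborel. \<forall>h\<in>L1 \<inter> L2. 0 \<le> Re (L2_inner (conv m h (\<kappa> x)) h)"
  obtains C where "0 \<le> C" "\<And>f s. f \<in> L2 \<Longrightarrow> 0 < s \<Longrightarrow> s \<le> 1 \<Longrightarrow>
    - C * s\<^sup>2 * (LINT x|lborel. (cmod (f x))\<^sup>2) \<le>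
      Re (LINT x|lborel. (LINT y|lborel. f y * \<kappa> (dil \<upsilon> (s\<^sup>2) x) (m (- y) x)) * cnj (f x))"
proof -
  define d where "d = 2 * DIM((real, 'n) vec)"
  define \<rho> where "\<rho> = (\<lambda>w :: (real, 'n) vec. 1 / (1 + norm w) ^ d)"
  have \<rho>: "integrable lborel \<rho>" unfolding \<rho>_def d_def by (rule decay_integrable)
  have \<rho>0: "0 \<le> \<rho> w" and \<rho>_even: "\<rho> (- w) = \<rho> w" for w by (simp_all add: \<rho>_def)
  define I where "I = (LINT w|lborel. \<rho> w)"
  have I0: "0 \<le> I" unfolding I_def by (rule Bochner_Integration.integral_nonneg) (rule \<rho>0)
  obtain C0 where C0: "0 \<le> C0" "\<And>x w. norm (\<kappa> x w) \<le> C0 * \<rho> w"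
    using Cc_schwartz_decay[OF \<kappa>, of d] unfolding \<rho>_def by auto
  obtain C1 where C1: "0 \<le> C1" "\<And>s x w. 0 < s \<Longrightarrow> s \<le> 1 \<Longrightarrow> cmod (packet_kernel \<kappa> s x w - \<kappa> x w) \<le> C1 * s\<^sup>2 * \<rho> w"
    using packet_kernel_estimate[OF \<kappa>] unfolding \<rho>_def d_def by auto
  have "- (C1 * I) * s\<^sup>2 * (LINT x|lborel. (cmod (f x))\<^sup>2) \<le>
      Re (LINT x|lborel. (LINT y|lborel. f y * \<kappa> (dil \<upsilon> (s\<^sup>2) x) (m (- y) x)) * cnj (f x))"
    if f: "f \<in> L2" and s: "0 < s" "s \<le> 1" for f s
  proof -
    let ?M = "lborel :: (real, 'n) vec measure" and ?P = "(lborel :: (real, 'n) vec measure) \<Otimes>\<^sub>M (lborel :: (real, 'n) vec measure)"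
    interpret Q: pair_sigma_finite ?P ?M
      by (intro pair_sigma_finite.intro sigma_finite_pair_measure sigma_finite_lborel)
    have [measurable]: "f \<in> borel_measurable borel" "\<rho> \<in> borel_measurable borel" using f \<rho> by (auto simp: L2_def)
    note [measurable] = kernel_measurable[OF \<kappa>]
    define A where "A = (\<lambda>p. cmod (f (fst p)) * cmod (f (snd p)) * \<rho> (m (- snd p) (fst p)))"
    have A: "integrable ?P A" and A_le: "(LINT p|?P. A p) \<le> I * (LINT x|lborel. (cmod (f x))\<^sup>2)"
      unfolding A_def I_def by (rule schur_test[OF f \<rho> \<rho>0 \<rho>_even])+
    have A0: "0 \<le> A p" for p by (simp add: A_def \<rho>0)
    define \<Phi> where "\<Phi> = (\<lambda>p. f (snd p) * \<kappa> (dil \<upsilon> (s\<^sup>2) (fst p)) (m (- snd p) (fst p)) * cnj (f (fst p)))"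
    define G where "G = (\<lambda>p z. bump (m (- z) (dil \<upsilon> s (fst p))) * bump (m (- z) (dil \<upsilon> s (snd p))))"
    have G: "0 \<le> G p z" "integrable ?M (G p)" "(LINT z|lborel. G p z) \<le> 1" for p z
      unfolding G_def by (simp_all add: bump_nonneg bump_orbit)
    define q where "q = (\<lambda>p z. complex_of_real (G p z) * (f (snd p) * \<kappa> (dil \<upsilon> s z) (m (- snd p) (fst p)) * cnj (f (fst p))))"
    have [measurable]: "\<Phi> \<in> borel_measurable ?P"
      unfolding \<Phi>_def by measurable
    have qm [measurable]: "case_prod q \<in> borel_measurable (?P \<Otimes>\<^sub>M ?M)"
      unfolding q_def G_def by measurable
    have form_bound: "cmod (f y * \<kappa> v (m (- y) x) * cnj (f x)) \<le> C0 * A (x, y)" for x y v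
    proof -
      have "cmod (f y) * cmod (f x) * cmod (\<kappa> v (m (- y) x)) \<le> cmod (f y) * cmod (f x) * (C0 * \<rho> (m (- y) x))"
        by (intro mult_left_mono C0(2)) auto
      then show ?thesis by (simp add: norm_mult A_def mult_ac)
    qed
    have q_bound: "cmod (q p z) \<le> G p z * (C0 * A p)" for p z
      using mult_left_mono[OF form_bound[of "snd p" "dil \<upsilon> s z" "fst p"] G(1)]
      by (simp add: q_def norm_mult abs_mult G(1))
    have q_meas: "q p \<in> borel_measurable borel" for p unfolding q_def G_def by measurable
    have q_slice: "integrable ?M (q p)" for p
      by (rule integrable_dominated[OF integrable_mult_left[OF G(2)] _ q_bound]) (simp add: q_meas)
    have q_int: "integrable (?P \<Otimes>\<^sub>M ?M) (case_prod q)"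
    proof (rule Q.Fubini_integrable)
      have le: "(LINT z|lborel. cmod (q p z)) \<le> C0 * A p" for p
      proof -
        have "(LINT z|lborel. cmod (q p z)) \<le> (LINT z|lborel. G p z * (C0 * A p))"
          by (intro integral_mono integrable_norm q_slice q_bound integrable_mult_left G(2))
        also have "\<dots> \<le> 1 * (C0 * A p)"
          unfolding Bochner_Integration.integral_mult_left_zero
          by (intro mult_right_mono G(3)) (simp add: A0 C0(1))
        finally show ?thesis by simp
      qed
      show "integrable ?P (\<lambda>p. LINT z|lborel. norm (case (p, z) of (p, z) \<Rightarrow> q p z))"
      proof (rule integrable_dominated)
        show "integrable ?P (\<lambda>p. C0 * A p)" using A by simp
        show "(\<lambda>p. LINT z|lborel. norm (case (p, z) of (p, z) \<Rightarrow> q p z)) \<in> borel_measurable ?P" using qm by measurable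
      qed (use le in simp)
    qed (use qm q_slice in auto)
    have q_integral: "(LINT z|lborel. q p z) =
        f (snd p) * packet_kernel \<kappa> s (dil \<upsilon> (s\<^sup>2) (fst p)) (m (- snd p) (fst p)) * cnj (f (fst p))" for p
    proof -
      define a where "a = dil \<upsilon> s (fst p)"
      define w where "w = m (- snd p) (fst p)"
      have w: "m (- a) (dil \<upsilon> s (snd p)) = - dil \<upsilon> s w"
        unfolding a_def w_def by (simp add: minus_mult flip: dil_minus dil_mult)
      have "m (- m a (- u)) a = u" "m (- m a (- u)) (dil \<upsilon> s (snd p)) = m u (- dil \<upsilon> s w)"
        "dil \<upsilon> s (m a (- u)) = m (dil \<upsilon> (s\<^sup>2) (fst p)) (- dil \<upsilon> s u)" for u
        by (simp_all add: minus_mult assoc w dil_mult dil_minus power2_eq_square) (simp_all add: a_def dil_dil)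
      \<comment> \<open>the substitution \<open>z = a (- u)\<close>\<close>
      note sub = this
      have "(LINT z|lborel. q p z) = (LINT u|lborel. q p (m a (- u)))"
        by (rule reflected_translation_integral[OF q_meas])
      also have "\<dots> = (LINT u|lborel. f (snd p) * cnj (f (fst p)) *
          (complex_of_real (bump u * bump (m u (- dil \<upsilon> s w))) * \<kappa> (m (dil \<upsilon> (s\<^sup>2) (fst p)) (- dil \<upsilon> s u)) w))"
        unfolding q_def G_def by (simp add: sub mult_ac flip: a_def w_def)
      also have "\<dots> = f (snd p) * packet_kernel \<kappa> s (dil \<upsilon> (s\<^sup>2) (fst p)) w * cnj (f (fst p))"
        by (simp add: packet_kernel_def)
      finally show ?thesis by (simp add: w_def)
    qed
    have T0: "0 \<le> Re (LINT p|?P. (LINT z|lborel. q p z))"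
    proof -
      have ae1: "AE z in lborel. \<forall>h\<in>L1 \<inter> L2. 0 \<le> Re (L2_inner (conv m h (\<kappa> (dil \<upsilon> s z))) h)"
        by (rule dil_AE[OF s(1) pos])
      have ae2: "AE z in lborel. integrable ?P (\<lambda>p. q p z)" by (rule Q.AE_integrable_snd[OF q_int])
      have ae: "AE z in lborel. 0 \<le> Re (LINT p|?P. q p z)"
        using ae1 ae2
      proof eventually_elim
        case (elim z)
        define h where "h = (\<lambda>y. f y * complex_of_real (bump (m (- z) (dil \<upsilon> s y))))"
        have h: "h \<in> L1 \<inter> L2" unfolding h_def by (rule localize_L1_L2[OF f s(1)])
        have "(LINT p|?P. q p z) = (LINT x|lborel. LINT y|lborel. q (x, y) z)"
          using lborel_pair.integral_fst'[OF elim(2)] by simp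
        also have "\<dots> = L2_inner (conv m h (\<kappa> (dil \<upsilon> s z))) h"
          unfolding L2_inner_def conv_def
          by (simp add: q_def G_def h_def mult_ac flip: Bochner_Integration.integral_mult_left_zero Bochner_Integration.integral_mult_right_zero)
        finally show ?case using elim(1) h by simp
      qed
      have i: "integrable lborel (\<lambda>z. LINT p|?P. q p z)" by (rule Q.integrable_snd[OF q_int])
      have "(LINT p|?P. (LINT z|lborel. q p z)) = (LINT z|lborel. (LINT p|?P. q p z))"
        by (rule Q.Fubini_integral[OF q_int, symmetric])
      then have "Re (LINT p|?P. (LINT z|lborel. q p z)) = (LINT z|lborel. Re (LINT p|?P. q p z))"
        by (simp add: integral_Re[OF i])
      also have "0 \<le> \<dots>" by (rule integral_nonneg_AE[OF ae])
      finally show ?thesis .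
    qed
    have \<Phi>: "integrable ?P \<Phi>"
    proof (rule integrable_dominated)
      show "integrable ?P (\<lambda>p. C0 * A p)" using A by simp
      show "norm (\<Phi> p) \<le> C0 * A p" for p
        using form_bound[of "snd p" _ "fst p"] by (simp add: \<Phi>_def)
    qed measurable
    have qp: "integrable ?P (\<lambda>p. LINT z|lborel. q p z)" by (rule Q.integrable_fst[OF q_int])
    have diff: "cmod (\<Phi> p - (LINT z|lborel. q p z)) \<le> C1 * s\<^sup>2 * A p" for p
    proof -
      define w where "w = m (- snd p) (fst p)"
      define X where "X = dil \<upsilon> (s\<^sup>2) (fst p)"
      have "\<Phi> p - (LINT z|lborel. q p z) = f (snd p) * (\<kappa> X w - packet_kernel \<kappa> s X w) * cnj (f (fst p))"
        unfolding q_integral by (simp add: \<Phi>_def w_def X_def algebra_simps)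
      then have "cmod (\<Phi> p - (LINT z|lborel. q p z)) = cmod (f (fst p)) * cmod (f (snd p)) * cmod (packet_kernel \<kappa> s X w - \<kappa> X w)"
        by (simp add: norm_mult norm_minus_commute)
      also have "\<dots> \<le> cmod (f (fst p)) * cmod (f (snd p)) * (C1 * s\<^sup>2 * \<rho> w)"
        by (intro mult_left_mono C1(2) s) auto
      finally show ?thesis by (simp add: A_def w_def mult_ac)
    qed
    have "cmod (LINT p|?P. \<Phi> p - (LINT z|lborel. q p z)) \<le> (LINT p|?P. C1 * s\<^sup>2 * A p)"
      using \<Phi> qp A diff
      by (intro order_trans[OF integral_norm_bound] integral_mono) (auto intro!: integrable_norm)
    also have "\<dots> \<le> C1 * s\<^sup>2 * (I * (LINT x|lborel. (cmod (f x))\<^sup>2))"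
      using A_le C1(1) by (simp add: mult_left_mono)
    finally have "\<bar>Re (LINT p|?P. \<Phi> p - (LINT z|lborel. q p z))\<bar> \<le> C1 * s\<^sup>2 * (I * (LINT x|lborel. (cmod (f x))\<^sup>2))"
      using abs_Re_le_cmod order_trans by blast
    moreover have "(LINT p|?P. \<Phi> p) = (LINT p|?P. \<Phi> p - (LINT z|lborel. q p z)) + (LINT p|?P. (LINT z|lborel. q p z))"
      using \<Phi> qp by simp
    ultimately have "- (C1 * I) * s\<^sup>2 * (LINT x|lborel. (cmod (f x))\<^sup>2) \<le> Re (LINT p|?P. \<Phi> p)"
      using T0 by (simp add: mult_ac)
    also have "(LINT p|?P. \<Phi> p) = (LINT x|lborel. LINT y|lborel. \<Phi> (x, y))"
      using lborel_pair.integral_fst'[OF \<Phi>] by simp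
    also have "\<dots> = (LINT x|lborel. (LINT y|lborel. f y * \<kappa> (dil \<upsilon> (s\<^sup>2) x) (m (- y) x)) * cnj (f x))"
      by (simp add: \<Phi>_def)
    finally show ?thesis .
  qed
  then show ?thesis using C1(1) I0 by (intro that[of "C1 * I"]) auto
qed

lemma L2_dil: "f \<in> L2 \<Longrightarrow> 0 < r \<Longrightarrow> (\<lambda>x. f (dil \<upsilon> r x)) \<in> L2"
  using dil_integrable[of "\<lambda>x. (cmod (f x))\<^sup>2" r] by (auto simp: L2_def)

text \<open>In the coordinates \<open>x = \<delta>\<^sub>\<epsilon> x'\<close> the dilated kernel becomes \<open>\<kappa>\<close> at the slowly varying point
  \<open>\<delta>\<^sub>\<epsilon> x'\<close>.\<close>

lemma Op_eps_rescaled: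
  assumes pl: "plancherel_measure m \<mu>" and k: "has_kernel m \<sigma> \<kappa>" and r: "0 < \<epsilon>" and f: "f \<in> L2"
  shows "L2_inner (Op_eps \<upsilon> m \<epsilon> \<sigma> f) f = \<epsilon> ^ hdim *\<^sub>R (LINT x|lborel.
    (LINT y|lborel. f (dil \<upsilon> \<epsilon> y) * \<kappa> (dil \<upsilon> \<epsilon> x) (m (- y) x)) * cnj (f (dil \<upsilon> \<epsilon> x)))"
proof -
  have cc: "\<kappa> \<in> Cc_schwartz" using k by (simp add: has_kernel_def)
  note [measurable] = kernel_measurable[OF cc]
  have [measurable]: "f \<in> borel_measurable borel" using f by (simp add: L2_def)
  define H where "H = (\<lambda>x. conv m f (\<lambda>y. complex_of_real ((1 / \<epsilon>) ^ hdim) * \<kappa> x (dil \<upsilon> (1 / \<epsilon>) y)) x)"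
  have [measurable]: "H \<in> borel_measurable borel" unfolding H_def conv_def by measurable
  have H: "H (dil \<upsilon> \<epsilon> x) = (LINT y|lborel. f (dil \<upsilon> \<epsilon> y) * \<kappa> (dil \<upsilon> \<epsilon> x) (m (- y) x))" for x
  proof -
    have "H (dil \<upsilon> \<epsilon> x) = \<epsilon> ^ hdim *\<^sub>R (LINT y|lborel. f (dil \<upsilon> \<epsilon> y) * (complex_of_real ((1 / \<epsilon>) ^ hdim) *
        \<kappa> (dil \<upsilon> \<epsilon> x) (dil \<upsilon> (1 / \<epsilon>) (m (- dil \<upsilon> \<epsilon> y) (dil \<upsilon> \<epsilon> x)))))"
      unfolding H_def conv_def by (rule dil_integral[OF _ r]) measurable
    also have "\<dots> = \<epsilon> ^ hdim *\<^sub>R (LINT y|lborel. complex_of_real ((1 / \<epsilon>) ^ hdim) * (f (dil \<upsilon> \<epsilon> y) * \<kappa> (dil \<upsilon> \<epsilon> x) (m (- y) x)))"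
      using r by (simp add: mult_ac flip: dil_minus dil_mult)
    also have "\<dots> = (LINT y|lborel. f (dil \<upsilon> \<epsilon> y) * \<kappa> (dil \<upsilon> \<epsilon> x) (m (- y) x))"
      using r by (simp add: scaleR_conv_of_real power_one_over)
    finally show ?thesis .
  qed
  have "L2_inner (Op_eps \<upsilon> m \<epsilon> \<sigma> f) f = (LINT x|lborel. H x * cnj (f x))"
    by (simp add: L2_inner_def Op_eps_eq[OF pl k r] H_def)
  also have "\<dots> = \<epsilon> ^ hdim *\<^sub>R (LINT x|lborel. H (dil \<upsilon> \<epsilon> x) * cnj (f (dil \<upsilon> \<epsilon> x)))"
    by (rule dil_integral[OF _ r]) measurable
  finally show ?thesis unfolding H .
qed

theorem garding_inequality:
  assumes pl: "plancherel_measure m \<mu>" and \<sigma>: "\<sigma> \<in> A0 m" and nonneg: "nonneg_symbol \<mu> \<sigma>"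
  shows "\<exists>C>0. \<forall>f\<in>L2. \<forall>\<epsilon>\<in>{0<..1}.
           Re (L2_inner (Op_eps \<upsilon> m \<epsilon> \<sigma> f) f) \<ge> - C * \<epsilon> * (L2_norm f)\<^sup>2"
proof -
  obtain \<kappa> where k: "has_kernel m \<sigma> \<kappa>" using \<sigma> by (auto simp: A0_def)
  have cc: "\<kappa> \<in> Cc_schwartz" using k by (simp add: has_kernel_def)
  obtain C where C: "0 \<le> C" "\<And>f s. f \<in> L2 \<Longrightarrow> 0 < s \<Longrightarrow> s \<le> 1 \<Longrightarrow>
    - C * s\<^sup>2 * (LINT x|lborel. (cmod (f x))\<^sup>2) \<le>
      Re (LINT x|lborel. (LINT y|lborel. f y * \<kappa> (dil \<upsilon> (s\<^sup>2) x) (m (- y) x)) * cnj (f x))"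
    using wave_packet_lower_bound[OF cc symbol_positivity[OF pl k nonneg]] by blast
  have "- (C + 1) * \<epsilon> * (L2_norm f)\<^sup>2 \<le> Re (L2_inner (Op_eps \<upsilon> m \<epsilon> \<sigma> f) f)"
    if f: "f \<in> L2" and \<epsilon>: "0 < \<epsilon>" "\<epsilon> \<le> 1" for f \<epsilon>
  proof -
    have [measurable]: "f \<in> borel_measurable borel" using f by (simp add: L2_def)
    define N where "N = (LINT x|lborel. (cmod (f (dil \<upsilon> \<epsilon> x)))\<^sup>2)"
    have norm: "(L2_norm f)\<^sup>2 = \<epsilon> ^ hdim * N"
      using dil_integral[of "\<lambda>x. (cmod (f x))\<^sup>2" \<epsilon>] \<epsilon>(1) by (simp add: L2_norm_def N_def)
    have "- C * (sqrt \<epsilon>)\<^sup>2 * N \<le> Re (LINT x|lborel. (LINT y|lborel. f (dil \<upsilon> \<epsilon> y) *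
        \<kappa> (dil \<upsilon> ((sqrt \<epsilon>)\<^sup>2) x) (m (- y) x)) * cnj (f (dil \<upsilon> \<epsilon> x)))"
      unfolding N_def using \<epsilon> by (intro C(2) L2_dil f) auto
    then have "\<epsilon> ^ hdim * (- C * (sqrt \<epsilon>)\<^sup>2 * N) \<le> \<epsilon> ^ hdim * Re (LINT x|lborel. (LINT y|lborel. f (dil \<upsilon> \<epsilon> y) *
        \<kappa> (dil \<upsilon> ((sqrt \<epsilon>)\<^sup>2) x) (m (- y) x)) * cnj (f (dil \<upsilon> \<epsilon> x)))"
      using \<epsilon>(1) by (intro mult_left_mono) auto
    then have "\<epsilon> ^ hdim * (- C * \<epsilon> * N) \<le> Re (L2_inner (Op_eps \<upsilon> m \<epsilon> \<sigma> f) f)"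
      unfolding Op_eps_rescaled[OF pl k \<epsilon>(1) f] using \<epsilon>(1) by simp
    then have "- (C * \<epsilon> * (L2_norm f)\<^sup>2) \<le> Re (L2_inner (Op_eps \<upsilon> m \<epsilon> \<sigma> f) f)"
      by (simp add: norm mult_ac)
    moreover have "0 \<le> \<epsilon> * (L2_norm f)\<^sup>2" using \<epsilon> by simp
    ultimately show ?thesis by (simp add: algebra_simps)
  qed
  then show ?thesis using C(1) by (intro exI[of _ "C + 1"]) auto
qed

end

theorem theorem1p3:
  fixes \<upsilon> :: "'n::{finite,linorder} \<Rightarrow> nat"
    and m :: "(real, 'n) vec \<Rightarrow> (real, 'n) vec \<Rightarrow> (real, 'n) vec"
    and \<mu> :: "(real, 'n) vec rep set measure"
    and \<sigma> :: "(real, 'n) vec symbol"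
  assumes "graded_group \<upsilon> m"
    and "plancherel_measure m \<mu>"
    and "\<sigma> \<in> A0 m"
    and "nonneg_symbol \<mu> \<sigma>"
  shows "\<exists>C>0. \<forall>f\<in>L2. \<forall>\<epsilon>\<in>{0<..1}.
           Re (L2_inner (Op_eps \<upsilon> m \<epsilon> \<sigma> f) f) \<ge> - C * \<epsilon> * (L2_norm f)\<^sup>2"
proof -
  interpret graded \<upsilon> m by unfold_locales (rule assms(1))
  show ?thesis by (rule garding_inequality[OF assms(2-4)])
qed

end
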